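(* (1) The functor $-_\pi:\mathcal{SC}at\to\Pi\text{-}\mathcal{SC}at$, $\mathcal A\mapsto\mathcal A_\pi$, $F\mapsto F_\pi$, is left 2-adjoint to the forgetful functor $\nu:\Pi\text{-}\mathcal{SC}at\to\mathcal{SC}at$, in the sense that there is a superequivalence $\mathcal Hom(\mathcal A,\nu\mathcal B)\to\mathcal Hom(\mathcal A_\pi,\mathcal B)$ for every supercategory $\mathcal A$ and every $\Pi$-supercategory $\mathcal B$. (2) The functor $\Pi\text{-}\mathcal{SC}at\to\Pi\text{-}\mathcal Cat$ sending a $\Pi$-supercategory $(\mathcal A,\Pi,\zeta)$ to its underlying $\Pi$-category $(\underline{\mathcal A},\underline\Pi,\xi)$ with $\xi:=\zeta\zeta$, and a superfunctor $F:(\mathcal A,\Pi_{\mathcal A},\zeta_{\mathcal A})\to(\mathcal B,\Pi_{\mathcal B},\zeta_{\mathcal B})$ to the $\Pi$-functor $(\underline F,\beta_F)$ with $\beta_F:=-\zeta_{\mathcal B}F\zeta_{\mathcal A}^{-1}:\Pi_{\mathcal B}F\Rightarrow F\Pi_{\mathcal A}$, is an equivalence of categories.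
   Context: Let $k$ be a field of characteristic different from 2. A superspace is a $\mathbb Z/2$-graded $k$-vector space $V=V_{\bar0}\oplus V_{\bar1}$; $|v|$ is the parity of a homogeneous $v$; formulae with $|v|$ are extended additively. A linear map is even (odd) if it preserves (reverses) parity. A supercategory is a category whose morphism sets are superspaces, with composition bilinear and inducing an even linear map. A superfunctor is a functor inducing even linear maps on morphism superspaces. For superfunctors $F,G:\mathcal A\to\mathcal B$, a supernatural transformation $x:F\Rightarrow G$ is a family $x_\lambda=x_{\lambda,\bar0}+x_{\lambda,\bar1}\in\mathrm{Hom}_{\mathcal B}(F\lambda,G\lambda)$ with $|x_{\lambda,p}|=p$ and $x_{\mu,p}\circ Ff=(-1)^{p|f|}Gf\circ x_{\lambda,p}$ for all $p\in\mathbb Z/2$, $f\in\mathrm{Hom}_{\mathcal A}(\lambda,\mu)$; it is even (odd) if all $x_\lambda$ are. $\mathcal Hom(\mathcal A,\mathcal B)$ is the supercategory of superfunctors and supernatural transformations. For $x:F\Rightarrow H$ between superfunctors $\mathcal A\to\mathcal B$ and $y:G\Rightarrow K$ between superfunctors $\mathcal B\to\mathcal C$, the horizontal composition $yx:GF\Rightarrow KH$ is $(yx)_\lambda:=y_{H\lambda}\circ Gx_\lambda$; a functor symbol inside such an expression denotes its identity transformation. A superfunctor is a superequivalence if it has a quasi-inverse superfunctor such that both composites are isomorphic to identities via even supernatural isomorphisms. The underlying category $\underline{\mathcal A}$ has the same objects and only the even morphisms; $\underline F$ is the restriction of $F$. A $\Pi$-supercategory $(\mathcal A,\Pi,\zeta)$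 is a supercategory $\mathcal A$ with a superfunctor $\Pi:\mathcal A\to\mathcal A$ and an odd supernatural isomorphism $\zeta:\Pi\Rightarrow I$. With $\xi=\zeta\zeta$ one has $\xi_\lambda=\zeta_\lambda\circ\Pi\zeta_\lambda=-\zeta_\lambda\circ\zeta_{\Pi\lambda}$. Explicitly $(\beta_F)_\lambda=(F(\zeta_{\mathcal A})_\lambda)^{-1}\circ(\zeta_{\mathcal B})_{F\lambda}$. A $\Pi$-category $(\mathcal A,\Pi,\xi)$ is a $k$-linear category with a $k$-linear endofunctor $\Pi$ and a natural isomorphism $\xi:\Pi^2\Rightarrow I$ with $\xi\Pi=\Pi\xi$. A $\Pi$-functor $\mathcal A\to\mathcal B$ is a $k$-linear functor $F$ with a natural isomorphism $\beta_F:\Pi_{\mathcal B}F\Rightarrow F\Pi_{\mathcal A}$ such that $\xi_{\mathcal B}F\xi_{\mathcal A}^{-1}=\beta_F\Pi_{\mathcal A}\circ\Pi_{\mathcal B}\beta_F$ in $\mathrm{Hom}(\Pi_{\mathcal B}^2F,F\Pi_{\mathcal A}^2)$; composition is given by $\beta_{GF}:=G\beta_F\circ\beta_GF$, and $\beta_I=1_\Pi$. $\mathcal{SC}at$: the category of supercategories and superfunctors. $\Pi\text{-}\mathcal{SC}at$: the category of $\Pi$-supercategories and (all) superfunctors. $\Pi\text{-}\mathcal Cat$: the category of $\Pi$-categories and $\Pi$-functors. The functor $\nu$ forgets $\Pi$ and $\zeta$. The $\Pi$-envelope $\mathcal A_\pi$ of a supercategory $\mathcal A$ has objects $\Pi^a\lambda$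 ($\lambda\in\mathrm{ob}\,\mathcal A$, $a\in\mathbb Z/2$) and $\mathrm{Hom}_{\mathcal A_\pi}(\Pi^a\lambda,\Pi^b\mu):=\Pi^{a+b}\mathrm{Hom}_{\mathcal A}(\lambda,\mu)$, where on superspaces $\Pi$ reverses the grading; the morphism coming from a homogeneous $f:\lambda\to\mu$ is written $f_a^b$ and has parity $|f|+a+b$. Composition: $f_b^c\circ g_a^b:=(f\circ g)_a^c$. It is a $\Pi$-supercategory with $\Pi(\Pi^a\lambda):=\Pi^{a+\bar1}\lambda$, $\zeta_{\Pi^a\lambda}:=(1_\lambda)_{a+\bar1}^a$ (the effect of $\Pi$ on morphisms being forced by supernaturality of $\zeta$). For a superfunctor $F:\mathcal A\to\mathcal B$, $F_\pi$ sends $\Pi^a\lambda\mapsto\Pi^a(F\lambda)$ and $f_a^b\mapsto(Ff)_a^b$. *)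

theory Defs
  imports "HOL-Algebra.Module" "HOL-Library.Z2"
begin

text \<open>
  Parities are elements of the two-element field \<^typ>\<open>bit\<close>, so that \<open>+\<close> is addition modulo 2.
  Functors and families of morphisms are extensional (\<open>undefined\<close> outside their domain), so
  that equality in HOL is equality of functors and of transformations.
\<close>

section \<open>Superspaces\<close>

text \<open>
  The fields \<open>mult\<close> and \<open>one\<close> that HOL-Algebra modules inherit from rings play no role.
\<close>

record ('k, 'm) superspace = "('k, 'm) module" +
  homog :: "bit \<Rightarrow> 'm set"

locale superspace = field K + module K V
  for K (structure) and V :: "('k, 'm, 'z) superspace_scheme" (structure) +
  assumes homog_subspace: "submodule (homog V p) K V"
    and homog_disjoint: "homog V 0 \<inter> homog V 1 = {\<zero>\<^bsub>V\<^esub>}"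
    and homog_span: "v \<in> carrier V \<Longrightarrow> \<exists>u\<in>homog V 0. \<exists>w\<in>homog V 1. v = u \<oplus>\<^bsub>V\<^esub> w"

definition component :: "('k, 'm, 'z) superspace_scheme \<Rightarrow> bit \<Rightarrow> 'm \<Rightarrow> 'm" where
  "component V p v = (THE u. u \<in> homog V p \<and> (\<exists>w\<in>homog V (p + 1). v = u \<oplus>\<^bsub>V\<^esub> w))"

text \<open>\<open>koszul V p v\<close> is \<open>(-1)\<close> to the power \<open>p\<close>, times \<open>v\<close>.\<close>

definition koszul :: "('k, 'm, 'z) module_scheme \<Rightarrow> bit \<Rightarrow> 'm \<Rightarrow> 'm" where
  "koszul V p v = (if p = 0 then v else \<ominus>\<^bsub>V\<^esub> v)"


section \<open>Categories\<close>

text \<open>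
  The morphisms from \<open>a\<close> to \<open>b\<close> form a structure \<open>Mor C a b\<close> with a carrier: a bare set for
  ordinary categories, a module for linear categories, a superspace for supercategories.
  Different morphism sets may overlap, so composition takes the three objects as arguments:
  \<open>Cmp C a b c g f\<close> is the composite of \<open>f\<close> from \<open>a\<close> to \<open>b\<close> followed by \<open>g\<close> from \<open>b\<close> to \<open>c\<close>.
\<close>

record ('o, 'm, 'h) cat =
  Ob :: "'o set"
  Mor :: "'o \<Rightarrow> 'o \<Rightarrow> ('m, 'h) partial_object_scheme"
  Cmp :: "'o \<Rightarrow> 'o \<Rightarrow> 'o \<Rightarrow> 'm \<Rightarrow> 'm \<Rightarrow> 'm"
  Idt :: "'o \<Rightarrow> 'm"

type_synonym ('o, 'm) ordinary_cat = "('o, 'm, unit) cat"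

type_synonym ('o, 'k, 'm, 'z) linear_cat_scheme =
  "('o, 'm, ('m, ('m, ('k, 'm, 'z) module_ext) ring_ext) monoid_ext) cat"

type_synonym ('o, 'k, 'm) linear_cat = "('o, 'k, 'm, unit) linear_cat_scheme"

type_synonym ('o, 'k, 'm) supercat = "('o, 'k, 'm, ('m, unit) superspace_ext) linear_cat_scheme"

locale category =
  fixes C :: "('o, 'm, 'h) cat"
  assumes Idt_closed: "a \<in> Ob C \<Longrightarrow> Idt C a \<in> carrier (Mor C a a)"
    and Cmp_closed: "\<lbrakk>a \<in> Ob C; b \<in> Ob C; c \<in> Ob C;
        f \<in> carrier (Mor C a b); g \<in> carrier (Mor C b c)\<rbrakk>
      \<Longrightarrow> Cmp C a b c g f \<in> carrier (Mor C a c)"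
    and Idt_left: "\<lbrakk>a \<in> Ob C; b \<in> Ob C; f \<in> carrier (Mor C a b)\<rbrakk>
      \<Longrightarrow> Cmp C a b b (Idt C b) f = f"
    and Idt_right: "\<lbrakk>a \<in> Ob C; b \<in> Ob C; f \<in> carrier (Mor C a b)\<rbrakk>
      \<Longrightarrow> Cmp C a a b f (Idt C a) = f"
    and Cmp_assoc: "\<lbrakk>a \<in> Ob C; b \<in> Ob C; c \<in> Ob C; d \<in> Ob C;
        f \<in> carrier (Mor C a b); g \<in> carrier (Mor C b c); h \<in> carrier (Mor C c d)\<rbrakk>
      \<Longrightarrow> Cmp C a b d (Cmp C b c d h g) f = Cmp C a c d h (Cmp C a b c g f)"

locale linear_category = field K + category C
  for K (structure) and C :: "('o, 'k, 'm, 'z) linear_cat_scheme" +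
  assumes Mor_module: "\<lbrakk>a \<in> Ob C; b \<in> Ob C\<rbrakk> \<Longrightarrow> module K (Mor C a b)"
    and Cmp_add_left: "\<lbrakk>a \<in> Ob C; b \<in> Ob C; c \<in> Ob C; f \<in> carrier (Mor C a b);
        g \<in> carrier (Mor C b c); g' \<in> carrier (Mor C b c)\<rbrakk>
      \<Longrightarrow> Cmp C a b c (g \<oplus>\<^bsub>Mor C b c\<^esub> g') f = Cmp C a b c g f \<oplus>\<^bsub>Mor C a c\<^esub> Cmp C a b c g' f"
    and Cmp_add_right: "\<lbrakk>a \<in> Ob C; b \<in> Ob C; c \<in> Ob C; f \<in> carrier (Mor C a b);
        f' \<in> carrier (Mor C a b); g \<in> carrier (Mor C b c)\<rbrakk>
      \<Longrightarrow> Cmp C a b c g (f \<oplus>\<^bsub>Mor C a b\<^esub> f') = Cmp C a b c g f \<oplus>\<^bsub>Mor C a c\<^esub> Cmp C a b c g f'"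
    and Cmp_smult_left: "\<lbrakk>a \<in> Ob C; b \<in> Ob C; c \<in> Ob C; r \<in> carrier K;
        f \<in> carrier (Mor C a b); g \<in> carrier (Mor C b c)\<rbrakk>
      \<Longrightarrow> Cmp C a b c (r \<odot>\<^bsub>Mor C b c\<^esub> g) f = r \<odot>\<^bsub>Mor C a c\<^esub> Cmp C a b c g f"
    and Cmp_smult_right: "\<lbrakk>a \<in> Ob C; b \<in> Ob C; c \<in> Ob C; r \<in> carrier K;
        f \<in> carrier (Mor C a b); g \<in> carrier (Mor C b c)\<rbrakk>
      \<Longrightarrow> Cmp C a b c g (r \<odot>\<^bsub>Mor C a b\<^esub> f) = r \<odot>\<^bsub>Mor C a c\<^esub> Cmp C a b c g f"

locale supercategory = linear_category K C
  for K (structure) and C :: "('o, 'k, 'm) supercat" +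
  assumes Mor_superspace: "\<lbrakk>a \<in> Ob C; b \<in> Ob C\<rbrakk> \<Longrightarrow> superspace K (Mor C a b)"
    and Cmp_even: "\<lbrakk>a \<in> Ob C; b \<in> Ob C; c \<in> Ob C;
        f \<in> homog (Mor C a b) p; g \<in> homog (Mor C b c) q\<rbrakk>
      \<Longrightarrow> Cmp C a b c g f \<in> homog (Mor C a c) (p + q)"

definition iso_mor :: "('o, 'm, 'h) cat \<Rightarrow> 'o \<Rightarrow> 'o \<Rightarrow> 'm \<Rightarrow> bool" where
  "iso_mor C a b f \<longleftrightarrow> f \<in> carrier (Mor C a b) \<and>
    (\<exists>g\<in>carrier (Mor C b a). Cmp C a b a g f = Idt C a \<and> Cmp C b a b f g = Idt C b)"

definition inv_mor :: "('o, 'm, 'h) cat \<Rightarrow> 'o \<Rightarrow> 'o \<Rightarrow> 'm \<Rightarrow> 'm" where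
  "inv_mor C a b f = (THE g. g \<in> carrier (Mor C b a) \<and>
    Cmp C a b a g f = Idt C a \<and> Cmp C b a b f g = Idt C b)"


section \<open>Functors\<close>

record ('o, 'm, 'p, 'n) fctr =
  fob :: "'o \<Rightarrow> 'p"
  fmap :: "'o \<Rightarrow> 'o \<Rightarrow> 'm \<Rightarrow> 'n"

locale is_functor = A: category A + B: category B
  for A :: "('o, 'm, 'h) cat" and B :: "('p, 'n, 'i) cat" +
  fixes F :: "('o, 'm, 'p, 'n) fctr"
  assumes fob_closed: "fob F \<in> Ob A \<rightarrow>\<^sub>E Ob B"
    and fmap_closed: "fmap F \<in> (\<Pi>\<^sub>E a\<in>Ob A. \<Pi>\<^sub>E b\<in>Ob A.
        carrier (Mor A a b) \<rightarrow>\<^sub>E carrier (Mor B (fob F a) (fob F b)))"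
    and fmap_Idt: "a \<in> Ob A \<Longrightarrow> fmap F a a (Idt A a) = Idt B (fob F a)"
    and fmap_Cmp: "\<lbrakk>a \<in> Ob A; b \<in> Ob A; c \<in> Ob A;
        f \<in> carrier (Mor A a b); g \<in> carrier (Mor A b c)\<rbrakk>
      \<Longrightarrow> fmap F a c (Cmp A a b c g f) =
          Cmp B (fob F a) (fob F b) (fob F c) (fmap F b c g) (fmap F a b f)"

locale linear_functor = A: linear_category K A + B: linear_category K B + is_functor A B F
  for K (structure) and A :: "('o, 'k, 'm, 'z) linear_cat_scheme"
    and B :: "('p, 'k, 'n, 'y) linear_cat_scheme" and F :: "('o, 'm, 'p, 'n) fctr" +
  assumes fmap_add: "\<lbrakk>a \<in> Ob A; b \<in> Ob A; f \<in> carrier (Mor A a b); g \<in> carrier (Mor A a b)\<rbrakk>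
      \<Longrightarrow> fmap F a b (f \<oplus>\<^bsub>Mor A a b\<^esub> g) = fmap F a b f \<oplus>\<^bsub>Mor B (fob F a) (fob F b)\<^esub> fmap F a b g"
    and fmap_smult: "\<lbrakk>a \<in> Ob A; b \<in> Ob A; r \<in> carrier K; f \<in> carrier (Mor A a b)\<rbrakk>
      \<Longrightarrow> fmap F a b (r \<odot>\<^bsub>Mor A a b\<^esub> f) = r \<odot>\<^bsub>Mor B (fob F a) (fob F b)\<^esub> fmap F a b f"

locale superfunctor = A: supercategory K A + B: supercategory K B + linear_functor K A B F
  for K (structure) and A :: "('o, 'k, 'm) supercat" and B :: "('p, 'k, 'n) supercat"
    and F :: "('o, 'm, 'p, 'n) fctr" +
  assumes fmap_even: "\<lbrakk>a \<in> Ob A; b \<in> Ob A; f \<in> homog (Mor A a b) p\<rbrakk>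
      \<Longrightarrow> fmap F a b f \<in> homog (Mor B (fob F a) (fob F b)) p"

definition id_functor :: "('o, 'm, 'h) cat \<Rightarrow> ('o, 'm, 'o, 'm) fctr" where
  "id_functor A = \<lparr>fob = (\<lambda>a\<in>Ob A. a),
    fmap = (\<lambda>a\<in>Ob A. \<lambda>b\<in>Ob A. \<lambda>f\<in>carrier (Mor A a b). f)\<rparr>"

text \<open>\<open>comp_functor A G F\<close> is \<open>GF\<close>, where \<open>A\<close> is the source of \<open>F\<close>.\<close>

definition comp_functor ::
  "('o, 'm, 'h) cat \<Rightarrow> ('p, 'n, 'q, 'l) fctr \<Rightarrow> ('o, 'm, 'p, 'n) fctr \<Rightarrow> ('o, 'm, 'q, 'l) fctr" where
  "comp_functor A G F = \<lparr>fob = (\<lambda>a\<in>Ob A. fob G (fob F a)),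
    fmap = (\<lambda>a\<in>Ob A. \<lambda>b\<in>Ob A. \<lambda>f\<in>carrier (Mor A a b).
      fmap G (fob F a) (fob F b) (fmap F a b f))\<rparr>"


section \<open>Transformations\<close>

definition families ::
  "('o, 'm, 'h) cat \<Rightarrow> ('p, 'n, 'i) cat \<Rightarrow> ('o, 'm, 'p, 'n) fctr \<Rightarrow> ('o, 'm, 'p, 'n) fctr
    \<Rightarrow> ('o \<Rightarrow> 'n) set" where
  "families A B F G = (\<Pi>\<^sub>E a\<in>Ob A. carrier (Mor B (fob F a) (fob G a)))"

definition natural ::
  "('o, 'm, 'h) cat \<Rightarrow> ('p, 'n, 'i) cat \<Rightarrow> ('o, 'm, 'p, 'n) fctr \<Rightarrow> ('o, 'm, 'p, 'n) fctr
    \<Rightarrow> ('o \<Rightarrow> 'n) \<Rightarrow> bool" where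
  "natural A B F G x \<longleftrightarrow> x \<in> families A B F G \<and>
    (\<forall>a\<in>Ob A. \<forall>b\<in>Ob A. \<forall>f\<in>carrier (Mor A a b).
      Cmp B (fob F a) (fob F b) (fob G b) (x b) (fmap F a b f) =
      Cmp B (fob F a) (fob G a) (fob G b) (fmap G a b f) (x a))"

definition natural_iso ::
  "('o, 'm, 'h) cat \<Rightarrow> ('p, 'n, 'i) cat \<Rightarrow> ('o, 'm, 'p, 'n) fctr \<Rightarrow> ('o, 'm, 'p, 'n) fctr
    \<Rightarrow> ('o \<Rightarrow> 'n) \<Rightarrow> bool" where
  "natural_iso A B F G x \<longleftrightarrow>
    natural A B F G x \<and> (\<forall>a\<in>Ob A. iso_mor B (fob F a) (fob G a) (x a))"

definition supernatural ::
  "('o, 'k, 'm) supercat \<Rightarrow> ('p, 'k, 'n) supercat \<Rightarrow> ('o, 'm, 'p, 'n) fctr \<Rightarrow> ('o, 'm, 'p, 'n) fctr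
    \<Rightarrow> ('o \<Rightarrow> 'n) \<Rightarrow> bool" where
  "supernatural A B F G x \<longleftrightarrow> x \<in> families A B F G \<and>
    (\<forall>a\<in>Ob A. \<forall>b\<in>Ob A. \<forall>p q. \<forall>f\<in>homog (Mor A a b) q.
      Cmp B (fob F a) (fob F b) (fob G b)
        (component (Mor B (fob F b) (fob G b)) p (x b)) (fmap F a b f) =
      koszul (Mor B (fob F a) (fob G b)) (p * q)
        (Cmp B (fob F a) (fob G a) (fob G b)
          (fmap G a b f) (component (Mor B (fob F a) (fob G a)) p (x a))))"

definition supernatural_of_parity ::
  "bit \<Rightarrow> ('o, 'k, 'm) supercat \<Rightarrow> ('p, 'k, 'n) supercat
    \<Rightarrow> ('o, 'm, 'p, 'n) fctr \<Rightarrow> ('o, 'm, 'p, 'n) fctr \<Rightarrow> ('o \<Rightarrow> 'n) \<Rightarrow> bool" where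
  "supernatural_of_parity p A B F G x \<longleftrightarrow> supernatural A B F G x \<and>
    (\<forall>a\<in>Ob A. x a \<in> homog (Mor B (fob F a) (fob G a)) p)"

definition supernatural_iso_of_parity ::
  "bit \<Rightarrow> ('o, 'k, 'm) supercat \<Rightarrow> ('p, 'k, 'n) supercat
    \<Rightarrow> ('o, 'm, 'p, 'n) fctr \<Rightarrow> ('o, 'm, 'p, 'n) fctr \<Rightarrow> ('o \<Rightarrow> 'n) \<Rightarrow> bool" where
  "supernatural_iso_of_parity p A B F G x \<longleftrightarrow> supernatural_of_parity p A B F G x \<and>
    (\<forall>a\<in>Ob A. iso_mor B (fob F a) (fob G a) (x a))"

definition id_trans ::
  "('o, 'm, 'h) cat \<Rightarrow> ('p, 'n, 'i) cat \<Rightarrow> ('o, 'm, 'p, 'n) fctr \<Rightarrow> 'o \<Rightarrow> 'n" where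
  "id_trans A B F = (\<lambda>a\<in>Ob A. Idt B (fob F a))"

definition inv_trans ::
  "('o, 'm, 'h) cat \<Rightarrow> ('p, 'n, 'i) cat \<Rightarrow> ('o, 'm, 'p, 'n) fctr \<Rightarrow> ('o, 'm, 'p, 'n) fctr
    \<Rightarrow> ('o \<Rightarrow> 'n) \<Rightarrow> 'o \<Rightarrow> 'n" where
  "inv_trans A B F G x = (\<lambda>a\<in>Ob A. inv_mor B (fob F a) (fob G a) (x a))"

text \<open>Vertical composite of \<open>x : F \<Rightarrow> G\<close> followed by \<open>y : G \<Rightarrow> H\<close>.\<close>

definition vcomp ::
  "('o, 'm, 'h) cat \<Rightarrow> ('p, 'n, 'i) cat
    \<Rightarrow> ('o, 'm, 'p, 'n) fctr \<Rightarrow> ('o, 'm, 'p, 'n) fctr \<Rightarrow> ('o, 'm, 'p, 'n) fctr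
    \<Rightarrow> ('o \<Rightarrow> 'n) \<Rightarrow> ('o \<Rightarrow> 'n) \<Rightarrow> 'o \<Rightarrow> 'n" where
  "vcomp A B F G H y x = (\<lambda>a\<in>Ob A. Cmp B (fob F a) (fob G a) (fob H a) (y a) (x a))"

text \<open>
  Horizontal composite \<open>yx : GF \<Rightarrow> LH\<close> of \<open>x : F \<Rightarrow> H\<close> and \<open>y : G \<Rightarrow> L\<close>, for functors \<open>F\<close>, \<open>H\<close>
  with source \<open>A\<close> and functors \<open>G\<close>, \<open>L\<close> with target \<open>C\<close>.
\<close>

definition hcomp ::
  "('o, 'm, 'h) cat \<Rightarrow> ('q, 'l, 'j) cat
    \<Rightarrow> ('p, 'n, 'q, 'l) fctr \<Rightarrow> ('p, 'n, 'q, 'l) fctr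
    \<Rightarrow> ('o, 'm, 'p, 'n) fctr \<Rightarrow> ('o, 'm, 'p, 'n) fctr
    \<Rightarrow> ('p \<Rightarrow> 'l) \<Rightarrow> ('o \<Rightarrow> 'n) \<Rightarrow> 'o \<Rightarrow> 'l" where
  "hcomp A C G L F H y x = (\<lambda>a\<in>Ob A.
    Cmp C (fob G (fob F a)) (fob G (fob H a)) (fob L (fob H a))
      (y (fob H a)) (fmap G (fob F a) (fob H a) (x a)))"

text \<open>
  The composite \<open>yFx : GFR \<Rightarrow> LFS\<close> for a functor \<open>F\<close> from \<open>A\<close> to \<open>B\<close>, a transformation \<open>y : G \<Rightarrow> L\<close>
  of endofunctors of \<open>B\<close> and a transformation \<open>x : R \<Rightarrow> S\<close> of endofunctors of \<open>A\<close>.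
\<close>

definition hcomp_through ::
  "('o, 'm, 'h) cat \<Rightarrow> ('p, 'n, 'i) cat \<Rightarrow> ('o, 'm, 'p, 'n) fctr
    \<Rightarrow> ('p, 'n, 'p, 'n) fctr \<Rightarrow> ('p, 'n, 'p, 'n) fctr
    \<Rightarrow> ('o, 'm, 'o, 'm) fctr \<Rightarrow> ('o, 'm, 'o, 'm) fctr
    \<Rightarrow> ('p \<Rightarrow> 'n) \<Rightarrow> ('o \<Rightarrow> 'm) \<Rightarrow> 'o \<Rightarrow> 'n" where
  "hcomp_through A B F G L R S y x =
    hcomp A B G L (comp_functor A F R) (comp_functor A F S) y
      (hcomp A B F F R S (id_trans A B F) x)"


section \<open>Equivalences\<close>

definition cat_equivalence ::
  "('o, 'm, 'h) cat \<Rightarrow> ('p, 'n, 'i) cat \<Rightarrow> ('o, 'm, 'p, 'n) fctr \<Rightarrow> bool" where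
  "cat_equivalence A B F \<longleftrightarrow> is_functor A B F \<and>
    (\<exists>G. is_functor B A G \<and>
      (\<exists>x. natural_iso A A (comp_functor A G F) (id_functor A) x) \<and>
      (\<exists>y. natural_iso B B (comp_functor B F G) (id_functor B) y))"

definition superequivalence ::
  "'k ring \<Rightarrow> ('o, 'k, 'm) supercat \<Rightarrow> ('p, 'k, 'n) supercat \<Rightarrow> ('o, 'm, 'p, 'n) fctr \<Rightarrow> bool" where
  "superequivalence K A B F \<longleftrightarrow> superfunctor K A B F \<and>
    (\<exists>G. superfunctor K B A G \<and>
      (\<exists>x. supernatural_iso_of_parity 0 A A (comp_functor A G F) (id_functor A) x) \<and>
      (\<exists>y. supernatural_iso_of_parity 0 B B (comp_functor B F G) (id_functor B) y))"


section \<open>The supercategory of superfunctors and supernatural transformations\<close>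

definition hom_supercat ::
  "'k ring \<Rightarrow> ('o, 'k, 'm) supercat \<Rightarrow> ('p, 'k, 'n) supercat
    \<Rightarrow> (('o, 'm, 'p, 'n) fctr, 'k, 'o \<Rightarrow> 'n) supercat" where
  "hom_supercat K A B = \<lparr>
    Ob = {F. superfunctor K A B F},
    Mor = (\<lambda>F G. \<lparr>
      carrier = {x. supernatural A B F G x},
      mult = undefined,
      one = undefined,
      zero = (\<lambda>a\<in>Ob A. \<zero>\<^bsub>Mor B (fob F a) (fob G a)\<^esub>),
      add = (\<lambda>x y. \<lambda>a\<in>Ob A. x a \<oplus>\<^bsub>Mor B (fob F a) (fob G a)\<^esub> y a),
      smult = (\<lambda>r x. \<lambda>a\<in>Ob A. r \<odot>\<^bsub>Mor B (fob F a) (fob G a)\<^esub> x a),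
      homog = (\<lambda>p. {x. supernatural_of_parity p A B F G x})\<rparr>),
    Cmp = vcomp A B,
    Idt = id_trans A B\<rparr>"


section \<open>Supercategories and categories with parity shift\<close>

record ('o, 'k, 'm) pi_supercat =
  scat :: "('o, 'k, 'm) supercat"
  sshift :: "('o, 'm, 'o, 'm) fctr"
  zeta :: "'o \<Rightarrow> 'm"

locale pi_supercategory =
  fixes K :: "'k ring" and P :: "('o, 'k, 'm) pi_supercat"
  assumes scat_supercategory: "supercategory K (scat P)"
    and sshift_superfunctor: "superfunctor K (scat P) (scat P) (sshift P)"
    and zeta_odd_iso:
      "supernatural_iso_of_parity 1 (scat P) (scat P) (sshift P) (id_functor (scat P)) (zeta P)"

record ('o, 'k, 'm) pi_cat =
  lcat :: "('o, 'k, 'm) linear_cat"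
  lshift :: "('o, 'm, 'o, 'm) fctr"
  xi :: "'o \<Rightarrow> 'm"

definition lshift2 :: "('o, 'k, 'm) pi_cat \<Rightarrow> ('o, 'm, 'o, 'm) fctr" where
  "lshift2 P = comp_functor (lcat P) (lshift P) (lshift P)"

locale pi_category =
  fixes K :: "'k ring" and P :: "('o, 'k, 'm) pi_cat"
  assumes lcat_linear_category: "linear_category K (lcat P)"
    and lshift_linear_functor: "linear_functor K (lcat P) (lcat P) (lshift P)"
    and xi_iso: "natural_iso (lcat P) (lcat P) (lshift2 P) (id_functor (lcat P)) (xi P)"
    and xi_shift:
      "hcomp (lcat P) (lcat P) (lshift2 P) (id_functor (lcat P)) (lshift P) (lshift P)
        (xi P) (id_trans (lcat P) (lcat P) (lshift P)) =
       hcomp (lcat P) (lcat P) (lshift P) (lshift P) (lshift2 P) (id_functor (lcat P))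
        (id_trans (lcat P) (lcat P) (lshift P)) (xi P)"

locale pi_functor =
  fixes K :: "'k ring" and P :: "('o, 'k, 'm) pi_cat" and Q :: "('p, 'k, 'n) pi_cat"
    and F :: "('o, 'm, 'p, 'n) fctr" and \<beta> :: "'o \<Rightarrow> 'n"
  assumes source: "pi_category K P" and target: "pi_category K Q"
    and linear: "linear_functor K (lcat P) (lcat Q) F"
    and beta_iso: "natural_iso (lcat P) (lcat Q)
      (comp_functor (lcat P) (lshift Q) F) (comp_functor (lcat P) F (lshift P)) \<beta>"
    and beta_coherence:
      "hcomp_through (lcat P) (lcat Q) F
        (lshift2 Q) (id_functor (lcat Q)) (id_functor (lcat P)) (lshift2 P)
        (xi Q) (inv_trans (lcat P) (lcat P) (lshift2 P) (id_functor (lcat P)) (xi P)) =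
       vcomp (lcat P) (lcat Q)
        (comp_functor (lcat P) (lshift2 Q) F)
        (comp_functor (lcat P) (lshift Q) (comp_functor (lcat P) F (lshift P)))
        (comp_functor (lcat P) F (lshift2 P))
        (hcomp (lcat P) (lcat Q)
          (comp_functor (lcat P) (lshift Q) F) (comp_functor (lcat P) F (lshift P))
          (lshift P) (lshift P) \<beta> (id_trans (lcat P) (lcat P) (lshift P)))
        (hcomp (lcat P) (lcat Q) (lshift Q) (lshift Q)
          (comp_functor (lcat P) (lshift Q) F) (comp_functor (lcat P) F (lshift P))
          (id_trans (lcat Q) (lcat Q) (lshift Q)) \<beta>)"

text \<open>\<open>comp_beta P Q R G \<beta>G F \<beta>F\<close> is the composite of \<open>\<beta>G F\<close> followed by \<open>G \<beta>F\<close>.\<close>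

definition comp_beta ::
  "('o, 'k, 'm) pi_cat \<Rightarrow> ('p, 'k, 'n) pi_cat \<Rightarrow> ('q, 'k, 'l) pi_cat
    \<Rightarrow> ('p, 'n, 'q, 'l) fctr \<Rightarrow> ('p \<Rightarrow> 'l) \<Rightarrow> ('o, 'm, 'p, 'n) fctr \<Rightarrow> ('o \<Rightarrow> 'n) \<Rightarrow> 'o \<Rightarrow> 'l" where
  "comp_beta P Q R G \<beta>G F \<beta>F =
    vcomp (lcat P) (lcat R)
      (comp_functor (lcat P) (lshift R) (comp_functor (lcat P) G F))
      (comp_functor (lcat P) G (comp_functor (lcat P) (lshift Q) F))
      (comp_functor (lcat P) G (comp_functor (lcat P) F (lshift P)))
      (hcomp (lcat P) (lcat R) G G
        (comp_functor (lcat P) (lshift Q) F) (comp_functor (lcat P) F (lshift P))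
        (id_trans (lcat Q) (lcat R) G) \<beta>F)
      (hcomp (lcat P) (lcat R)
        (comp_functor (lcat Q) (lshift R) G) (comp_functor (lcat Q) G (lshift Q))
        F F \<beta>G (id_trans (lcat P) (lcat Q) F))"


section \<open>The categories of supercategories, of Pi-supercategories and of Pi-categories\<close>

text \<open>
  The type variables \<open>'o\<close> and \<open>'m\<close> for objects and morphisms act as the universe relative to
  which these categories are formed.
\<close>

definition SCat ::
  "'k ring \<Rightarrow> (('o, 'k, 'm) supercat, ('o, 'm, 'o, 'm) fctr) ordinary_cat" where
  "SCat K = \<lparr>
    Ob = {A. supercategory K A},
    Mor = (\<lambda>A B. \<lparr>carrier = {F. superfunctor K A B F}\<rparr>),
    Cmp = (\<lambda>A B C G F. comp_functor A G F),
    Idt = id_functor\<rparr>"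

definition PiSCat ::
  "'k ring \<Rightarrow> (('o, 'k, 'm) pi_supercat, ('o, 'm, 'o, 'm) fctr) ordinary_cat" where
  "PiSCat K = \<lparr>
    Ob = {P. pi_supercategory K P},
    Mor = (\<lambda>P Q. \<lparr>carrier = {F. superfunctor K (scat P) (scat Q) F}\<rparr>),
    Cmp = (\<lambda>P Q R G F. comp_functor (scat P) G F),
    Idt = (\<lambda>P. id_functor (scat P))\<rparr>"

definition PiCat ::
  "'k ring \<Rightarrow> (('o, 'k, 'm) pi_cat, ('o, 'm, 'o, 'm) fctr \<times> ('o \<Rightarrow> 'm)) ordinary_cat" where
  "PiCat K = \<lparr>
    Ob = {P. pi_category K P},
    Mor = (\<lambda>P Q. \<lparr>carrier = {(F, \<beta>). pi_functor K P Q F \<beta>}\<rparr>),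
    Cmp = (\<lambda>P Q R (G, \<beta>G) (F, \<beta>F).
      (comp_functor (lcat P) G F, comp_beta P Q R G \<beta>G F \<beta>F)),
    Idt = (\<lambda>P. (id_functor (lcat P), id_trans (lcat P) (lcat P) (lshift P)))\<rparr>"

definition forget :: "'k ring \<Rightarrow> (('o, 'k, 'm) pi_supercat, ('o, 'm, 'o, 'm) fctr,
    ('o, 'k, 'm) supercat, ('o, 'm, 'o, 'm) fctr) fctr" where
  "forget K = \<lparr>
    fob = (\<lambda>P\<in>Ob (PiSCat K). scat P),
    fmap = (\<lambda>P\<in>Ob (PiSCat K). \<lambda>Q\<in>Ob (PiSCat K). \<lambda>F\<in>carrier (Mor (PiSCat K) P Q). F)\<rparr>"


section \<open>The Pi-envelope\<close>

text \<open>
  The object written as the \<open>a\<close>-fold shift of \<open>l\<close> is the pair \<open>(l, a)\<close>. The morphism from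
  \<open>(l, a)\<close> to \<open>(m, b)\<close> coming from \<open>f\<close> is \<open>f\<close> itself, with its parity shifted by \<open>a + b\<close>.
\<close>

definition envelope_cat :: "('o, 'k, 'm) supercat \<Rightarrow> ('o \<times> bit, 'k, 'm) supercat" where
  "envelope_cat A = \<lparr>
    Ob = Ob A \<times> UNIV,
    Mor = (\<lambda>(l, a) (m, b). (Mor A l m)\<lparr>homog := \<lambda>p. homog (Mor A l m) (p + a + b)\<rparr>),
    Cmp = (\<lambda>(l, a) (m, b) (n, c). Cmp A l m n),
    Idt = (\<lambda>(l, a). Idt A l)\<rparr>"

text \<open>
  As the components of \<open>zeta\<close> are given by identities of \<open>A\<close>, supernaturality forces the shift
  to be multiplication by \<open>(-1)\<close> to the power \<open>p\<close> on morphisms of parity \<open>p\<close> in the envelope,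
  that is, to negate the odd component.
\<close>

definition envelope :: "('o, 'k, 'm) supercat \<Rightarrow> ('o \<times> bit, 'k, 'm) pi_supercat" where
  "envelope A = \<lparr>
    scat = envelope_cat A,
    sshift = \<lparr>
      fob = (\<lambda>(l, a)\<in>Ob (envelope_cat A). (l, a + 1)),
      fmap = (\<lambda>s\<in>Ob (envelope_cat A). \<lambda>t\<in>Ob (envelope_cat A).
        \<lambda>f\<in>carrier (Mor (envelope_cat A) s t).
          component (Mor (envelope_cat A) s t) 0 f
            \<ominus>\<^bsub>Mor (envelope_cat A) s t\<^esub> component (Mor (envelope_cat A) s t) 1 f)\<rparr>,
    zeta = (\<lambda>(l, a)\<in>Ob (envelope_cat A). Idt A l)\<rparr>"

definition envelope_map ::
  "('o, 'k, 'm) supercat \<Rightarrow> ('o, 'm, 'p, 'n) fctr \<Rightarrow> ('o \<times> bit, 'm, 'p \<times> bit, 'n) fctr" where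
  "envelope_map A F = \<lparr>
    fob = (\<lambda>(l, a)\<in>Ob (envelope_cat A). (fob F l, a)),
    fmap = (\<lambda>s\<in>Ob (envelope_cat A). \<lambda>t\<in>Ob (envelope_cat A).
      \<lambda>f\<in>carrier (Mor (envelope_cat A) s t). fmap F (fst s) (fst t) f)\<rparr>"

definition envelope_functor :: "'k ring \<Rightarrow> (('o, 'k, 'm) supercat, ('o, 'm, 'o, 'm) fctr,
    ('o \<times> bit, 'k, 'm) pi_supercat, ('o \<times> bit, 'm, 'o \<times> bit, 'm) fctr) fctr" where
  "envelope_functor K = \<lparr>
    fob = (\<lambda>A\<in>Ob (SCat K). envelope A),
    fmap = (\<lambda>A\<in>Ob (SCat K). \<lambda>B\<in>Ob (SCat K). \<lambda>F\<in>carrier (Mor (SCat K) A B).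
      envelope_map A F)\<rparr>"


section \<open>The underlying Pi-category\<close>

definition underlying_cat :: "('o, 'k, 'm) supercat \<Rightarrow> ('o, 'k, 'm) linear_cat" where
  "underlying_cat A = \<lparr>
    Ob = Ob A,
    Mor = (\<lambda>a b. (module.truncate (Mor A a b))\<lparr>carrier := homog (Mor A a b) 0\<rparr>),
    Cmp = Cmp A,
    Idt = Idt A\<rparr>"

definition underlying_map ::
  "('o, 'k, 'm) supercat \<Rightarrow> ('o, 'm, 'p, 'n) fctr \<Rightarrow> ('o, 'm, 'p, 'n) fctr" where
  "underlying_map A F = \<lparr>
    fob = fob F,
    fmap = (\<lambda>a\<in>Ob A. \<lambda>b\<in>Ob A. \<lambda>f\<in>homog (Mor A a b) 0. fmap F a b f)\<rparr>"

definition underlying :: "('o, 'k, 'm) pi_supercat \<Rightarrow> ('o, 'k, 'm) pi_cat" where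
  "underlying P = \<lparr>
    lcat = underlying_cat (scat P),
    lshift = underlying_map (scat P) (sshift P),
    xi = hcomp (scat P) (scat P) (sshift P) (id_functor (scat P)) (sshift P) (id_functor (scat P))
      (zeta P) (zeta P)\<rparr>"

definition beta ::
  "('o, 'k, 'm) pi_supercat \<Rightarrow> ('p, 'k, 'n) pi_supercat \<Rightarrow> ('o, 'm, 'p, 'n) fctr \<Rightarrow> 'o \<Rightarrow> 'n" where
  "beta P Q F = (\<lambda>a\<in>Ob (scat P).
    \<ominus>\<^bsub>Mor (scat Q) (fob (sshift Q) (fob F a)) (fob F (fob (sshift P) a))\<^esub>
      hcomp_through (scat P) (scat Q) F
        (sshift Q) (id_functor (scat Q)) (id_functor (scat P)) (sshift P)
        (zeta Q) (inv_trans (scat P) (scat P) (sshift P) (id_functor (scat P)) (zeta P)) a)"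

definition underlying_functor :: "'k ring \<Rightarrow> (('o, 'k, 'm) pi_supercat, ('o, 'm, 'o, 'm) fctr,
    ('o, 'k, 'm) pi_cat, ('o, 'm, 'o, 'm) fctr \<times> ('o \<Rightarrow> 'm)) fctr" where
  "underlying_functor K = \<lparr>
    fob = (\<lambda>P\<in>Ob (PiSCat K). underlying P),
    fmap = (\<lambda>P\<in>Ob (PiSCat K). \<lambda>Q\<in>Ob (PiSCat K). \<lambda>F\<in>carrier (Mor (PiSCat K) P Q).
      (underlying_map (scat P) F, beta P Q F))\<rparr>"

end

theory Submission
  imports Defs
begin

text \<open>
  Write \<open>\<zeta>\<^sup>0 = 1\<close> and \<open>\<zeta>\<^sup>1 = \<zeta>\<close>. A superfunctor \<open>F\<close> from \<open>A\<close> to a \<open>\<Pi>\<close>-supercategory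
  extends to the envelope of \<open>A\<close> by sending \<open>\<Pi>\<^sup>a \<lambda>\<close> to \<open>\<Pi>\<^sup>a F \<lambda>\<close> and the morphism from \<open>\<Pi>\<^sup>a \<lambda>\<close>
  to \<open>\<Pi>\<^sup>b \<mu>\<close> given by \<open>f\<close> to \<open>(\<zeta>\<^sup>b)\<^sup>-\<^sup>1 \<circ> F f \<circ> \<zeta>\<^sup>a\<close>. The factors \<open>\<zeta>\<close> cancel in composites, so no signs
  appear. A supernatural transformation \<open>x\<close> extends by \<open>\<Pi>\<^sup>a x\<^sub>\<lambda>\<close>, the sign rule being absorbed by the
  functor \<open>\<Pi>\<close>. Restriction along \<open>\<lambda> \<mapsto> \<Pi>\<^sup>0 \<lambda>\<close> is quasi-inverse to extension.

  In a \<open>\<Pi>\<close>-supercategory the odd morphisms \<open>a \<rightarrow> b\<close> are the composites of \<open>\<zeta>\<^sub>b\<close> with the even morphisms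
  \<open>a \<rightarrow> \<Pi> b\<close>. Hence a superfunctor amounts to its even part together with its values on \<open>\<zeta>\<close>, that is, to a
  \<open>\<Pi>\<close>-functor, whose coherence condition says that products of two odd morphisms are respected; and a
  \<open>\<Pi>\<close>-category \<open>C\<close> is recovered as the underlying category of the \<open>\<Pi>\<close>-supercategory with odd morphisms
  \<open>C(a, \<Pi> b)\<close>. So the functor of the second part is fully faithful and essentially surjective.
\<close>

text \<open>All signs come from one identity: the naturality square of the odd transformation
  \<zeta> at the odd morphism \<zeta> itself gives \<open>\<Pi> \<zeta> = - \<zeta> \<Pi>\<close>.
  Let f : a -> b and g : b -> c be odd, f = \<zeta> f' and g = \<zeta> g' with f', g' even. Moving
  g' past \<zeta> costs no sign, so g f = \<zeta> \<zeta> (\<Pi> g') f' = - \<xi> (\<Pi> g') f',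
  which is built from data of the underlying \<Pi>-category. Hence the coherence law of \<beta>,
  which compares \<xi> on the two sides, expresses multiplicativity on pairs of odd morphisms, and
  the same formula has to define composition when a \<Pi>-supercategory is rebuilt. Parity needs
  care: the axioms of a supercategory do not say that identities are even or that inverses of
  homogeneous isomorphisms are homogeneous, so both are proved before even morphisms can form a
  category. Sign rules concern homogeneous morphisms only; general ones are reached by additivity.
  Rebuilding turns a morphism into a pair (even part, odd part), while the category of
  \<Pi>-categories has a fixed type of morphisms. An infinite type leaves room to code
  pairs.\<close>

section \<open>Superspaces\<close>

text \<open>The default simplifier setup rewrites \<open>+\<close> on \<^typ>\<open>bit\<close> to \<open>XOR\<close>, which defeats the additive simp rules.\<close>

declare add_bit_eq_xor [simp del] mult_bit_eq_and [simp del]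

lemma bit_add_self [simp]: "p + p = 0" "p + (p + q) = q" for p q :: bit
  by (cases p; simp add: add.assoc[symmetric])+

lemma bit_add_one_neq [simp]: "p \<noteq> p + 1" "p \<noteq> 1 + p" for p :: bit
  by (cases p; simp)+

lemma bit_mult_self [simp]: "p * p = p" for p :: bit
  by (cases p) simp_all

text \<open>Negation is multiplication by the scalar -1, so closure under scalars already gives
  closure under additive inverses.\<close>

lemma (in module) submoduleI_smult:
  assumes "H \<subseteq> carrier M" "\<zero>\<^bsub>M\<^esub> \<in> H"
    and "\<And>a b. \<lbrakk>a \<in> H; b \<in> H\<rbrakk> \<Longrightarrow> a \<oplus>\<^bsub>M\<^esub> b \<in> H"
    and smult: "\<And>a x. \<lbrakk>a \<in> carrier R; x \<in> H\<rbrakk> \<Longrightarrow> a \<odot>\<^bsub>M\<^esub> x \<in> H"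
  shows "submodule H R M"
proof (rule submoduleI)
  fix a assume a: "a \<in> H"
  then have "a \<in> carrier M" using assms(1) by blast
  then have "\<ominus>\<^bsub>M\<^esub> a = (\<ominus> \<one>) \<odot>\<^bsub>M\<^esub> a" by (simp add: smult_l_minus)
  then show "\<ominus>\<^bsub>M\<^esub> a \<in> H" using smult[OF _ a, of "\<ominus> \<one>"] by simp
qed (use assms in auto)

context superspace
begin

lemma homog_carrier: "v \<in> homog V p \<Longrightarrow> v \<in> carrier V"
  using submoduleE(1)[OF homog_subspace] by blast

lemma zero_homog [simp]: "\<zero>\<^bsub>V\<^esub> \<in> homog V p"
  using subgroup.one_closed[OF submodule.axioms(1)[OF homog_subspace]] by simp

lemma neg_homog [simp]: "v \<in> homog V p \<Longrightarrow> \<ominus>\<^bsub>V\<^esub> v \<in> homog V p"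
  using submoduleE(3)[OF homog_subspace] by blast

lemma add_homog [simp]: "\<lbrakk>v \<in> homog V p; w \<in> homog V p\<rbrakk> \<Longrightarrow> v \<oplus>\<^bsub>V\<^esub> w \<in> homog V p"
  using submoduleE(5)[OF homog_subspace] by blast

lemma smult_homog [simp]: "\<lbrakk>r \<in> carrier K; v \<in> homog V p\<rbrakk> \<Longrightarrow> r \<odot>\<^bsub>V\<^esub> v \<in> homog V p"
  using submoduleE(4)[OF homog_subspace] by blast

lemma homog_eq_zero: "\<lbrakk>v \<in> homog V p; v \<in> homog V q; p \<noteq> q\<rbrakk> \<Longrightarrow> v = \<zero>\<^bsub>V\<^esub>"
  using homog_disjoint by (cases p; cases q) auto

text \<open>The vectors u - u' and w' - w coincide; the first has parity p and the second parity p +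
  1, so both vanish. This is the uniqueness behind \<open>component\<close>.\<close>

lemma homog_add_cancel:
  assumes "u \<in> homog V p" "u' \<in> homog V p" "w \<in> homog V (p + 1)" "w' \<in> homog V (p + 1)"
    and eq: "u \<oplus>\<^bsub>V\<^esub> w = u' \<oplus>\<^bsub>V\<^esub> w'"
  shows "u = u'"
proof -
  have c: "u \<in> carrier V" "u' \<in> carrier V" "w \<in> carrier V" "w' \<in> carrier V"
    using assms homog_carrier by blast+
  have "u \<oplus>\<^bsub>V\<^esub> (\<ominus>\<^bsub>V\<^esub> u') = w' \<oplus>\<^bsub>V\<^esub> (\<ominus>\<^bsub>V\<^esub> w)"
  proof -
    have "u \<oplus>\<^bsub>V\<^esub> (\<ominus>\<^bsub>V\<^esub> u') = (u \<oplus>\<^bsub>V\<^esub> w) \<oplus>\<^bsub>V\<^esub> (\<ominus>\<^bsub>V\<^esub> w) \<oplus>\<^bsub>V\<^esub> (\<ominus>\<^bsub>V\<^esub> u')"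
      using c by (simp add: M.a_assoc[of u w] M.r_neg)
    also have "\<dots> = (w' \<oplus>\<^bsub>V\<^esub> (\<ominus>\<^bsub>V\<^esub> w)) \<oplus>\<^bsub>V\<^esub> (u' \<oplus>\<^bsub>V\<^esub> (\<ominus>\<^bsub>V\<^esub> u'))"
      using c unfolding eq by (simp add: M.a_ac)
    finally show ?thesis using c by (simp add: M.r_neg)
  qed
  moreover have "u \<oplus>\<^bsub>V\<^esub> (\<ominus>\<^bsub>V\<^esub> u') \<in> homog V p" "w' \<oplus>\<^bsub>V\<^esub> (\<ominus>\<^bsub>V\<^esub> w) \<in> homog V (p + 1)"
    using assms by simp_all
  ultimately have "u \<oplus>\<^bsub>V\<^esub> (\<ominus>\<^bsub>V\<^esub> u') = \<zero>\<^bsub>V\<^esub>"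
    using homog_eq_zero[of _ p "p + 1"] by (cases p) auto
  then show ?thesis
    using c M.minus_equality[of u "\<ominus>\<^bsub>V\<^esub> u'"] by simp
qed

lemma homog_decomp:
  assumes "v \<in> carrier V"
  shows "\<exists>u\<in>homog V p. \<exists>w\<in>homog V (p + 1). v = u \<oplus>\<^bsub>V\<^esub> w"
proof -
  obtain u w where uw: "u \<in> homog V 0" "w \<in> homog V 1" "v = u \<oplus>\<^bsub>V\<^esub> w"
    using homog_span[OF assms] by blast
  moreover from uw have "v = w \<oplus>\<^bsub>V\<^esub> u" using homog_carrier M.a_comm by simp
  ultimately show ?thesis by (cases p) (simp, blast, simp, metis)
qed

text \<open>Uniqueness of the decomposition justifies the definite description in
  \<open>component\<close>; components are computed by exhibiting a decomposition.\<close>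

lemma component_eqI:
  assumes "u \<in> homog V p" "w \<in> homog V (p + 1)" "v = u \<oplus>\<^bsub>V\<^esub> w"
  shows "component V p v = u"
  unfolding component_def
  by (rule the_equality) (use assms homog_add_cancel in blast)+

lemma component_homog [simp]:
  assumes "v \<in> carrier V"
  shows "component V p v \<in> homog V p"
proof -
  obtain u w where "u \<in> homog V p" "w \<in> homog V (p + 1)" "v = u \<oplus>\<^bsub>V\<^esub> w"
    using homog_decomp[OF assms] by blast
  then show ?thesis using component_eqI[of u p w v] by simp
qed

lemma component_carrier [simp]: "v \<in> carrier V \<Longrightarrow> component V p v \<in> carrier V"
  using component_homog homog_carrier by blast

lemma component_sum':
  assumes v: "v \<in> carrier V"
  shows "component V p v \<oplus>\<^bsub>V\<^esub> component V (p + 1) v = v"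
proof -
  obtain u w where uw: "u \<in> homog V p" "w \<in> homog V (p + 1)" "v = u \<oplus>\<^bsub>V\<^esub> w"
    using homog_decomp[OF v] by blast
  then have "v = w \<oplus>\<^bsub>V\<^esub> u" using homog_carrier M.a_comm by simp
  moreover have "u \<in> homog V (p + 1 + 1)" using uw(1) by (cases p) simp_all
  ultimately show ?thesis using component_eqI[OF uw] component_eqI[OF uw(2)] uw(3) by simp
qed

lemma component_sum: "v \<in> carrier V \<Longrightarrow> component V 0 v \<oplus>\<^bsub>V\<^esub> component V 1 v = v"
  using component_sum'[of v 0] by simp

lemma component_of_homog: "v \<in> homog V q \<Longrightarrow> component V p v = (if p = q then v else \<zero>\<^bsub>V\<^esub>)"
proof (cases "p = q")
  case True
  assume "v \<in> homog V q"
  then show ?thesis using True component_eqI[of v q "\<zero>\<^bsub>V\<^esub>" v] homog_carrier[of v q] by simp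
next
  case False
  assume v: "v \<in> homog V q"
  have "q = p + 1" using False by (cases p; cases q) auto
  then show ?thesis using False v component_eqI[of "\<zero>\<^bsub>V\<^esub>" p v v] homog_carrier[of v q] by simp
qed

lemma component_add:
  assumes "v \<in> carrier V" "w \<in> carrier V"
  shows "component V p (v \<oplus>\<^bsub>V\<^esub> w) = component V p v \<oplus>\<^bsub>V\<^esub> component V p w"
proof (rule component_eqI)
  show "v \<oplus>\<^bsub>V\<^esub> w = component V p v \<oplus>\<^bsub>V\<^esub> component V p w \<oplus>\<^bsub>V\<^esub>
      (component V (p + 1) v \<oplus>\<^bsub>V\<^esub> component V (p + 1) w)"
    (is "_ = ?a \<oplus>\<^bsub>V\<^esub> ?b \<oplus>\<^bsub>V\<^esub> (?c \<oplus>\<^bsub>V\<^esub> ?d)")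
  proof -
    have "?a \<oplus>\<^bsub>V\<^esub> ?b \<oplus>\<^bsub>V\<^esub> (?c \<oplus>\<^bsub>V\<^esub> ?d) = (?a \<oplus>\<^bsub>V\<^esub> ?c) \<oplus>\<^bsub>V\<^esub> (?b \<oplus>\<^bsub>V\<^esub> ?d)"
      using assms by (simp add: M.a_ac)
    then show ?thesis using assms component_sum' by simp
  qed
qed (use assms in simp_all)

lemma component_smult:
  assumes "r \<in> carrier K" "v \<in> carrier V"
  shows "component V p (r \<odot>\<^bsub>V\<^esub> v) = r \<odot>\<^bsub>V\<^esub> component V p v"
proof (rule component_eqI)
  show "r \<odot>\<^bsub>V\<^esub> v = r \<odot>\<^bsub>V\<^esub> component V p v \<oplus>\<^bsub>V\<^esub> r \<odot>\<^bsub>V\<^esub> component V (p + 1) v"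
    using assms component_sum'[of v p] smult_r_distr[of r "component V p v" "component V (p + 1) v"]
    by simp
qed (use assms in simp_all)

text \<open>Sign rules are stated for homogeneous elements only. This induction extends additive
  statements from them to all vectors.\<close>

lemma homog_induct [consumes 1, case_names homog add]:
  assumes "v \<in> carrier V"
    and "\<And>p u. u \<in> homog V p \<Longrightarrow> P u"
    and "\<And>u w. \<lbrakk>u \<in> carrier V; w \<in> carrier V; P u; P w\<rbrakk> \<Longrightarrow> P (u \<oplus>\<^bsub>V\<^esub> w)"
  shows "P v"
  using homog_span[OF assms(1)] assms(2,3) homog_carrier by metis

end

section \<open>Koszul signs\<close>

lemma koszul_zero [simp]: "koszul M 0 v = v"
  by (simp add: koszul_def)

context module
begin

lemma koszul_closed [simp]: "v \<in> carrier M \<Longrightarrow> koszul M p v \<in> carrier M"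
  by (simp add: koszul_def)

text \<open>Exponents are parities, so signs multiply by adding exponents modulo 2; sign
  computations then become identities in \<open>bit\<close>.\<close>

lemma koszul_koszul: "v \<in> carrier M \<Longrightarrow> koszul M p (koszul M q v) = koszul M (p + q) v"
  by (cases p; cases q) (simp_all add: koszul_def)

lemma koszul_add:
  "\<lbrakk>v \<in> carrier M; w \<in> carrier M\<rbrakk> \<Longrightarrow> koszul M p (v \<oplus>\<^bsub>M\<^esub> w) = koszul M p v \<oplus>\<^bsub>M\<^esub> koszul M p w"
  by (simp add: koszul_def M.minus_add)

lemma koszul_smult:
  "\<lbrakk>r \<in> carrier R; v \<in> carrier M\<rbrakk> \<Longrightarrow> koszul M p (r \<odot>\<^bsub>M\<^esub> v) = r \<odot>\<^bsub>M\<^esub> koszul M p v"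
  by (simp add: koszul_def smult_r_minus)

lemma koszul_null [simp]: "koszul M p \<zero>\<^bsub>M\<^esub> = \<zero>\<^bsub>M\<^esub>"
  by (simp add: koszul_def)

end

lemma (in superspace) koszul_homog [simp]: "v \<in> homog V p \<Longrightarrow> koszul V q v \<in> homog V p"
  by (simp add: koszul_def)

section \<open>Linear categories and supercategories\<close>

context category
begin

lemma inv_mor_equality:
  assumes "a \<in> Ob C" "b \<in> Ob C" "f \<in> carrier (Mor C a b)" "g \<in> carrier (Mor C b a)"
    "Cmp C a b a g f = Idt C a" "Cmp C b a b f g = Idt C b"
  shows "inv_mor C a b f = g"
  unfolding inv_mor_def
proof (rule the_equality)
  fix g' assume g': "g' \<in> carrier (Mor C b a) \<and> Cmp C a b a g' f = Idt C a \<and> Cmp C b a b f g' = Idt C b"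
  then have "g' = Cmp C b a a (Cmp C a b a g f) g'" using assms by (simp add: Idt_left)
  also have "\<dots> = Cmp C b b a g (Cmp C b a b f g')" using Cmp_assoc[of b a b a g' f g] assms g' by simp
  also have "\<dots> = g" using assms g' by (simp add: Idt_right)
  finally show "g' = g" .
qed (use assms in blast)

lemma
  assumes "a \<in> Ob C" "b \<in> Ob C" "iso_mor C a b f"
  shows iso_mor_carrier: "f \<in> carrier (Mor C a b)"
    and inv_mor_closed: "inv_mor C a b f \<in> carrier (Mor C b a)"
    and inv_mor_left: "Cmp C a b a (inv_mor C a b f) f = Idt C a"
    and inv_mor_right: "Cmp C b a b f (inv_mor C a b f) = Idt C b"
  using assms inv_mor_equality unfolding iso_mor_def by metis+

lemma iso_morI:
  assumes "f \<in> carrier (Mor C a b)" "g \<in> carrier (Mor C b a)"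
    "Cmp C a b a g f = Idt C a" "Cmp C b a b f g = Idt C b"
  shows "iso_mor C a b f"
  using assms unfolding iso_mor_def by blast

lemma iso_mor_inv:
  assumes "a \<in> Ob C" "b \<in> Ob C" "iso_mor C a b f"
  shows "iso_mor C b a (inv_mor C a b f)"
  using inv_mor_closed[OF assms] iso_mor_carrier[OF assms] inv_mor_left[OF assms] inv_mor_right[OF assms]
  by (rule_tac iso_morI)

lemma iso_mor_Idt: "a \<in> Ob C \<Longrightarrow> iso_mor C a a (Idt C a)"
  by (rule iso_morI[where g = "Idt C a"]) (simp_all add: Idt_closed Idt_left)

lemma
  assumes o: "a \<in> Ob C" "b \<in> Ob C" "c \<in> Ob C" and f: "iso_mor C a b f" and g: "iso_mor C b c g"
  shows iso_mor_Cmp: "iso_mor C a c (Cmp C a b c g f)"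
    and inv_mor_Cmp: "inv_mor C a c (Cmp C a b c g f) = Cmp C c b a (inv_mor C a b f) (inv_mor C b c g)"
proof -
  note f' = iso_mor_carrier[OF o(1,2) f] inv_mor_closed[OF o(1,2) f] inv_mor_left[OF o(1,2) f]
      inv_mor_right[OF o(1,2) f]
  note g' = iso_mor_carrier[OF o(2,3) g] inv_mor_closed[OF o(2,3) g] inv_mor_left[OF o(2,3) g]
      inv_mor_right[OF o(2,3) g]
  let ?fi = "inv_mor C a b f" and ?gi = "inv_mor C b c g"
  have 1: "Cmp C a c a (Cmp C c b a ?fi ?gi) (Cmp C a b c g f) = Idt C a"
    using o f' g' Cmp_assoc[of a b c b f g ?gi] by (simp add: Cmp_assoc Cmp_closed Idt_left)
  have 2: "Cmp C c a c (Cmp C a b c g f) (Cmp C c b a ?fi ?gi) = Idt C c"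
    using o f' g' Cmp_assoc[of c b a b ?gi ?fi f] by (simp add: Cmp_assoc Cmp_closed Idt_left)
  show "iso_mor C a c (Cmp C a b c g f)"
    "inv_mor C a c (Cmp C a b c g f) = Cmp C c b a ?fi ?gi"
    using 1 2 o f' g' by (auto intro!: iso_morI inv_mor_equality simp: Cmp_closed)
qed

text \<open>Identities involving inverses are mostly proved by composing with an isomorphism and
  cancelling it.\<close>

lemma cancel_left:
  assumes "a \<in> Ob C" "b \<in> Ob C" "c \<in> Ob C" "f \<in> carrier (Mor C a b)" "f' \<in> carrier (Mor C a b)"
    "iso_mor C b c g" "Cmp C a b c g f = Cmp C a b c g f'"
  shows "f = f'"
proof -
  let ?i = "inv_mor C b c g"
  note i = iso_mor_carrier[OF assms(2,3,6)] inv_mor_closed[OF assms(2,3,6)] inv_mor_left[OF assms(2,3,6)]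
  have *: "h = Cmp C a c b ?i (Cmp C a b c g h)" if "h \<in> carrier (Mor C a b)" for h
    using Cmp_assoc[of a b c b h g ?i] i that assms by (simp add: Idt_left)
  show ?thesis using *[of f] *[of f'] assms by simp
qed

lemma cancel_right:
  assumes "a \<in> Ob C" "b \<in> Ob C" "c \<in> Ob C" "g \<in> carrier (Mor C b c)" "g' \<in> carrier (Mor C b c)"
    "iso_mor C a b f" "Cmp C a b c g f = Cmp C a b c g' f"
  shows "g = g'"
proof -
  let ?i = "inv_mor C a b f"
  note i = iso_mor_carrier[OF assms(1,2,6)] inv_mor_closed[OF assms(1,2,6)] inv_mor_right[OF assms(1,2,6)]
  have *: "h = Cmp C b a c (Cmp C a b c h f) ?i" if "h \<in> carrier (Mor C b c)" for h
    using Cmp_assoc[of b a b c ?i f h] i that assms by (simp add: Idt_right)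
  show ?thesis using *[of g] *[of g'] assms by simp
qed

end

context linear_category
begin

lemma Mor_abelian_group: "\<lbrakk>a \<in> Ob C; b \<in> Ob C\<rbrakk> \<Longrightarrow> abelian_group (Mor C a b)"
  using Mor_module by (simp add: module_def)

lemmas Mor_monoid = Mor_abelian_group[THEN abelian_group.axioms(1)]

lemmas Mor_add_closed [simp] = abelian_monoid.a_closed[OF Mor_monoid]
  and Mor_zero_closed [simp] = abelian_monoid.zero_closed[OF Mor_monoid]
  and Mor_l_zero [simp] = abelian_monoid.l_zero[OF Mor_monoid]
  and Mor_r_zero [simp] = abelian_monoid.r_zero[OF Mor_monoid]
  and Mor_neg_closed [simp] = abelian_group.a_inv_closed[OF Mor_abelian_group]
  and Mor_neg_neg [simp] = abelian_group.minus_minus[OF Mor_abelian_group]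
  and Mor_neg_add = abelian_group.minus_add[OF Mor_abelian_group]
  and Mor_smult_closed [simp] = module.smult_closed[OF Mor_module]
  and Mor_smult_add = module.smult_r_distr[OF Mor_module]
  and Mor_smult_neg = module.smult_r_minus[OF Mor_module]
  and Mor_smult_zero [simp] = module.smult_r_null[OF Mor_module]
  and Mor_koszul_closed [simp] = module.koszul_closed[OF Mor_module]
  and Mor_koszul_koszul = module.koszul_koszul[OF Mor_module]
  and Mor_koszul_add = module.koszul_add[OF Mor_module]
  and Mor_koszul_smult = module.koszul_smult[OF Mor_module]
  and Mor_koszul_null [simp] = module.koszul_null[OF Mor_module]

text \<open>Writing -f as (-1) f and the zero morphism as 0 f lets compatibility with scalars alone
  settle compatibility with negation and zero, for composition here and for functors later.\<close>

lemma
  assumes ab: "a \<in> Ob C" "b \<in> Ob C"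
  shows Mor_neg_smult: "f \<in> carrier (Mor C a b) \<Longrightarrow> \<ominus>\<^bsub>Mor C a b\<^esub> f = (\<ominus> \<one>) \<odot>\<^bsub>Mor C a b\<^esub> f"
    and Mor_null_smult: "f \<in> carrier (Mor C a b) \<Longrightarrow> \<zero>\<^bsub>Mor C a b\<^esub> = \<zero> \<odot>\<^bsub>Mor C a b\<^esub> f"
    and Mor_neg_zero [simp]: "\<ominus>\<^bsub>Mor C a b\<^esub> \<zero>\<^bsub>Mor C a b\<^esub> = \<zero>\<^bsub>Mor C a b\<^esub>"
proof -
  interpret M: module K "Mor C a b" using ab by (rule Mor_module)
  show "f \<in> carrier (Mor C a b) \<Longrightarrow> \<ominus>\<^bsub>Mor C a b\<^esub> f = (\<ominus> \<one>) \<odot>\<^bsub>Mor C a b\<^esub> f"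
    "f \<in> carrier (Mor C a b) \<Longrightarrow> \<zero>\<^bsub>Mor C a b\<^esub> = \<zero> \<odot>\<^bsub>Mor C a b\<^esub> f"
    "\<ominus>\<^bsub>Mor C a b\<^esub> \<zero>\<^bsub>Mor C a b\<^esub> = \<zero>\<^bsub>Mor C a b\<^esub>"
    by (simp_all add: M.smult_l_minus)
qed

lemma Cmp_zero_left [simp]:
  assumes "a \<in> Ob C" "b \<in> Ob C" "c \<in> Ob C" "f \<in> carrier (Mor C a b)"
  shows "Cmp C a b c \<zero>\<^bsub>Mor C b c\<^esub> f = \<zero>\<^bsub>Mor C a c\<^esub>"
  using Cmp_smult_left[of a b c "\<zero>" f "\<zero>\<^bsub>Mor C b c\<^esub>"] assms
  by (simp flip: Mor_null_smult add: Cmp_closed)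

lemma Cmp_zero_right [simp]:
  assumes "a \<in> Ob C" "b \<in> Ob C" "c \<in> Ob C" "g \<in> carrier (Mor C b c)"
  shows "Cmp C a b c g \<zero>\<^bsub>Mor C a b\<^esub> = \<zero>\<^bsub>Mor C a c\<^esub>"
  using Cmp_smult_right[of a b c "\<zero>" "\<zero>\<^bsub>Mor C a b\<^esub>" g] assms
  by (simp flip: Mor_null_smult add: Cmp_closed)

lemma
  assumes "a \<in> Ob C" "b \<in> Ob C" "c \<in> Ob C" "f \<in> carrier (Mor C a b)" "g \<in> carrier (Mor C b c)"
  shows Cmp_neg_left: "Cmp C a b c (\<ominus>\<^bsub>Mor C b c\<^esub> g) f = \<ominus>\<^bsub>Mor C a c\<^esub> (Cmp C a b c g f)"
    and Cmp_neg_right: "Cmp C a b c g (\<ominus>\<^bsub>Mor C a b\<^esub> f) = \<ominus>\<^bsub>Mor C a c\<^esub> (Cmp C a b c g f)"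
    and Cmp_koszul_left: "Cmp C a b c (koszul (Mor C b c) p g) f = koszul (Mor C a c) p (Cmp C a b c g f)"
    and Cmp_koszul_right: "Cmp C a b c g (koszul (Mor C a b) p f) = koszul (Mor C a c) p (Cmp C a b c g f)"
proof -
  show l: "Cmp C a b c (\<ominus>\<^bsub>Mor C b c\<^esub> g) f = \<ominus>\<^bsub>Mor C a c\<^esub> (Cmp C a b c g f)"
    using assms by (simp add: Mor_neg_smult Cmp_smult_left Cmp_closed)
  show r: "Cmp C a b c g (\<ominus>\<^bsub>Mor C a b\<^esub> f) = \<ominus>\<^bsub>Mor C a c\<^esub> (Cmp C a b c g f)"
    using assms by (simp add: Mor_neg_smult Cmp_smult_right Cmp_closed)
  show "Cmp C a b c (koszul (Mor C b c) p g) f = koszul (Mor C a c) p (Cmp C a b c g f)"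
    "Cmp C a b c g (koszul (Mor C a b) p f) = koszul (Mor C a c) p (Cmp C a b c g f)"
    using l r by (simp_all add: koszul_def)
qed

end

context supercategory
begin

lemma homog_carrier: "\<lbrakk>a \<in> Ob C; b \<in> Ob C; f \<in> homog (Mor C a b) p\<rbrakk> \<Longrightarrow> f \<in> carrier (Mor C a b)"
  using Mor_superspace superspace.homog_carrier by metis

lemmas homog_zero = superspace.zero_homog[OF Mor_superspace]
  and homog_neg = superspace.neg_homog[OF Mor_superspace]
  and homog_add = superspace.add_homog[OF Mor_superspace]
  and homog_smult = superspace.smult_homog[OF Mor_superspace]
  and homog_koszul = superspace.koszul_homog[OF Mor_superspace]
  and Mor_component_homog = superspace.component_homog[OF Mor_superspace]
  and Mor_component_carrier = superspace.component_carrier[OF Mor_superspace]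
  and Mor_component_sum = superspace.component_sum[OF Mor_superspace]
  and Mor_component_of_homog = superspace.component_of_homog[OF Mor_superspace]
  and Mor_component_add = superspace.component_add[OF Mor_superspace]
  and Mor_component_smult = superspace.component_smult[OF Mor_superspace]
  and Mor_homog_eq_zero = superspace.homog_eq_zero[OF Mor_superspace]
  and Mor_homog_induct = superspace.homog_induct[OF Mor_superspace, consumes 3, case_names homog add]
  and Mor_component_eqI = superspace.component_eqI[OF Mor_superspace]

lemmas [simp] = homog_zero homog_neg homog_add homog_smult homog_koszul Mor_component_homog
    Mor_component_carrier

text \<open>The odd part \<open>e\<^sub>1\<close> of an identity annihilates homogeneous morphisms: comparing parities in
  \<open>f = f e\<^sub>0 + f e\<^sub>1\<close> gives \<open>f e\<^sub>1 = 0\<close>.\<close>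

lemma Idt_even:
  assumes a: "a \<in> Ob C"
  shows "Idt C a \<in> homog (Mor C a a) 0"
proof -
  let ?i = "Idt C a" and ?e = "\<lambda>p. component (Mor C a a) p (Idt C a)"
  have i: "?i \<in> carrier (Mor C a a)" using a by (rule Idt_closed)
  have e: "?e p \<in> homog (Mor C a a) p" "?e p \<in> carrier (Mor C a a)" for p using a i by simp_all
  have *: "Cmp C a a a (?e p) (?e 1) = \<zero>\<^bsub>Mor C a a\<^esub>" for p
  proof -
    have "?e p = Cmp C a a a (?e p) (?e 0) \<oplus>\<^bsub>Mor C a a\<^esub> Cmp C a a a (?e p) (?e 1)"
      using a e i Idt_right[of a a "?e p"] Cmp_add_right[of a a a "?e 0" "?e 1" "?e p"]
        Mor_component_sum[OF a a i] by simp
    moreover have h: "Cmp C a a a (?e p) (?e 0) \<in> homog (Mor C a a) p"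
      "Cmp C a a a (?e p) (?e 1) \<in> homog (Mor C a a) (1 + p)"
      using a e(1) Cmp_even[of a a a "?e 0" 0 "?e p" p] Cmp_even[of a a a "?e 1" 1 "?e p" p] by simp_all
    moreover have "component (Mor C a a) (1 + p) (Cmp C a a a (?e p) (?e 0) \<oplus>\<^bsub>Mor C a a\<^esub> Cmp C a a a (?e p)
        (?e 1)) =
        Cmp C a a a (?e p) (?e 1)"
      using a e h by (simp add: Mor_component_add Mor_component_of_homog Cmp_closed)
    ultimately have "component (Mor C a a) (1 + p) (?e p) = Cmp C a a a (?e p) (?e 1)" by simp
    then show ?thesis using Mor_component_of_homog[OF a a e(1), of "1 + p" p] by simp
  qed
  \<comment> \<open>Expanding the identity as e_0 + e_1 leaves two products with e_1 on the right,
    both zero by the previous step; so e_1 = 0.\<close>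
  have "?e 1 = Cmp C a a a ?i (?e 1)" using a e by (simp add: Idt_left)
  also have "\<dots> = Cmp C a a a (?e 0) (?e 1) \<oplus>\<^bsub>Mor C a a\<^esub> Cmp C a a a (?e 1) (?e 1)"
    using a e Cmp_add_left[of a a a "?e 1" "?e 0" "?e 1"] Mor_component_sum[OF a a i] by simp
  also have "\<dots> = \<zero>\<^bsub>Mor C a a\<^esub>" using a by (simp add: *)
  finally have "?i = ?e 0" using a e Mor_component_sum[OF a a i] by simp
  then show ?thesis using e(1)[of 0] by simp
qed

text \<open>Write the inverse as g_p + g_(p+1). Then g_(p+1) f is the odd part of an identity, which
  is even, so it vanishes; composing with the inverse of f on the right gives g_(p+1) = 0.\<close>

lemma inv_mor_homog:
  assumes ab: "a \<in> Ob C" "b \<in> Ob C" and f: "f \<in> homog (Mor C a b) p" "iso_mor C a b f"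
  shows "inv_mor C a b f \<in> homog (Mor C b a) p"
proof -
  let ?g = "inv_mor C a b f" and ?c = "\<lambda>q. component (Mor C b a) q (inv_mor C a b f)"
  note g = inv_mor_closed[OF ab f(2)] inv_mor_left[OF ab f(2)] inv_mor_right[OF ab f(2)]
  have fc: "f \<in> carrier (Mor C a b)" using ab f(2) by (rule iso_mor_carrier)
  have c: "?c q \<in> homog (Mor C b a) q" "?c q \<in> carrier (Mor C b a)" for q using ab g by simp_all
  have s: "?c p \<oplus>\<^bsub>Mor C b a\<^esub> ?c (p + 1) = ?g"
    by (rule superspace.component_sum'[OF Mor_superspace]) (use ab g in auto)
  have "Cmp C a b a (?c p) f \<oplus>\<^bsub>Mor C a a\<^esub> Cmp C a b a (?c (p + 1)) f = Idt C a"
    using ab fc c s g Cmp_add_left[of a b a f "?c p" "?c (p + 1)"] by simp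
  moreover have "Cmp C a b a (?c p) f \<in> homog (Mor C a a) 0" "Cmp C a b a (?c (p + 1)) f \<in> homog (Mor C a a) 1"
    using Cmp_even[OF ab(1,2,1) f(1) c(1)[of p]] Cmp_even[OF ab(1,2,1) f(1) c(1)[of "p + 1"]] by simp_all
  ultimately have "Cmp C a b a (?c (p + 1)) f = component (Mor C a a) 1 (Idt C a)"
    using ab Mor_component_add[of a a "Cmp C a b a (?c p) f" "Cmp C a b a (?c (p + 1)) f" 1]
      Mor_component_of_homog[of a a "Cmp C a b a (?c p) f" 0 1] fc c
      Mor_component_of_homog[of a a "Cmp C a b a (?c (p + 1)) f" 1 1] by (simp add: Cmp_closed)
  then have z: "Cmp C a b a (?c (p + 1)) f = \<zero>\<^bsub>Mor C a a\<^esub>"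
    using Mor_component_of_homog[OF ab(1,1) Idt_even[OF ab(1)], of 1] by simp
  have "?c (p + 1) = Cmp C b a a (Cmp C a b a (?c (p + 1)) f) ?g"
    using ab g c fc by (simp add: Cmp_assoc Idt_right)
  then have "?c (p + 1) = \<zero>\<^bsub>Mor C b a\<^esub>" using z ab g by simp
  then have "?g = ?c p" using s ab c[of p] by simp
  then show ?thesis using c(1)[of p] by simp
qed

end

section \<open>Functors\<close>

context is_functor
begin

lemma fob_Ob [simp]: "a \<in> Ob A \<Longrightarrow> fob F a \<in> Ob B"
  using fob_closed by auto

lemma fmap_carrier [simp]:
  "\<lbrakk>a \<in> Ob A; b \<in> Ob A; f \<in> carrier (Mor A a b)\<rbrakk> \<Longrightarrow> fmap F a b f \<in> carrier (Mor B (fob F a) (fob F b))"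
  using fmap_closed by (fastforce simp: PiE_iff)

lemma fmap_iso:
  assumes "a \<in> Ob A" "b \<in> Ob A" "iso_mor A a b f"
  shows "iso_mor B (fob F a) (fob F b) (fmap F a b f)"
    and "inv_mor B (fob F a) (fob F b) (fmap F a b f) = fmap F b a (inv_mor A a b f)"
proof -
  note f = A.iso_mor_carrier[OF assms] A.inv_mor_closed[OF assms] A.inv_mor_left[OF assms]
      A.inv_mor_right[OF assms]
  have *: "Cmp B (fob F a) (fob F b) (fob F a) (fmap F b a (inv_mor A a b f)) (fmap F a b f) = Idt B (fob F a)"
    "Cmp B (fob F b) (fob F a) (fob F b) (fmap F a b f) (fmap F b a (inv_mor A a b f)) = Idt B (fob F b)"
    using assms f by (simp_all flip: fmap_Cmp add: fmap_Idt)
  show "iso_mor B (fob F a) (fob F b) (fmap F a b f)"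
    "inv_mor B (fob F a) (fob F b) (fmap F a b f) = fmap F b a (inv_mor A a b f)"
    using assms f * by (auto intro!: B.iso_morI B.inv_mor_equality)
qed

end

text \<open>Functors are \<open>undefined\<close> outside their domains, so agreement on the source
  category is equality in HOL. Strict identities between composites, required where functors are
  themselves morphisms of a category, are proved this way.\<close>

lemma functor_eqI:
  assumes F: "is_functor A B F" and G: "is_functor A B G"
    and ob: "\<And>a. a \<in> Ob A \<Longrightarrow> fob F a = fob G a"
    and map: "\<And>a b f. \<lbrakk>a \<in> Ob A; b \<in> Ob A; f \<in> carrier (Mor A a b)\<rbrakk> \<Longrightarrow> fmap F a b f = fmap G a b f"
  shows "F = G"
proof -
  interpret F: is_functor A B F by fact
  interpret G: is_functor A B G by fact
  have ext: "fob H \<in> extensional (Ob A)" "fmap H \<in> extensional (Ob A)"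
    "a \<in> Ob A \<Longrightarrow> fmap H a \<in> extensional (Ob A)"
    "\<lbrakk>a \<in> Ob A; b \<in> Ob A\<rbrakk> \<Longrightarrow> fmap H a b \<in> extensional (carrier (Mor A a b))"
    if "is_functor A B H" for H a b
    using is_functor.fob_closed[OF that] is_functor.fmap_closed[OF that] by (fastforce simp: PiE_iff)+
  have "fob F = fob G"
    by (rule extensionalityI[OF ext(1)[OF F] ext(1)[OF G]]) (rule ob)
  moreover have "fmap F = fmap G"
    by (rule extensionalityI[OF ext(2)[OF F] ext(2)[OF G]],
        rule extensionalityI[OF ext(3)[OF F] ext(3)[OF G]], assumption+,
        rule extensionalityI[OF ext(4)[OF F] ext(4)[OF G]], assumption+, rule map)
  ultimately show ?thesis by simp
qed

lemma fob_id_functor [simp]: "a \<in> Ob A \<Longrightarrow> fob (id_functor A) a = a"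
  and fmap_id_functor [simp]:
    "\<lbrakk>a \<in> Ob A; b \<in> Ob A; f \<in> carrier (Mor A a b)\<rbrakk> \<Longrightarrow> fmap (id_functor A) a b f = f"
  by (simp_all add: id_functor_def)

lemma fob_comp_functor [simp]: "a \<in> Ob A \<Longrightarrow> fob (comp_functor A G F) a = fob G (fob F a)"
  and fmap_comp_functor [simp]: "\<lbrakk>a \<in> Ob A; b \<in> Ob A; f \<in> carrier (Mor A a b)\<rbrakk>
    \<Longrightarrow> fmap (comp_functor A G F) a b f = fmap G (fob F a) (fob F b) (fmap F a b f)"
  by (simp_all add: comp_functor_def)

lemma is_functor_id:
  assumes "category A"
  shows "is_functor A A (id_functor A)"
proof -
  interpret category A by fact
  show ?thesis
    by unfold_locales (auto simp: Idt_closed Cmp_closed id_functor_def)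
qed

lemma linear_functor_id:
  assumes "linear_category K A"
  shows "linear_functor K A A (id_functor A)"
proof -
  interpret linear_category K A by fact
  interpret is_functor A A "id_functor A" by (rule is_functor_id) unfold_locales
  show ?thesis by unfold_locales simp_all
qed

lemma superfunctor_id:
  assumes "supercategory K A"
  shows "superfunctor K A A (id_functor A)"
proof -
  interpret supercategory K A by fact
  interpret linear_functor K A A "id_functor A" by (rule linear_functor_id) unfold_locales
  show ?thesis by unfold_locales (simp add: homog_carrier)
qed

lemma is_functor_comp:
  assumes "is_functor A B F" "is_functor B C G"
  shows "is_functor A C (comp_functor A G F)"
proof -
  interpret F: is_functor A B F by fact
  interpret G: is_functor B C G by fact
  show ?thesis
    by unfold_locales
      (auto simp: F.A.Idt_closed F.A.Cmp_closed comp_functor_def F.fmap_Idt G.fmap_Idt F.fmap_Cmp G.fmap_Cmp)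
qed

lemma linear_functor_comp:
  assumes "linear_functor K A B F" "linear_functor K B C G"
  shows "linear_functor K A C (comp_functor A G F)"
proof -
  interpret F: linear_functor K A B F by fact
  interpret G: linear_functor K B C G by fact
  interpret is_functor A C "comp_functor A G F" by (rule is_functor_comp) unfold_locales
  show ?thesis
    by unfold_locales (simp_all add: F.fmap_add G.fmap_add F.fmap_smult G.fmap_smult)
qed

lemma superfunctor_comp:
  assumes "superfunctor K A B F" "superfunctor K B C G"
  shows "superfunctor K A C (comp_functor A G F)"
proof -
  interpret F: superfunctor K A B F by fact
  interpret G: superfunctor K B C G by fact
  interpret linear_functor K A C "comp_functor A G F" by (rule linear_functor_comp) unfold_locales
  show ?thesis
    by unfold_locales (simp add: F.A.homog_carrier F.fmap_even G.fmap_even)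
qed

lemma comp_functor_id_left: "is_functor A B F \<Longrightarrow> comp_functor A (id_functor B) F = F"
  by (rule functor_eqI[of A B])
    (auto intro!: is_functor_comp is_functor_id is_functor.axioms(2) simp: is_functor.fob_Ob
        is_functor.fmap_carrier)

lemma comp_functor_id_right: "is_functor A B F \<Longrightarrow> comp_functor A F (id_functor A) = F"
  by (rule functor_eqI[of A B])
    (auto intro!: is_functor_comp is_functor_id is_functor.axioms(1))

lemma comp_functor_assoc:
  assumes "is_functor A B F" "is_functor B C G" "is_functor C D H"
  shows "comp_functor A (comp_functor B H G) F = comp_functor A H (comp_functor A G F)"
  by (rule functor_eqI[of A D])
    (use assms in \<open>auto intro!: is_functor_comp simp: is_functor.fob_Ob is_functor.fmap_carrier\<close>)

context linear_functor
begin

lemma fmap_neg: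
  "\<lbrakk>a \<in> Ob A; b \<in> Ob A; f \<in> carrier (Mor A a b)\<rbrakk>
    \<Longrightarrow> fmap F a b (\<ominus>\<^bsub>Mor A a b\<^esub> f) = \<ominus>\<^bsub>Mor B (fob F a) (fob F b)\<^esub> fmap F a b f"
  by (simp add: A.Mor_neg_smult B.Mor_neg_smult fmap_smult)

end

text \<open>Both sides of the multiplicativity law are biadditive, so it suffices to check it on
  homogeneous morphisms, where parities and signs are available.\<close>

lemma superfunctorI:
  assumes A: "supercategory K A" and B: "supercategory K B"
    and ob: "fob F \<in> Ob A \<rightarrow>\<^sub>E Ob B"
    and map: "fmap F \<in> (\<Pi>\<^sub>E a\<in>Ob A. \<Pi>\<^sub>E b\<in>Ob A. carrier (Mor A a b) \<rightarrow>\<^sub>E carrier (Mor B (fob F a) (fob F b)))"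
    and Idt: "\<And>a. a \<in> Ob A \<Longrightarrow> fmap F a a (Idt A a) = Idt B (fob F a)"
    and add: "\<And>a b f g. \<lbrakk>a \<in> Ob A; b \<in> Ob A; f \<in> carrier (Mor A a b); g \<in> carrier (Mor A a b)\<rbrakk>
      \<Longrightarrow> fmap F a b (f \<oplus>\<^bsub>Mor A a b\<^esub> g) = fmap F a b f \<oplus>\<^bsub>Mor B (fob F a) (fob F b)\<^esub> fmap F a b g"
    and smult: "\<And>a b r f. \<lbrakk>a \<in> Ob A; b \<in> Ob A; r \<in> carrier K; f \<in> carrier (Mor A a b)\<rbrakk>
      \<Longrightarrow> fmap F a b (r \<odot>\<^bsub>Mor A a b\<^esub> f) = r \<odot>\<^bsub>Mor B (fob F a) (fob F b)\<^esub> fmap F a b f"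
    and even: "\<And>a b p f. \<lbrakk>a \<in> Ob A; b \<in> Ob A; f \<in> homog (Mor A a b) p\<rbrakk>
      \<Longrightarrow> fmap F a b f \<in> homog (Mor B (fob F a) (fob F b)) p"
    and Cmp: "\<And>a b c p q f g. \<lbrakk>a \<in> Ob A; b \<in> Ob A; c \<in> Ob A; f \<in> homog (Mor A a b) p; g \<in> homog (Mor A b c) q\<rbrakk>
      \<Longrightarrow> fmap F a c (Cmp A a b c g f) = Cmp B (fob F a) (fob F b) (fob F c) (fmap F b c g) (fmap F a b f)"
  shows "superfunctor K A B F"
proof -
  interpret A: supercategory K A by fact
  interpret B: supercategory K B by fact
  have o: "a \<in> Ob A \<Longrightarrow> fob F a \<in> Ob B" for a using ob by auto
  have m: "\<lbrakk>a \<in> Ob A; b \<in> Ob A; f \<in> carrier (Mor A a b)\<rbrakk> \<Longrightarrow> fmap F a b f \<in> carrier (Mor B (fob F a) (fob F b))"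
    for a b f using map by (fastforce simp: PiE_iff)
  have Cmp1: "fmap F a c (Cmp A a b c g f) = Cmp B (fob F a) (fob F b) (fob F c) (fmap F b c g) (fmap F a b f)"
    if abc: "a \<in> Ob A" "b \<in> Ob A" "c \<in> Ob A" and f: "f \<in> carrier (Mor A a b)" and g: "g \<in> homog (Mor A b c) q"
    for a b c f g q
    using f
  proof (induction rule: A.Mor_homog_induct[OF abc(1,2), consumes 1, case_names homog add])
    case (homog p u)
    then show ?case using abc g by (rule_tac Cmp)
  next
    case (add u w)
    then show ?case using abc A.homog_carrier[OF _ _ g]
      by (simp add: A.Cmp_add_right B.Cmp_add_right o m assms(6) A.Cmp_closed)
  qed
  have "fmap F a c (Cmp A a b c g f) = Cmp B (fob F a) (fob F b) (fob F c) (fmap F b c g) (fmap F a b f)"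
    if abc: "a \<in> Ob A" "b \<in> Ob A" "c \<in> Ob A" and f: "f \<in> carrier (Mor A a b)" and g: "g \<in> carrier (Mor A b c)"
    for a b c f g
    using g
  proof (induction rule: A.Mor_homog_induct[OF abc(2,3), consumes 1, case_names homog add])
    case (homog p u)
    then show ?case using abc f by (rule_tac Cmp1)
  next
    case (add u w)
    then show ?case using abc f
      by (simp add: A.Cmp_add_left B.Cmp_add_left o m assms(6) A.Cmp_closed)
  qed
  then show ?thesis
    by unfold_locales (use assms(3-8) in auto)
qed

section \<open>Supernatural transformations\<close>

locale parallel_superfunctors =
  A: supercategory K A + B: supercategory K B + F: superfunctor K A B F + G: superfunctor K A B G
  for K :: "'k ring" (structure) and A :: "('o, 'k, 'm) supercat" and B :: "('p, 'k, 'n) supercat" and F G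
begin

text \<open>A family of parity p has p-component equal to itself and the other component zero. The
  sign rule, imposed on each component, thus reduces to one instance, the other reading 0 =
  0.\<close>

lemma supernatural_of_parity_iff:
  "supernatural_of_parity p A B F G x \<longleftrightarrow> x \<in> families A B F G \<and>
    (\<forall>a\<in>Ob A. x a \<in> homog (Mor B (fob F a) (fob G a)) p) \<and>
    (\<forall>a\<in>Ob A. \<forall>b\<in>Ob A. \<forall>q. \<forall>f\<in>homog (Mor A a b) q.
      Cmp B (fob F a) (fob F b) (fob G b) (x b) (fmap F a b f) =
      koszul (Mor B (fob F a) (fob G b)) (p * q) (Cmp B (fob F a) (fob G a) (fob G b) (fmap G a b f) (x a)))"
    (is "?l \<longleftrightarrow> ?f \<and> ?h \<and> ?n")
proof
  assume l: ?l
  then have h: ?f ?h unfolding supernatural_of_parity_def supernatural_def by blast+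
  have ?n
  proof (intro ballI allI)
    fix a b q f assume ab: "a \<in> Ob A" "b \<in> Ob A" and f: "f \<in> homog (Mor A a b) q"
    then have "component (Mor B (fob F c) (fob G c)) p (x c) = x c" if "c \<in> Ob A" for c
      using that B.Mor_component_of_homog[OF _ _ h(2)[THEN bspec]] by simp
    then show "Cmp B (fob F a) (fob F b) (fob G b) (x b) (fmap F a b f) =
      koszul (Mor B (fob F a) (fob G b)) (p * q) (Cmp B (fob F a) (fob G a) (fob G b) (fmap G a b f) (x a))"
      using l ab f unfolding supernatural_of_parity_def supernatural_def by metis
  qed
  with h show "?f \<and> ?h \<and> ?n" by blast
next
  assume r: "?f \<and> ?h \<and> ?n"
  have "Cmp B (fob F a) (fob F b) (fob G b) (component (Mor B (fob F b) (fob G b)) r (x b)) (fmap F a b f) =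
      koszul (Mor B (fob F a) (fob G b)) (r * q) (Cmp B (fob F a) (fob G a) (fob G b)
          (fmap G a b f) (component (Mor B (fob F a) (fob G a)) r (x a)))"
    if ab: "a \<in> Ob A" "b \<in> Ob A" and f: "f \<in> homog (Mor A a b) q" for a b q f r
  proof -
    have c: "component (Mor B (fob F c) (fob G c)) r (x c)
        = (if r = p then x c else \<zero>\<^bsub>Mor B (fob F c) (fob G c)\<^esub>)"
      if "c \<in> Ob A" for c using that r B.Mor_component_of_homog[of "fob F c" "fob G c" "x c" p r] by simp
    show ?thesis using ab f r A.homog_carrier[OF ab f] by (auto simp: c)
  qed
  then show ?l using r unfolding supernatural_of_parity_def supernatural_def by blast
qed

text \<open>The sign rule treats the two components separately. This is what splits a transformation
  into an even and an odd one and so grades the space of transformations.\<close>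

lemma supernatural_iff:
  "supernatural A B F G x \<longleftrightarrow> x \<in> families A B F G \<and>
    (\<forall>p. supernatural_of_parity p A B F G (\<lambda>a\<in>Ob A. component (Mor B (fob F a) (fob G a)) p (x a)))"
  unfolding supernatural_of_parity_iff
  by (auto simp: supernatural_def families_def PiE_iff)

lemma supernatural_carrier:
  "\<lbrakk>supernatural A B F G x; a \<in> Ob A\<rbrakk> \<Longrightarrow> x a \<in> carrier (Mor B (fob F a) (fob G a))"
  by (auto simp: supernatural_def families_def PiE_iff)

lemma supernatural_zero: "supernatural_of_parity p A B F G (\<lambda>a\<in>Ob A. \<zero>\<^bsub>Mor B (fob F a) (fob G a)\<^esub>)"
  unfolding supernatural_of_parity_iff families_def by (auto simp: A.homog_carrier)

lemma supernatural_add: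
  assumes "supernatural A B F G x" "supernatural A B F G y"
  shows "supernatural A B F G (\<lambda>a\<in>Ob A. x a \<oplus>\<^bsub>Mor B (fob F a) (fob G a)\<^esub> y a)"
  using assms unfolding supernatural_def families_def
  by (auto simp: PiE_iff B.Mor_component_add B.Cmp_add_left B.Cmp_add_right B.Mor_koszul_add
      A.homog_carrier B.Cmp_closed)

lemma supernatural_smult:
  assumes "r \<in> carrier K" "supernatural A B F G x"
  shows "supernatural A B F G (\<lambda>a\<in>Ob A. r \<odot>\<^bsub>Mor B (fob F a) (fob G a)\<^esub> x a)"
  using assms unfolding supernatural_def families_def
  by (auto simp: PiE_iff B.Mor_component_smult B.Cmp_smult_left B.Cmp_smult_right B.Mor_koszul_smult
      A.homog_carrier B.Cmp_closed)

lemma supernatural_of_parity_supernatural: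
  "supernatural_of_parity p A B F G x \<Longrightarrow> supernatural A B F G x"
  by (simp add: supernatural_of_parity_def)

lemma supernatural_of_parity_add:
  assumes "supernatural_of_parity p A B F G x" "supernatural_of_parity p A B F G y"
  shows "supernatural_of_parity p A B F G (\<lambda>a\<in>Ob A. x a \<oplus>\<^bsub>Mor B (fob F a) (fob G a)\<^esub> y a)"
  using assms supernatural_add[of x y] unfolding supernatural_of_parity_def by simp

lemma supernatural_of_parity_smult:
  assumes "r \<in> carrier K" "supernatural_of_parity p A B F G x"
  shows "supernatural_of_parity p A B F G (\<lambda>a\<in>Ob A. r \<odot>\<^bsub>Mor B (fob F a) (fob G a)\<^esub> x a)"
  using assms supernatural_smult[of r x] unfolding supernatural_of_parity_def by simp

lemma supernatural_decomp:
  assumes "supernatural A B F G x"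
  obtains y z where "supernatural_of_parity 0 A B F G y" "supernatural_of_parity 1 A B F G z"
    "x = (\<lambda>a\<in>Ob A. y a \<oplus>\<^bsub>Mor B (fob F a) (fob G a)\<^esub> z a)"
proof (rule that)
  have c: "supernatural_of_parity p A B F G (\<lambda>a\<in>Ob A. component (Mor B (fob F a) (fob G a)) p (x a))" for p
    using assms supernatural_iff[of x] by blast
  show "supernatural_of_parity 0 A B F G (\<lambda>a\<in>Ob A. component (Mor B (fob F a) (fob G a)) 0 (x a))"
    "supernatural_of_parity 1 A B F G (\<lambda>a\<in>Ob A. component (Mor B (fob F a) (fob G a)) 1 (x a))"
    by (rule c)+
  have "x \<in> extensional (Ob A)" using assms by (auto simp: supernatural_def families_def PiE_iff)
  then show "x = (\<lambda>a\<in>Ob A. (\<lambda>a\<in>Ob A. component (Mor B (fob F a) (fob G a)) 0 (x a)) a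
      \<oplus>\<^bsub>Mor B (fob F a) (fob G a)\<^esub> (\<lambda>a\<in>Ob A. component (Mor B (fob F a) (fob G a)) 1 (x a)) a)"
    by (rule extensionalityI) (use assms in \<open>auto simp: B.Mor_component_sum supernatural_carrier\<close>)
qed

end

text \<open>For f of parity r, moving x past f contributes the exponent p r and moving y past f
  contributes q r; they add up to (q + p) r.\<close>

lemma supernatural_of_parity_vcomp:
  fixes K :: "'k ring"
  assumes "superfunctor K A B F" "superfunctor K A B G" "superfunctor K A B H"
    and "supernatural_of_parity p A B F G x" "supernatural_of_parity q A B G H y"
  shows "supernatural_of_parity (q + p) A B F H (vcomp A B F G H y x)"
proof -
  interpret F: superfunctor K A B F by fact
  interpret G: superfunctor K A B G by fact
  interpret H: superfunctor K A B H by fact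
  interpret FG: parallel_superfunctors K A B F G by unfold_locales
  interpret GH: parallel_superfunctors K A B G H by unfold_locales
  interpret FH: parallel_superfunctors K A B F H by unfold_locales
  note x = assms(4)[unfolded FG.supernatural_of_parity_iff, THEN conjunct2, THEN conjunct1, THEN bspec]
    assms(4)[unfolded FG.supernatural_of_parity_iff, THEN conjunct2, THEN conjunct2, rule_format]
  note y = assms(5)[unfolded GH.supernatural_of_parity_iff, THEN conjunct2, THEN conjunct1, THEN bspec]
    assms(5)[unfolded GH.supernatural_of_parity_iff, THEN conjunct2, THEN conjunct2, rule_format]
  note xc = FG.supernatural_carrier[OF FG.supernatural_of_parity_supernatural[OF assms(4)]]
  note yc = GH.supernatural_carrier[OF GH.supernatural_of_parity_supernatural[OF assms(5)]]
  have h: "Cmp B (fob F a) (fob G a) (fob H a) (y a) (x a) \<in> homog (Mor B (fob F a) (fob H a)) (q + p)"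
    if "a \<in> Ob A" for a
    using F.B.Cmp_even[OF _ _ _ x(1) y(1)] that by (simp add: add.commute)
  show ?thesis
    unfolding FH.supernatural_of_parity_iff
  proof (intro conjI ballI allI)
    show "vcomp A B F G H y x \<in> families A B F H"
      by (auto simp: vcomp_def families_def F.B.Cmp_closed xc yc)
    fix a assume a: "a \<in> Ob A"
    then show "vcomp A B F G H y x a \<in> homog (Mor B (fob F a) (fob H a)) (q + p)" by (simp add: h vcomp_def)
    fix b r f assume b: "b \<in> Ob A" and f: "f \<in> homog (Mor A a b) r"
    note fc = F.A.homog_carrier[OF a b f]
    let ?C = "\<lambda>X Y Z. Cmp B (fob X a) (fob Y b) (fob Z b)"
    have "?C F F H (vcomp A B F G H y x b) (fmap F a b f) = ?C F G H (y b) (?C F F G (x b) (fmap F a b f))"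
      using a b fc by (simp add: vcomp_def F.B.Cmp_assoc xc yc)
    also have "\<dots> = koszul (Mor B (fob F a) (fob H b)) (p * r)
        (?C F G H (y b) (Cmp B (fob F a) (fob G a) (fob G b) (fmap G a b f) (x a)))"
      using a b fc by (simp add: x(2)[OF a b f] F.B.Cmp_koszul_right F.B.Cmp_closed xc yc)
    also have "\<dots> = koszul (Mor B (fob F a) (fob H b)) (p * r)
        (Cmp B (fob F a) (fob G a) (fob H b) (?C G G H (y b) (fmap G a b f)) (x a))"
      using a b fc by (simp add: F.B.Cmp_assoc xc yc)
    also have "\<dots> = koszul (Mor B (fob F a) (fob H b)) ((q + p) * r)
        (Cmp B (fob F a) (fob H a) (fob H b) (fmap H a b f) (vcomp A B F G H y x a))"
      using a b fc by (simp add: y(2)[OF a b f] vcomp_def F.B.Cmp_koszul_left F.B.Mor_koszul_koszul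
          F.B.Cmp_closed xc yc F.B.Cmp_assoc distrib_right add.commute)
    finally show "?C F F H (vcomp A B F G H y x b) (fmap F a b f)
        = koszul (Mor B (fob F a) (fob H b)) ((q + p) * r)
        (Cmp B (fob F a) (fob H a) (fob H b) (fmap H a b f) (vcomp A B F G H y x a))" .
  qed
qed

lemma supernatural_id:
  fixes K :: "'k ring"
  assumes "superfunctor K A B F"
  shows "supernatural_of_parity 0 A B F F (id_trans A B F)"
proof -
  interpret F: superfunctor K A B F by fact
  interpret FF: parallel_superfunctors K A B F F by unfold_locales
  show ?thesis
    unfolding FF.supernatural_of_parity_iff
    by (auto simp: families_def id_trans_def F.B.Idt_closed F.B.Idt_even F.B.Idt_left F.B.Idt_right
        F.A.homog_carrier)
qed

text \<open>Composition is biadditive, so the composite is a sum of four composites of homogeneous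
  transformations.\<close>

lemma supernatural_vcomp:
  fixes K :: "'k ring"
  assumes F: "superfunctor K A B F" and G: "superfunctor K A B G" and H: "superfunctor K A B H"
    and x: "supernatural A B F G x" and y: "supernatural A B G H y"
  shows "supernatural A B F H (vcomp A B F G H y x)"
proof -
  interpret F: superfunctor K A B F by fact
  interpret G: superfunctor K A B G by fact
  interpret H: superfunctor K A B H by fact
  interpret FG: parallel_superfunctors K A B F G by unfold_locales
  interpret GH: parallel_superfunctors K A B G H by unfold_locales
  interpret FH: parallel_superfunctors K A B F H by unfold_locales
  obtain x0 x1 where x01: "supernatural_of_parity 0 A B F G x0" "supernatural_of_parity 1 A B F G x1"
    and xs: "x = (\<lambda>a\<in>Ob A. x0 a \<oplus>\<^bsub>Mor B (fob F a) (fob G a)\<^esub> x1 a)" using FG.supernatural_decomp[OF x] .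
  obtain y0 y1 where y01: "supernatural_of_parity 0 A B G H y0" "supernatural_of_parity 1 A B G H y1"
    and ys: "y = (\<lambda>a\<in>Ob A. y0 a \<oplus>\<^bsub>Mor B (fob G a) (fob H a)\<^esub> y1 a)" using GH.supernatural_decomp[OF y] .
  note xc = x01[THEN FG.supernatural_of_parity_supernatural, THEN FG.supernatural_carrier]
  note yc = y01[THEN GH.supernatural_of_parity_supernatural, THEN GH.supernatural_carrier]
  let ?v = "\<lambda>y x. vcomp A B F G H y x"
  let ?s = "\<lambda>u w. \<lambda>a\<in>Ob A. u a \<oplus>\<^bsub>Mor B (fob F a) (fob H a)\<^esub> w a"
  have "supernatural A B F H (?v y' x')"
    if "supernatural_of_parity p A B F G x'" "supernatural_of_parity q A B G H y'" for p q x' y'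
    using supernatural_of_parity_vcomp[OF F G H that] by (rule FH.supernatural_of_parity_supernatural)
  then have "supernatural A B F H (?s (?s (?v y0 x0) (?v y1 x0)) (?s (?v y0 x1) (?v y1 x1)))"
    using x01 y01 by (intro FH.supernatural_add) blast+
  moreover have "?v y x = ?s (?s (?v y0 x0) (?v y1 x0)) (?s (?v y0 x1) (?v y1 x1))"
    unfolding xs ys vcomp_def
    by (rule restrict_ext) (simp add: xc yc F.B.Cmp_add_left F.B.Cmp_add_right)
  ultimately show ?thesis by simp
qed

section \<open>The supercategory of superfunctors\<close>

lemma hom_supercat_simps [simp]:
  "Ob (hom_supercat K A B) = {F. superfunctor K A B F}"
  "carrier (Mor (hom_supercat K A B) F G) = {x. supernatural A B F G x}"
  "zero (Mor (hom_supercat K A B) F G) = (\<lambda>a\<in>Ob A. \<zero>\<^bsub>Mor B (fob F a) (fob G a)\<^esub>)"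
  "add (Mor (hom_supercat K A B) F G) = (\<lambda>x y. \<lambda>a\<in>Ob A. x a \<oplus>\<^bsub>Mor B (fob F a) (fob G a)\<^esub> y a)"
  "smult (Mor (hom_supercat K A B) F G) = (\<lambda>r x. \<lambda>a\<in>Ob A. r \<odot>\<^bsub>Mor B (fob F a) (fob G a)\<^esub> x a)"
  "homog (Mor (hom_supercat K A B) F G) p = {x. supernatural_of_parity p A B F G x}"
  "Cmp (hom_supercat K A B) = vcomp A B"
  "Idt (hom_supercat K A B) = id_trans A B"
  by (simp_all add: hom_supercat_def)

lemma supernatural_ext:
  assumes "supernatural A B F G x" "supernatural A B F G y" "\<And>a. a \<in> Ob A \<Longrightarrow> x a = y a"
  shows "x = y"
  using assms by (intro extensionalityI[of x "Ob A" y]) (auto simp: supernatural_def families_def PiE_iff)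

lemma (in parallel_superfunctors) Mor_hom_superspace: "superspace K (Mor (hom_supercat K A B) F G)"
proof -
  let ?H = "Mor (hom_supercat K A B) F G"
  note c = supernatural_carrier
  note m = B.Mor_module[OF F.fob_Ob G.fob_Ob]
  note ag = B.Mor_abelian_group[OF F.fob_Ob G.fob_Ob]
  note zero = supernatural_zero[THEN supernatural_of_parity_supernatural]
  have abelian: "abelian_group ?H"
  proof (rule abelian_groupI)
    fix x assume "x \<in> carrier ?H"
    then have x: "supernatural A B F G x" by simp
    \<comment> \<open>Chosen as a scalar multiple because closure of supernatural transformations
      under scalars is already known.\<close>
    let ?y = "\<lambda>a\<in>Ob A. (\<ominus> \<one>) \<odot>\<^bsub>Mor B (fob F a) (fob G a)\<^esub> x a"
    show "\<exists>y\<in>carrier ?H. y \<oplus>\<^bsub>?H\<^esub> x = \<zero>\<^bsub>?H\<^esub>"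
    proof (rule bexI[of _ ?y])
      show y: "?y \<in> carrier ?H" using supernatural_smult[OF _ x] by simp
      show "?y \<oplus>\<^bsub>?H\<^esub> x = \<zero>\<^bsub>?H\<^esub>"
        unfolding hom_supercat_simps
        by (rule restrict_ext)
          (simp add: B.Mor_neg_smult[symmetric] c[OF x] abelian_group.l_neg[OF ag])
    qed
  next
    fix x assume "x \<in> carrier ?H"
    then have x: "supernatural A B F G x" by simp
    show "\<zero>\<^bsub>?H\<^esub> \<oplus>\<^bsub>?H\<^esub> x = x"
      using supernatural_ext[OF supernatural_add[OF zero x] x] by (simp add: c[OF x])
  next
    fix x y z assume "x \<in> carrier ?H" "y \<in> carrier ?H" "z \<in> carrier ?H"
    then show "x \<oplus>\<^bsub>?H\<^esub> y \<oplus>\<^bsub>?H\<^esub> z = x \<oplus>\<^bsub>?H\<^esub> (y \<oplus>\<^bsub>?H\<^esub> z)"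
      by (auto simp: c abelian_monoid.a_assoc[OF abelian_group.axioms(1)[OF ag]] intro!: restrict_ext)
  next
    fix x y assume "x \<in> carrier ?H" "y \<in> carrier ?H"
    then show "x \<oplus>\<^bsub>?H\<^esub> y = y \<oplus>\<^bsub>?H\<^esub> x"
      by (auto simp: c abelian_monoid.a_comm[OF abelian_group.axioms(1)[OF ag]] intro!: restrict_ext)
  qed (use zero supernatural_add in auto)
  have "module K ?H"
  proof (rule moduleI[OF A.is_cring abelian])
    fix x assume "x \<in> carrier ?H"
    then have x: "supernatural A B F G x" by simp
    show "\<one> \<odot>\<^bsub>?H\<^esub> x = x"
      using supernatural_ext[OF supernatural_smult[OF _ x] x] by (simp add: c[OF x] module.smult_one[OF m])
  qed (auto intro!: restrict_ext intro: supernatural_smult simp: c module.smult_assoc1[OF m]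
      module.smult_l_distr[OF m] module.smult_r_distr[OF m])
  then interpret H: module K ?H .
  show ?thesis
  proof (intro superspace.intro superspace_axioms.intro)
    show "field K" "module K ?H" by unfold_locales
    show "submodule (homog ?H p) K ?H" for p
      by (rule H.submoduleI_smult)
        (use supernatural_zero supernatural_of_parity_add supernatural_of_parity_smult in
          \<open>auto simp: supernatural_of_parity_def\<close>)
    show "homog ?H 0 \<inter> homog ?H 1 = {\<zero>\<^bsub>?H\<^esub>}"
    proof (intro equalityI subsetI)
      fix x assume x: "x \<in> homog ?H 0 \<inter> homog ?H 1"
      then have "x a = \<zero>\<^bsub>Mor B (fob F a) (fob G a)\<^esub>" if "a \<in> Ob A" for a
        using that B.Mor_homog_eq_zero[of "fob F a" "fob G a" "x a" 0 1]
        by (simp add: supernatural_of_parity_def)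
      then show "x \<in> {\<zero>\<^bsub>?H\<^esub>}"
        using x supernatural_ext[OF _ zero, of x] by (simp add: supernatural_of_parity_def)
    qed (use supernatural_zero in simp)
    fix x assume "x \<in> carrier ?H"
    then have x: "supernatural A B F G x" by simp
    obtain y z where "supernatural_of_parity 0 A B F G y" "supernatural_of_parity 1 A B F G z"
      "x = (\<lambda>a\<in>Ob A. y a \<oplus>\<^bsub>Mor B (fob F a) (fob G a)\<^esub> z a)" using supernatural_decomp[OF x] .
    then show "\<exists>u\<in>homog ?H 0. \<exists>w\<in>homog ?H 1. x = u \<oplus>\<^bsub>?H\<^esub> w"
      unfolding hom_supercat_simps by blast
  qed
qed

text \<open>The equational laws hold componentwise in \<open>B\<close>; supernaturality enters only
  through closure properties.\<close>

lemma supercategory_hom: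
  assumes A: "supercategory K A" and B: "supercategory K B"
  shows "supercategory K (hom_supercat K A B)"
proof -
  interpret A: supercategory K A by fact
  interpret B: supercategory K B by fact
  have ps: "parallel_superfunctors K A B F G" if "superfunctor K A B F" "superfunctor K A B G" for F G
    using that A B by (simp add: parallel_superfunctors_def)
  note c = parallel_superfunctors.supernatural_carrier[OF ps]
  note v = supernatural_vcomp
  note i = supernatural_id[THEN supernatural_of_parity_def[THEN iffD1], THEN conjunct1]
  note o = superfunctor.axioms(3)[THEN linear_functor.axioms(3), THEN is_functor.fob_Ob]
  show ?thesis
  proof (intro supercategory.intro linear_category.intro category.intro linear_category_axioms.intro
      supercategory_axioms.intro A.field_axioms)
    fix F G x assume "F \<in> Ob (hom_supercat K A B)" "G \<in> Ob (hom_supercat K A B)"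
      "x \<in> carrier (Mor (hom_supercat K A B) F G)"
    then have *: "superfunctor K A B F" "superfunctor K A B G" "supernatural A B F G x" by simp_all
    show "Cmp (hom_supercat K A B) F G G (Idt (hom_supercat K A B) G) x = x"
      using supernatural_ext[OF v[OF *(1,2,2) *(3) i[OF *(2)]] *(3)] *
      by (simp add: vcomp_def id_trans_def B.Idt_left c o)
    show "Cmp (hom_supercat K A B) F F G x (Idt (hom_supercat K A B) F) = x"
      using supernatural_ext[OF v[OF *(1,1,2) i[OF *(1)] *(3)] *(3)] *
      by (simp add: vcomp_def id_trans_def B.Idt_right c o)
  next
    fix F G
    assume "F \<in> Ob (hom_supercat K A B)" "G \<in> Ob (hom_supercat K A B)"
    then have s: "superspace K (Mor (hom_supercat K A B) F G)"
      by (simp add: parallel_superfunctors.Mor_hom_superspace ps)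
    then show "superspace K (Mor (hom_supercat K A B) F G)" .
    from s show "module K (Mor (hom_supercat K A B) F G)" by (rule superspace.axioms(2))
  next
    fix F G H p q x y
    assume "F \<in> Ob (hom_supercat K A B)" "G \<in> Ob (hom_supercat K A B)" "H \<in> Ob (hom_supercat K A B)"
      "x \<in> homog (Mor (hom_supercat K A B) F G) p" "y \<in> homog (Mor (hom_supercat K A B) G H) q"
    then show "Cmp (hom_supercat K A B) F G H y x \<in> homog (Mor (hom_supercat K A B) F H) (p + q)"
      using supernatural_of_parity_vcomp[of K A B F G H p x q y] by (simp add: add.commute)
  qed (auto intro!: restrict_ext intro: i v[unfolded vcomp_def] simp: vcomp_def c o B.Cmp_assoc B.Cmp_closed
      B.Cmp_add_left B.Cmp_add_right
      B.Cmp_smult_left B.Cmp_smult_right)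
qed

text \<open>The pointwise inverses are even by \<open>inv_mor_homog\<close>, and their naturality
  follows from that of x by cancelling the isomorphism x_b. As x is even, no sign arises.\<close>

lemma hom_supercat_isoI:
  assumes F: "superfunctor K A B F" and G: "superfunctor K A B G"
    and x: "supernatural_iso_of_parity 0 A B F G x"
  shows "iso_mor (hom_supercat K A B) F G x"
proof -
  interpret parallel_superfunctors K A B F G
    using F G by (simp add: parallel_superfunctors_def superfunctor_def)
  interpret GF: parallel_superfunctors K A B G F by unfold_locales
  let ?y = "inv_trans A B F G x"
  note x' = x[unfolded supernatural_iso_of_parity_def supernatural_of_parity_iff]
  have iso: "iso_mor B (fob F a) (fob G a) (x a)" if "a \<in> Ob A" for a using x' that by blast
  note xi = B.iso_mor_carrier[OF _ _ iso] B.inv_mor_closed[OF _ _ iso]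
    B.inv_mor_left[OF _ _ iso] B.inv_mor_right[OF _ _ iso]
  have y: "supernatural_of_parity 0 A B G F ?y"
    unfolding GF.supernatural_of_parity_iff
  proof (intro conjI ballI allI)
    show "?y \<in> families A B G F" by (auto simp: inv_trans_def families_def xi)
    fix a assume a: "a \<in> Ob A"
    then show "?y a \<in> homog (Mor B (fob G a) (fob F a)) 0"
      using B.inv_mor_homog[OF _ _ _ iso[OF a], of 0] x' by (simp add: inv_trans_def)
    fix b q f assume b: "b \<in> Ob A" and f: "f \<in> homog (Mor A a b) q"
    note fc = A.homog_carrier[OF a b f]
    have n: "Cmp B (fob F a) (fob F b) (fob G b) (x b) (fmap F a b f) =
        Cmp B (fob F a) (fob G a) (fob G b) (fmap G a b f) (x a)" using x' a b f by auto
    show "Cmp B (fob G a) (fob G b) (fob F b) (?y b) (fmap G a b f) =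
        koszul (Mor B (fob G a) (fob F b)) (0 * q) (Cmp B (fob G a) (fob F a) (fob F b) (fmap F a b f) (?y a))"
    proof (rule B.cancel_left[OF _ _ _ _ _ iso[OF b]])
      have "Cmp B (fob G a) (fob F b) (fob G b) (x b) (Cmp B (fob G a) (fob F a) (fob F b) (fmap F a b f)
          (?y a))
        = Cmp B (fob G a) (fob F a) (fob G b) (Cmp B (fob F a) (fob F b) (fob G b) (x b) (fmap F a b f)) (?y a)"
        using a b fc by (simp add: B.Cmp_assoc xi inv_trans_def)
      also have "\<dots> = fmap G a b f"
        unfolding n using a b fc by (simp add: B.Cmp_assoc xi inv_trans_def B.Idt_right)
      also have "\<dots> = Cmp B (fob G a) (fob F b) (fob G b) (x b) (Cmp B (fob G a) (fob G b) (fob F b) (?y b)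
          (fmap G a b f))"
        using a b fc by (simp add: B.Cmp_assoc[symmetric] xi inv_trans_def B.Idt_left)
      finally show "Cmp B (fob G a) (fob F b) (fob G b) (x b) (Cmp B (fob G a) (fob G b) (fob F b) (?y b)
          (fmap G a b f)) =
        Cmp B (fob G a) (fob F b) (fob G b) (x b) (koszul (Mor B (fob G a) (fob F b)) (0 * q)
          (Cmp B (fob G a) (fob F a) (fob F b) (fmap F a b f) (?y a)))" by simp
    qed (use a b fc in \<open>auto simp: B.Cmp_closed xi inv_trans_def\<close>)
  qed
  have "vcomp A B F G F ?y x = id_trans A B F" "vcomp A B G F G x ?y = id_trans A B G"
    unfolding vcomp_def id_trans_def by (auto intro!: restrict_ext simp: xi inv_trans_def)
  moreover have "supernatural A B F G x"
    using x by (simp add: supernatural_iso_of_parity_def supernatural_of_parity_def)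
  ultimately show ?thesis
    using y unfolding iso_mor_def by (auto simp: supernatural_of_parity_def)
qed

section \<open>Categories with parity shift\<close>

context pi_supercategory
begin

abbreviation (input) "C \<equiv> scat P"
abbreviation (input) "s \<equiv> fob (sshift P)"
abbreviation (input) "sm \<equiv> fmap (sshift P)"

sublocale S: supercategory K "scat P" by (rule scat_supercategory)
sublocale Sh: superfunctor K "scat P" "scat P" "sshift P" by (rule sshift_superfunctor)
sublocale Z: parallel_superfunctors K "scat P" "scat P" "sshift P" "id_functor (scat P)"
  by (simp add: parallel_superfunctors_def scat_supercategory sshift_superfunctor superfunctor_id)

lemma zeta_homog [simp]:
  "a \<in> Ob C \<Longrightarrow> zeta P a \<in> homog (Mor C (s a) a) 1"
  using zeta_odd_iso unfolding supernatural_iso_of_parity_def supernatural_of_parity_def by simp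

lemma zeta_iso: "a \<in> Ob C \<Longrightarrow> iso_mor C (s a) a (zeta P a)"
  using zeta_odd_iso unfolding supernatural_iso_of_parity_def by simp

lemma zeta_natural:
  assumes "a \<in> Ob C" "b \<in> Ob C" "f \<in> homog (Mor C a b) q"
  shows "Cmp C (s a) (s b) b (zeta P b) (sm a b f) =
    koszul (Mor C (s a) b) q (Cmp C (s a) a b f (zeta P a))"
proof -
  note S.homog_carrier[OF assms]
  then show ?thesis
    using zeta_odd_iso[unfolded supernatural_iso_of_parity_def Z.supernatural_of_parity_iff,
        THEN conjunct1, THEN conjunct2, THEN conjunct2, rule_format, OF assms] assms(1,2) by simp
qed

end

text \<open>For p = 0 and q = 1 the difference of components is the parity involution, by which the
  shift of the envelope acts on morphisms. Its additivity here and its compatibility with scalars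
  below make that shift linear.\<close>

lemma (in superspace) component_diff_add:
  assumes "v \<in> carrier V" "w \<in> carrier V"
  shows "component V p (v \<oplus>\<^bsub>V\<^esub> w) \<ominus>\<^bsub>V\<^esub> component V q (v \<oplus>\<^bsub>V\<^esub> w) =
    (component V p v \<ominus>\<^bsub>V\<^esub> component V q v) \<oplus>\<^bsub>V\<^esub> (component V p w \<ominus>\<^bsub>V\<^esub> component V q w)"
  using assms by (simp add: component_add a_minus_def M.minus_add M.a_ac)

lemma (in superspace) component_diff_smult:
  assumes "r \<in> carrier K" "v \<in> carrier V"
  shows "component V p (r \<odot>\<^bsub>V\<^esub> v) \<ominus>\<^bsub>V\<^esub> component V q (r \<odot>\<^bsub>V\<^esub> v) =
    r \<odot>\<^bsub>V\<^esub> (component V p v \<ominus>\<^bsub>V\<^esub> component V q v)"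
  using assms by (simp add: component_smult a_minus_def smult_r_distr smult_r_minus)

lemma (in superspace) component_diff_homog:
  assumes "v \<in> homog V p"
  shows "component V 0 v \<ominus>\<^bsub>V\<^esub> component V 1 v = koszul V p v"
  using assms homog_carrier[OF assms]
  by (cases p) (simp_all add: component_of_homog a_minus_def koszul_def)

text \<open>The regrading leaves the module alone and at most exchanges the two homogeneous
  subspaces, so the splitting carries over.\<close>

lemma superspace_shift_homog:
  assumes "superspace K V"
  shows "superspace K (V\<lparr>homog := \<lambda>p. homog V (p + c)\<rparr>)"
proof -
  interpret superspace K V by fact
  let ?V = "V\<lparr>homog := \<lambda>p. homog V (p + c)\<rparr>"
  interpret V': module K ?V
    by (rule moduleI[OF is_cring]) (auto intro!: abelian_groupI simp: smult_l_distr smult_r_distr smult_assoc1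
        M.a_ac intro: bexI[of _ "\<ominus>\<^bsub>V\<^esub> x" for x] M.l_neg)
  show ?thesis
  proof (intro superspace.intro superspace_axioms.intro)
    show "field K" "module K ?V" by unfold_locales
    show "submodule (homog ?V p) K ?V" for p
      using homog_subspace[of "p + c"] by (simp add: submodule_def submodule_axioms_def)
    show "homog ?V 0 \<inter> homog ?V 1 = {\<zero>\<^bsub>?V\<^esub>}"
      using homog_disjoint by (cases c) auto
    show "\<exists>u\<in>homog ?V 0. \<exists>w\<in>homog ?V 1. v = u \<oplus>\<^bsub>?V\<^esub> w" if "v \<in> carrier ?V" for v
      using homog_decomp[of v c] that by (simp add: add.commute)
  qed
qed

section \<open>The envelope\<close>

lemma envelope_cat_simps [simp]:
  "Ob (envelope_cat A) = Ob A \<times> UNIV"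
  "carrier (Mor (envelope_cat A) s t) = carrier (Mor A (fst s) (fst t))"
  "add (Mor (envelope_cat A) s t) = add (Mor A (fst s) (fst t))"
  "zero (Mor (envelope_cat A) s t) = zero (Mor A (fst s) (fst t))"
  "smult (Mor (envelope_cat A) s t) = smult (Mor A (fst s) (fst t))"
  "homog (Mor (envelope_cat A) s t) p = homog (Mor A (fst s) (fst t)) (p + snd s + snd t)"
  "a_inv (Mor (envelope_cat A) s t) = a_inv (Mor A (fst s) (fst t))"
  "koszul (Mor (envelope_cat A) s t) = koszul (Mor A (fst s) (fst t))"
  "Cmp (envelope_cat A) s t u = Cmp A (fst s) (fst t) (fst u)"
  "Idt (envelope_cat A) s = Idt A (fst s)"
  by (cases s; cases t; cases u; simp add: envelope_cat_def a_inv_def koszul_def fun_eq_iff)+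

text \<open>In the parity of a composite the shift of the middle object occurs twice and cancels
  modulo 2; the remaining laws are those of \<open>A\<close>.\<close>

lemma supercategory_envelope_cat:
  assumes "supercategory K A"
  shows "supercategory K (envelope_cat A)"
proof -
  interpret supercategory K A by fact
  have m: "superspace K (Mor (envelope_cat A) s t)" if "fst s \<in> Ob A" "fst t \<in> Ob A" for s t
    using superspace_shift_homog[OF Mor_superspace[OF that], of "snd s + snd t"]
    by (cases s; cases t) (simp add: envelope_cat_def add.assoc)
  show ?thesis
  proof (intro supercategory.intro linear_category.intro category.intro linear_category_axioms.intro
      supercategory_axioms.intro field_axioms)
    fix s t u p q f g
    assume "s \<in> Ob (envelope_cat A)" "t \<in> Ob (envelope_cat A)" "u \<in> Ob (envelope_cat A)"
      "f \<in> homog (Mor (envelope_cat A) s t) p" "g \<in> homog (Mor (envelope_cat A) t u) q"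
    then show "Cmp (envelope_cat A) s t u g f \<in> homog (Mor (envelope_cat A) s u) (p + q)"
      using Cmp_even[of "fst s" "fst t" "fst u" f "p + snd s + snd t" g "q + snd t + snd u"]
      by (simp add: ac_simps mem_Times_iff)
  qed (auto simp: Idt_closed Cmp_closed Idt_left Idt_right Cmp_assoc Cmp_add_left Cmp_add_right Cmp_smult_left
      Cmp_smult_right m superspace.axioms(2)[OF m])
qed

lemma envelope_simps [simp]:
  "scat (envelope A) = envelope_cat A"
  "l \<in> Ob A \<Longrightarrow> fob (sshift (envelope A)) (l, a) = (l, a + 1)"
  "l \<in> Ob A \<Longrightarrow> zeta (envelope A) (l, a) = Idt A l"
  by (simp_all add: envelope_def)

text \<open>Here \<open>p\<close> is the parity in the envelope and \<open>p + a + b\<close> the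
  parity in \<open>C\<close>; the sign is governed by the former.\<close>

lemma (in supercategory) fmap_envelope_shift:
  assumes "l \<in> Ob C" "m \<in> Ob C" "f \<in> homog (Mor C l m) (p + a + b)"
  shows "fmap (sshift (envelope C)) (l, a) (m, b) f = koszul (Mor C l m) p f"
proof -
  interpret E: supercategory K "envelope_cat C"
    by (rule supercategory_envelope_cat) unfold_locales
  show ?thesis
    using superspace.component_diff_homog[OF E.Mor_superspace, of "(l, a)" "(m, b)" f p]
      homog_carrier[OF assms] assms by (simp add: envelope_def)
qed

text \<open>The sign (-1)^p is multiplicative because parities add under composition, and \<Pi>
  preserves parity because it shifts both ends. The identity of \<open>A\<close> counts as odd from
  \<open>(l, a + 1)\<close> to \<open>(l, a)\<close>, since these differ by one shift.\<close>

lemma pi_supercategory_envelope: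
  fixes K :: "'k ring"
  assumes "supercategory K A"
  shows "pi_supercategory K (envelope A)"
proof -
  interpret supercategory K A by fact
  interpret E: supercategory K "envelope_cat A" by (rule supercategory_envelope_cat) fact
  let ?S = "sshift (envelope A)"
  have fmap_S: "fmap ?S s t f = component (Mor (envelope_cat A) s t) 0 f
      \<ominus>\<^bsub>Mor (envelope_cat A) s t\<^esub> component (Mor (envelope_cat A) s t) 1 f"
    if "fst s \<in> Ob A" "fst t \<in> Ob A" "f \<in> carrier (Mor A (fst s) (fst t))" for s t f
    using that by (cases s; cases t) (simp add: envelope_def)
  have fob_S: "fob ?S s = (fst s, snd s + 1)" if "fst s \<in> Ob A" for s
    using that by (cases s) simp
  have fmap_h: "fmap ?S s t f = koszul (Mor A (fst s) (fst t)) p f"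
    if "fst s \<in> Ob A" "fst t \<in> Ob A" "f \<in> homog (Mor A (fst s) (fst t)) (p + snd s + snd t)" for s t f p
    using fmap_envelope_shift[OF that] by simp
  have S: "superfunctor K (envelope_cat A) (envelope_cat A) ?S"
  proof (rule superfunctorI)
    show "fob ?S \<in> Ob (envelope_cat A) \<rightarrow>\<^sub>E Ob (envelope_cat A)"
      by (auto simp: envelope_def)
    show "fmap ?S \<in> (\<Pi>\<^sub>E s\<in>Ob (envelope_cat A). \<Pi>\<^sub>E t\<in>Ob (envelope_cat A).
        carrier (Mor (envelope_cat A) s t) \<rightarrow>\<^sub>E carrier (Mor (envelope_cat A) (fob ?S s) (fob ?S t)))"
    proof (intro PiE_I)
      fix s t f assume s: "s \<in> Ob (envelope_cat A)" and t: "t \<in> Ob (envelope_cat A)"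
        and f: "f \<in> carrier (Mor (envelope_cat A) s t)"
      then have "component (Mor (envelope_cat A) s t) p f \<in> carrier (Mor (envelope_cat A) s t)" for p
        by (rule E.Mor_component_carrier)
      then show "fmap ?S s t f \<in> carrier (Mor (envelope_cat A) (fob ?S s) (fob ?S t))"
        using s t f by (auto simp: fmap_S fob_S a_minus_def)
    qed (auto simp: envelope_def)
    show "fmap ?S s s (Idt (envelope_cat A) s) = Idt (envelope_cat A) (fob ?S s)"
      if "s \<in> Ob (envelope_cat A)" for s
      using that fmap_h[of s s "Idt A (fst s)" 0] by (auto simp: Idt_even fob_S add.assoc)
    show "fmap ?S s t (f \<oplus>\<^bsub>Mor (envelope_cat A) s t\<^esub> g) =
        fmap ?S s t f \<oplus>\<^bsub>Mor (envelope_cat A) (fob ?S s) (fob ?S t)\<^esub> fmap ?S s t g"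
      if "s \<in> Ob (envelope_cat A)" "t \<in> Ob (envelope_cat A)"
        "f \<in> carrier (Mor (envelope_cat A) s t)" "g \<in> carrier (Mor (envelope_cat A) s t)" for s t f g
      using that superspace.component_diff_add[OF E.Mor_superspace[OF that(1,2)] that(3,4), of 0 1]
      by (auto simp: fmap_S fob_S)
    show "fmap ?S s t (r \<odot>\<^bsub>Mor (envelope_cat A) s t\<^esub> f) =
        r \<odot>\<^bsub>Mor (envelope_cat A) (fob ?S s) (fob ?S t)\<^esub> fmap ?S s t f"
      if "s \<in> Ob (envelope_cat A)" "t \<in> Ob (envelope_cat A)" "r \<in> carrier K"
        "f \<in> carrier (Mor (envelope_cat A) s t)" for s t f r
      using that superspace.component_diff_smult[OF E.Mor_superspace[OF that(1,2)] that(3,4), of 0 1]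
      by (auto simp: fmap_S fob_S)
    show "fmap ?S s t f \<in> homog (Mor (envelope_cat A) (fob ?S s) (fob ?S t)) p"
      if "s \<in> Ob (envelope_cat A)" "t \<in> Ob (envelope_cat A)" "f \<in> homog (Mor (envelope_cat A) s t) p"
          for s t f p
      using that fmap_h[of s t f p] by (auto simp: fob_S ac_simps)
    show "fmap ?S s u (Cmp (envelope_cat A) s t u g f) =
        Cmp (envelope_cat A) (fob ?S s) (fob ?S t) (fob ?S u) (fmap ?S t u g) (fmap ?S s t f)"
      if "s \<in> Ob (envelope_cat A)" "t \<in> Ob (envelope_cat A)" "u \<in> Ob (envelope_cat A)"
        "f \<in> homog (Mor (envelope_cat A) s t) p" "g \<in> homog (Mor (envelope_cat A) t u) q" for s t u f g p q
    proof -
      from that have o: "fst s \<in> Ob A" "fst t \<in> Ob A" "fst u \<in> Ob A" by auto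
      have f: "f \<in> homog (Mor A (fst s) (fst t)) (p + snd s + snd t)"
        and g: "g \<in> homog (Mor A (fst t) (fst u)) (q + snd t + snd u)"
        and gf: "Cmp A (fst s) (fst t) (fst u) g f \<in> homog (Mor A (fst s) (fst u)) (p + q + snd s + snd u)"
        using that E.Cmp_even[OF that] by simp_all
      note c = homog_carrier[OF o(1,2) f] homog_carrier[OF o(2,3) g]
      show ?thesis
        unfolding envelope_cat_simps fob_S[OF o(1)] fob_S[OF o(2)] fob_S[OF o(3)] fst_conv
          fmap_h[OF o(1,2) f] fmap_h[OF o(2,3) g] fmap_h[OF o(1,3) gf]
        using o c by (simp add: Cmp_koszul_left Cmp_koszul_right Mor_koszul_koszul Cmp_closed add.commute)
    qed
  qed (fact E.supercategory_axioms)+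
  then interpret S: superfunctor K "envelope_cat A" "envelope_cat A" ?S .
  interpret Z: parallel_superfunctors K "envelope_cat A" "envelope_cat A" ?S "id_functor (envelope_cat A)"
    by (simp add: parallel_superfunctors_def S superfunctor_id E.supercategory_axioms)
  have "supernatural_iso_of_parity 1 (envelope_cat A) (envelope_cat A) ?S (id_functor (envelope_cat A))
      (zeta (envelope A))"
    unfolding supernatural_iso_of_parity_def Z.supernatural_of_parity_iff
  proof (intro conjI ballI allI)
    show "zeta (envelope A) \<in> families (envelope_cat A) (envelope_cat A) ?S (id_functor (envelope_cat A))"
      by (auto simp: families_def envelope_def Idt_closed)
    fix s assume s: "s \<in> Ob (envelope_cat A)"
    then show "zeta (envelope A) s \<in>
        homog (Mor (envelope_cat A) (fob ?S s) (fob (id_functor (envelope_cat A)) s)) 1"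
      by (auto simp: Idt_even ac_simps)
    show "iso_mor (envelope_cat A) (fob ?S s) (fob (id_functor (envelope_cat A)) s) (zeta (envelope A) s)"
      using s iso_mor_Idt[of "fst s"] by (cases s) (simp add: iso_mor_def)
    fix t q f assume "t \<in> Ob (envelope_cat A)" "f \<in> homog (Mor (envelope_cat A) s t) q"
    then show "Cmp (envelope_cat A) (fob ?S s) (fob ?S t) (fob (id_functor (envelope_cat A)) t)
        (zeta (envelope A) t) (fmap ?S s t f) =
      koszul (Mor (envelope_cat A) (fob ?S s) (fob (id_functor (envelope_cat A)) t)) (1 * q)
        (Cmp (envelope_cat A) (fob ?S s) (fob (id_functor (envelope_cat A)) s)
            (fob (id_functor (envelope_cat A)) t)
          (fmap (id_functor (envelope_cat A)) s t f) (zeta (envelope A) s))"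
      using s fmap_h[of s t f q] homog_carrier[of "fst s" "fst t" f]
      by (auto simp: Idt_left Idt_right)
  qed
  then show ?thesis
    by (intro pi_supercategory.intro) (simp_all add: S E.supercategory_axioms)
qed

lemma envelope_map_simps [simp]:
  "l \<in> Ob A \<Longrightarrow> fob (envelope_map A F) (l, a) = (fob F l, a)"
  "\<lbrakk>fst s \<in> Ob A; fst t \<in> Ob A; f \<in> carrier (Mor A (fst s) (fst t))\<rbrakk>
    \<Longrightarrow> fmap (envelope_map A F) s t f = fmap F (fst s) (fst t) f"
  by (cases s; cases t; simp add: envelope_map_def)+

lemma superfunctor_envelope_map:
  assumes "superfunctor K A B F"
  shows "superfunctor K (envelope_cat A) (envelope_cat B) (envelope_map A F)"
proof -
  interpret superfunctor K A B F by fact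
  show ?thesis
  proof (rule superfunctorI)
    show "supercategory K (envelope_cat A)" "supercategory K (envelope_cat B)"
      by (simp_all add: supercategory_envelope_cat A.supercategory_axioms B.supercategory_axioms)
    show "fob (envelope_map A F) \<in> Ob (envelope_cat A) \<rightarrow>\<^sub>E Ob (envelope_cat B)"
      by (auto simp: envelope_map_def)
    show "fmap (envelope_map A F) \<in> (\<Pi>\<^sub>E s\<in>Ob (envelope_cat A). \<Pi>\<^sub>E t\<in>Ob (envelope_cat A).
        carrier (Mor (envelope_cat A) s t) \<rightarrow>\<^sub>E
          carrier (Mor (envelope_cat B) (fob (envelope_map A F) s) (fob (envelope_map A F) t)))"
      by (auto simp: envelope_map_def)
  next
    fix s t p f
    assume "s \<in> Ob (envelope_cat A)" "t \<in> Ob (envelope_cat A)" "f \<in> homog (Mor (envelope_cat A) s t) p"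
    then show "fmap (envelope_map A F) s t f
        \<in> homog (Mor (envelope_cat B) (fob (envelope_map A F) s) (fob (envelope_map A F) t)) p"
      using A.homog_carrier[of "fst s" "fst t" f] by (auto simp: fmap_even)
  next
    fix s t u p q f g
    assume "s \<in> Ob (envelope_cat A)" "t \<in> Ob (envelope_cat A)" "u \<in> Ob (envelope_cat A)"
      "f \<in> homog (Mor (envelope_cat A) s t) p" "g \<in> homog (Mor (envelope_cat A) t u) q"
    then show "fmap (envelope_map A F) s u (Cmp (envelope_cat A) s t u g f) =
        Cmp (envelope_cat B) (fob (envelope_map A F) s) (fob (envelope_map A F) t) (fob (envelope_map A F) u)
          (fmap (envelope_map A F) t u g) (fmap (envelope_map A F) s t f)"
      using A.homog_carrier[of "fst s" "fst t" f] A.homog_carrier[of "fst t" "fst u" g]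
      by (auto simp: fmap_Cmp A.Cmp_closed)
  qed (auto simp: A.Idt_closed fmap_Idt fmap_add fmap_smult)
qed

lemma envelope_map_id:
  assumes "supercategory K A"
  shows "envelope_map A (id_functor A) = id_functor (envelope_cat A)"
proof -
  interpret supercategory K A by fact
  interpret E: supercategory K "envelope_cat A" by (rule supercategory_envelope_cat) fact
  interpret M: superfunctor K "envelope_cat A" "envelope_cat A" "envelope_map A (id_functor A)"
    by (intro superfunctor_envelope_map superfunctor_id) fact
  show ?thesis
    by (rule functor_eqI[OF M.is_functor_axioms is_functor_id[OF E.category_axioms]]) auto
qed

lemma envelope_map_comp:
  assumes "superfunctor K A B F" "superfunctor K B C G"
  shows "envelope_map A (comp_functor A G F) = comp_functor (envelope_cat A) (envelope_map B G)
      (envelope_map A F)"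
proof -
  interpret F: superfunctor K A B F by fact
  interpret G: superfunctor K B C G by fact
  note e = superfunctor_envelope_map[OF superfunctor_comp[OF assms]]
    superfunctor_comp[OF assms[THEN superfunctor_envelope_map]]
  note e' = e[THEN superfunctor.axioms(3), THEN linear_functor.axioms(3)]
  show ?thesis
    by (rule functor_eqI[OF e']) auto
qed

section \<open>Functoriality of the envelope and of the forgetful functor\<close>

lemma SCat_simps [simp]:
  "Ob (SCat K) = {A. supercategory K A}"
  "carrier (Mor (SCat K) A B) = {F. superfunctor K A B F}"
  "Cmp (SCat K) A B C G F = comp_functor A G F"
  "Idt (SCat K) = id_functor"
  by (simp_all add: SCat_def)

lemma PiSCat_simps [simp]:
  "Ob (PiSCat K) = {P. pi_supercategory K P}"
  "carrier (Mor (PiSCat K) P Q) = {F. superfunctor K (scat P) (scat Q) F}"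
  "Cmp (PiSCat K) P Q R G F = comp_functor (scat P) G F"
  "Idt (PiSCat K) P = id_functor (scat P)"
  by (simp_all add: PiSCat_def)

lemma superfunctor_is_functor: "superfunctor K A B F \<Longrightarrow> is_functor A B F"
  by (simp add: superfunctor_def linear_functor_def)

lemma category_SCat: "category (SCat K)"
  by unfold_locales
    (auto simp: superfunctor_id superfunctor_comp comp_functor_id_left superfunctor_is_functor
      intro: comp_functor_assoc comp_functor_id_right superfunctor_is_functor)

lemma category_PiSCat: "category (PiSCat K)"
  by unfold_locales
    (auto simp: superfunctor_id superfunctor_comp comp_functor_id_left superfunctor_is_functor
      pi_supercategory.scat_supercategory intro: comp_functor_assoc comp_functor_id_right
          superfunctor_is_functor)

lemma is_functor_envelope: "is_functor (SCat K) (PiSCat K) (envelope_functor K)"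
  by (intro is_functor.intro is_functor_axioms.intro category_SCat category_PiSCat)
    (auto simp: envelope_functor_def pi_supercategory_envelope superfunctor_envelope_map superfunctor_id
      superfunctor_comp envelope_map_id intro: envelope_map_comp)

lemma is_functor_forget: "is_functor (PiSCat K) (SCat K) (forget K)"
  by (intro is_functor.intro is_functor_axioms.intro category_SCat category_PiSCat)
    (auto simp: forget_def pi_supercategory.scat_supercategory superfunctor_id superfunctor_comp)

section \<open>Extension of superfunctors along the envelope\<close>

text \<open>The exponent is the parity stored in an object of the envelope. Indexing the identity
  and the shift by it gives a single sign rule, with exponent \<open>p * q\<close>, for both copies
  of an object and avoids case distinctions in the extension.\<close>

definition shift_pow :: "('o, 'k, 'm) pi_supercat \<Rightarrow> bit \<Rightarrow> ('o, 'm, 'o, 'm) fctr" where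
  "shift_pow P p = (if p = 0 then id_functor (scat P) else sshift P)"

definition zeta_pow :: "('o, 'k, 'm) pi_supercat \<Rightarrow> bit \<Rightarrow> 'o \<Rightarrow> 'm" where
  "zeta_pow P p a = (if p = 0 then Idt (scat P) a else zeta P a)"

definition zeta_pow_inv :: "('o, 'k, 'm) pi_supercat \<Rightarrow> bit \<Rightarrow> 'o \<Rightarrow> 'm" where
  "zeta_pow_inv P p a = inv_mor (scat P) (fob (shift_pow P p) a) a (zeta_pow P p a)"

context pi_supercategory
begin

abbreviation (input) "pw p \<equiv> fob (shift_pow P p)"

lemma superfunctor_shift_pow: "superfunctor K (scat P) (scat P) (shift_pow P p)"
  by (simp add: shift_pow_def superfunctor_id scat_supercategory sshift_superfunctor)

sublocale Pow: superfunctor K "scat P" "scat P" "shift_pow P p" for p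
  by (rule superfunctor_shift_pow)

context
  fixes a and p :: bit assumes a: "a \<in> Ob C"
begin

lemma zeta_pow_homog: "zeta_pow P p a \<in> homog (Mor C (pw p a) a) p"
  using a by (simp add: zeta_pow_def shift_pow_def S.Idt_even)

lemma zeta_pow_iso: "iso_mor C (pw p a) a (zeta_pow P p a)"
  using a by (simp add: zeta_pow_def shift_pow_def S.iso_mor_Idt zeta_iso)

lemma zeta_pow_inv_homog: "zeta_pow_inv P p a \<in> homog (Mor C a (pw p a)) p"
  unfolding zeta_pow_inv_def
  using a zeta_pow_homog zeta_pow_iso by (intro S.inv_mor_homog) simp_all

lemma zeta_pow_closed [simp]: "zeta_pow P p a \<in> carrier (Mor C (pw p a) a)"
  using S.homog_carrier[OF _ _ zeta_pow_homog] a by simp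

lemma zeta_pow_inv_closed [simp]: "zeta_pow_inv P p a \<in> carrier (Mor C a (pw p a))"
  using S.homog_carrier[OF _ _ zeta_pow_inv_homog] a by simp

lemma zeta_pow_inv_left:
  "Cmp C (pw p a) a (pw p a) (zeta_pow_inv P p a) (zeta_pow P p a) =
    Idt C (pw p a)"
  unfolding zeta_pow_inv_def using a zeta_pow_iso by (simp add: S.inv_mor_left)

lemma zeta_pow_inv_right:
  "Cmp C a (pw p a) a (zeta_pow P p a) (zeta_pow_inv P p a) = Idt C a"
  unfolding zeta_pow_inv_def using a zeta_pow_iso by (simp add: S.inv_mor_right)

lemma zeta_pow_cancel:
  assumes "b \<in> Ob C" "f \<in> carrier (Mor C b a)"
  shows "Cmp C b (pw p a) a (zeta_pow P p a)
      (Cmp C b a (pw p a) (zeta_pow_inv P p a) f) = f"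
  using a assms S.Cmp_assoc[of b a "pw p a" a f "zeta_pow_inv P p a" "zeta_pow P p a"]
  by (simp add: zeta_pow_inv_right S.Idt_left)

end

lemma zeta_pow_natural:
  assumes "a \<in> Ob C" "b \<in> Ob C" "f \<in> homog (Mor C a b) q"
  shows "Cmp C (pw p a) (pw p b) b (zeta_pow P p b) (fmap (shift_pow P p) a b f) =
    koszul (Mor C (pw p a) b) (p * q) (Cmp C (pw p a) a b f (zeta_pow P p a))"
  using assms zeta_natural[OF assms] S.homog_carrier[OF assms]
  by (cases p) (simp_all add: zeta_pow_def shift_pow_def S.Idt_left S.Idt_right)

text \<open>Composed with \<open>zeta_pow P p b\<close>, both sides become (-1)^(pq) f, and this
  isomorphism can be cancelled.\<close>

lemma zeta_pow_inv_natural: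
  assumes ab: "a \<in> Ob C" "b \<in> Ob C" and f: "f \<in> homog (Mor C a b) q"
  shows "Cmp C a (pw p a) (pw p b) (fmap (shift_pow P p) a b f) (zeta_pow_inv P p a) =
    koszul (Mor C a (pw p b)) (p * q) (Cmp C a b (pw p b) (zeta_pow_inv P p b) f)"
    (is "?l = koszul _ _ ?r")
proof -
  note fc = S.homog_carrier[OF ab f]
  let ?a = "pw p a" and ?b = "pw p b"
  have "Cmp C a ?b b (zeta_pow P p b) ?l =
      Cmp C a ?a b (Cmp C ?a ?b b (zeta_pow P p b) (fmap (shift_pow P p) a b f)) (zeta_pow_inv P p a)"
    using ab fc by (simp add: S.Cmp_assoc)
  also have "\<dots> = koszul (Mor C a b) (p * q) f"
    unfolding zeta_pow_natural[OF ab f] using ab fc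
    by (simp add: S.Cmp_koszul_left S.Cmp_closed S.Cmp_assoc zeta_pow_inv_right S.Idt_right)
  also have "\<dots> = Cmp C a ?b b (zeta_pow P p b) (koszul (Mor C a ?b) (p * q) ?r)"
    using ab fc by (simp add: S.Cmp_koszul_right S.Cmp_closed zeta_pow_cancel)
  finally show ?thesis
    using ab fc
    by (rule_tac S.cancel_left[where b = ?b and c = b and g = "zeta_pow P p b"])
        (simp_all add: S.Cmp_closed zeta_pow_iso)
qed

end

definition extend_functor ::
  "('o, 'k, 'm) supercat \<Rightarrow> ('p, 'k, 'n) pi_supercat \<Rightarrow> ('o, 'm, 'p, 'n) fctr \<Rightarrow> ('o \<times> bit, 'm, 'p, 'n) fctr" where
  "extend_functor A P F = \<lparr>
    fob = (\<lambda>s\<in>Ob (envelope_cat A). fob (shift_pow P (snd s)) (fob F (fst s))),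
    fmap = (\<lambda>s\<in>Ob (envelope_cat A). \<lambda>t\<in>Ob (envelope_cat A). \<lambda>f\<in>carrier (Mor (envelope_cat A) s t).
      Cmp (scat P) (fob (shift_pow P (snd s)) (fob F (fst s))) (fob F (fst t))
          (fob (shift_pow P (snd t)) (fob F (fst t)))
        (zeta_pow_inv P (snd t) (fob F (fst t)))
        (Cmp (scat P) (fob (shift_pow P (snd s)) (fob F (fst s))) (fob F (fst s)) (fob F (fst t))
          (fmap F (fst s) (fst t) f) (zeta_pow P (snd s) (fob F (fst s)))))\<rparr>"

definition extend_trans ::
  "('o, 'k, 'm) supercat \<Rightarrow> ('p, 'k, 'n) pi_supercat \<Rightarrow> ('o, 'm, 'p, 'n) fctr \<Rightarrow> ('o, 'm, 'p, 'n) fctr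
    \<Rightarrow> ('o \<Rightarrow> 'n) \<Rightarrow> 'o \<times> bit \<Rightarrow> 'n" where
  "extend_trans A P F G x =
    (\<lambda>s\<in>Ob (envelope_cat A). fmap (shift_pow P (snd s)) (fob F (fst s)) (fob G (fst s)) (x (fst s)))"

lemma extend_functor_simps [simp]:
  "fst s \<in> Ob A \<Longrightarrow> fob (extend_functor A P F) s = fob (shift_pow P (snd s)) (fob F (fst s))"
  "\<lbrakk>fst s \<in> Ob A; fst t \<in> Ob A; f \<in> carrier (Mor A (fst s) (fst t))\<rbrakk> \<Longrightarrow> fmap (extend_functor A P F) s t f =
    Cmp (scat P) (fob (shift_pow P (snd s)) (fob F (fst s))) (fob F (fst t))
        (fob (shift_pow P (snd t)) (fob F (fst t)))
        (zeta_pow_inv P (snd t) (fob F (fst t)))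
        (Cmp (scat P) (fob (shift_pow P (snd s)) (fob F (fst s))) (fob F (fst s)) (fob F (fst t))
          (fmap F (fst s) (fst t) f) (zeta_pow P (snd s) (fob F (fst s))))"
  by (simp_all add: extend_functor_def mem_Times_iff)

text \<open>A morphism of parity p in the envelope, between objects with shifts a and b, has parity
  p + a + b in \<open>A\<close>. The conjugating factors have parities a and b, which restores p. In
  a composite the two factors in the middle are mutually inverse.\<close>

lemma superfunctor_extend_functor:
  assumes "pi_supercategory K P" "superfunctor K A (scat P) F"
  shows "superfunctor K (envelope_cat A) (scat P) (extend_functor A P F)"
proof -
  interpret pi_supercategory K P by fact
  interpret F: superfunctor K A "scat P" F by fact
  let ?E = "envelope_cat A" and ?F = "extend_functor A P F"
  show ?thesis
  proof (rule superfunctorI)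
    show "supercategory K ?E" by (rule supercategory_envelope_cat) (rule F.A.supercategory_axioms)
    show "fob ?F \<in> Ob ?E \<rightarrow>\<^sub>E Ob (scat P)" by (auto simp: extend_functor_def)
    show "fmap ?F \<in> (\<Pi>\<^sub>E s\<in>Ob ?E. \<Pi>\<^sub>E t\<in>Ob ?E. carrier (Mor ?E s t)
        \<rightarrow>\<^sub>E carrier (Mor (scat P) (fob ?F s) (fob ?F t)))"
      by (auto simp: extend_functor_def S.Cmp_closed)
  next
    fix s assume "s \<in> Ob ?E"
    then show "fmap ?F s s (Idt ?E s) = Idt (scat P) (fob ?F s)"
      by (auto simp: F.A.Idt_closed F.fmap_Idt S.Idt_left zeta_pow_inv_left)
  next
    fix s t f g assume "s \<in> Ob ?E" "t \<in> Ob ?E" "f \<in> carrier (Mor ?E s t)" "g \<in> carrier (Mor ?E s t)"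
    then show "fmap ?F s t (f \<oplus>\<^bsub>Mor ?E s t\<^esub> g) = fmap ?F s t f \<oplus>\<^bsub>Mor (scat P) (fob ?F s) (fob ?F t)\<^esub> fmap ?F s t g"
      by (auto simp: F.fmap_add S.Cmp_add_left S.Cmp_add_right S.Cmp_closed)
  next
    fix s t r f assume "s \<in> Ob ?E" "t \<in> Ob ?E" "r \<in> carrier K" "f \<in> carrier (Mor ?E s t)"
    then show "fmap ?F s t (r \<odot>\<^bsub>Mor ?E s t\<^esub> f) = r \<odot>\<^bsub>Mor (scat P) (fob ?F s) (fob ?F t)\<^esub> fmap ?F s t f"
      by (auto simp: F.fmap_smult S.Cmp_smult_left S.Cmp_smult_right S.Cmp_closed)
  next
    fix s t p f assume st: "s \<in> Ob ?E" "t \<in> Ob ?E" and f: "f \<in> homog (Mor ?E s t) p"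
    let ?a = "fob F (fst s)" and ?b = "fob F (fst t)"
    have o: "fst s \<in> Ob A" "fst t \<in> Ob A" "?a \<in> Ob (scat P)" "?b \<in> Ob (scat P)" using st by auto
    have f': "f \<in> homog (Mor A (fst s) (fst t)) (p + snd s + snd t)" using f by simp
    note fc = F.A.homog_carrier[OF o(1,2) f']
    have "Cmp (scat P) (fob ?F s) ?a ?b (fmap F (fst s) (fst t) f) (zeta_pow P (snd s) ?a)
        \<in> homog (Mor (scat P) (fob ?F s) ?b) (snd s + (p + snd s + snd t))"
      using o f' by (intro S.Cmp_even) (simp_all add: zeta_pow_homog F.fmap_even)
    from S.Cmp_even[OF _ _ _ this zeta_pow_inv_homog[OF o(4), of "snd t"]] have
        "Cmp (scat P) (fob ?F s) ?b (fob ?F t) (zeta_pow_inv P (snd t) ?b)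
          (Cmp (scat P) (fob ?F s) ?a ?b (fmap F (fst s) (fst t) f) (zeta_pow P (snd s) ?a))
        \<in> homog (Mor (scat P) (fob ?F s) (fob ?F t)) (snd s + (p + snd s + snd t) + snd t)"
      using o by simp
    then show "fmap ?F s t f \<in> homog (Mor (scat P) (fob ?F s) (fob ?F t)) p"
      using o fc by (simp add: ac_simps)
  next
    fix s t u p q f g assume st: "s \<in> Ob ?E" "t \<in> Ob ?E" "u \<in> Ob ?E"
      and f: "f \<in> homog (Mor ?E s t) p" and g: "g \<in> homog (Mor ?E t u) q"
    have o: "fst s \<in> Ob A" "fst t \<in> Ob A" "fst u \<in> Ob A" using st by auto
    have fc: "f \<in> carrier (Mor A (fst s) (fst t))" and gc: "g \<in> carrier (Mor A (fst t) (fst u))"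
      using F.A.homog_carrier[OF o(1,2), of f] F.A.homog_carrier[OF o(2,3), of g] f g by simp_all
    show "fmap ?F s u (Cmp ?E s t u g f) = Cmp (scat P) (fob ?F s) (fob ?F t) (fob ?F u) (fmap ?F t u g)
        (fmap ?F s t f)"
      using o fc gc by (simp add: F.fmap_Cmp S.Cmp_assoc S.Cmp_closed F.A.Cmp_closed zeta_pow_cancel)
  qed (rule scat_supercategory)
qed

text \<open>Three signs arise for f of parity q in the envelope: (-1)^(bp) from moving \<Pi>^b x
  past the inverse of \<zeta>^b, (-1)^(p(q+a+b)) from moving x past the image of f, whose parity in
  \<open>A\<close> is q + a + b, and (-1)^(ap) from moving x past \<zeta>^a. Modulo 2 the exponents
  add up to pq, as the sign rule in the envelope requires.\<close>

lemma supernatural_extend_trans: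
  assumes P: "pi_supercategory K P" and F: "superfunctor K A (scat P) F" and G: "superfunctor K A (scat P) G"
    and x: "supernatural_of_parity p A (scat P) F G x"
  shows "supernatural_of_parity p (envelope_cat A) (scat P) (extend_functor A P F) (extend_functor A P G)
    (extend_trans A P F G x)"
proof -
  interpret pi_supercategory K P by fact
  interpret FG: parallel_superfunctors K A "scat P" F G
    using F G by (simp add: parallel_superfunctors_def superfunctor_def)
  let ?E = "envelope_cat A" and ?F = "extend_functor A P F" and ?G = "extend_functor A P G"
  interpret X: parallel_superfunctors K ?E "scat P" ?F ?G
    using superfunctor_extend_functor[OF P F] superfunctor_extend_functor[OF P G]
    by (simp add: parallel_superfunctors_def superfunctor_def)
  note x' = x[unfolded FG.supernatural_of_parity_iff]
  have xh: "x l \<in> homog (Mor (scat P) (fob F l) (fob G l)) p" if "l \<in> Ob A" for l using that x' by blast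
  have xc: "x l \<in> carrier (Mor (scat P) (fob F l) (fob G l))" if "l \<in> Ob A" for l
    using S.homog_carrier[OF _ _ xh[OF that]] that by simp
  show ?thesis
    unfolding X.supernatural_of_parity_iff
  proof (intro conjI ballI allI)
    show "extend_trans A P F G x \<in> families ?E (scat P) ?F ?G"
      by (auto simp: extend_trans_def families_def xc)
    fix s assume s: "s \<in> Ob ?E"
    then show "extend_trans A P F G x s \<in> homog (Mor (scat P) (fob ?F s) (fob ?G s)) p"
      by (auto simp: extend_trans_def xh Pow.fmap_even)
    fix t q f assume t: "t \<in> Ob ?E" and f: "f \<in> homog (Mor ?E s t) q"
    obtain l a m b where st: "s = (l, a)" "t = (m, b)" by (metis surj_pair)
    have o: "l \<in> Ob A" "m \<in> Ob A" using s t st by auto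
    have f': "f \<in> homog (Mor A l m) (q + a + b)" using f st by simp
    note fc = FG.A.homog_carrier[OF o f']
    let ?Fl = "fob F l" and ?Gl = "fob G l" and ?Fm = "fob F m" and ?Gm = "fob G m"
      and ?Fs = "fob (shift_pow P a) (fob F l)" and ?Gs = "fob (shift_pow P a) (fob G l)"
      and ?Ft = "fob (shift_pow P b) (fob F m)" and ?Gt = "fob (shift_pow P b) (fob G m)"
    let ?C = "Cmp (scat P)" and ?k = "koszul (Mor (scat P) ?Fs ?Gt)"
    have n: "?C ?Fl ?Fm ?Gm (x m) (fmap F l m f) =
        koszul (Mor (scat P) ?Fl ?Gm) (p * (q + a + b)) (?C ?Fl ?Gl ?Gm (fmap G l m f) (x l))"
      using x' o f' by blast
    have "?C ?Fs ?Ft ?Gt (fmap (shift_pow P b) ?Fm ?Gm (x m))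
        (?C ?Fs ?Fm ?Ft (zeta_pow_inv P b ?Fm) (?C ?Fs ?Fl ?Fm (fmap F l m f) (zeta_pow P a ?Fl))) =
      ?C ?Fs ?Fm ?Gt (?C ?Fm ?Ft ?Gt (fmap (shift_pow P b) ?Fm ?Gm (x m)) (zeta_pow_inv P b ?Fm))
        (?C ?Fs ?Fl ?Fm (fmap F l m f) (zeta_pow P a ?Fl))"
      using o fc by (simp add: S.Cmp_assoc S.Cmp_closed xc)
    also have "\<dots> = ?k (b * p) (?C ?Fs ?Gm ?Gt (zeta_pow_inv P b ?Gm)
        (?C ?Fs ?Fl ?Gm (?C ?Fl ?Fm ?Gm (x m) (fmap F l m f)) (zeta_pow P a ?Fl)))"
      using o fc by (simp add: zeta_pow_inv_natural[OF _ _ xh] S.Cmp_koszul_left S.Cmp_assoc S.Cmp_closed xc)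
    also have "\<dots> = ?k (b * p + p * (q + a + b)) (?C ?Fs ?Gm ?Gt (zeta_pow_inv P b ?Gm)
        (?C ?Fs ?Gl ?Gm (fmap G l m f) (?C ?Fs ?Fl ?Gl (x l) (zeta_pow P a ?Fl))))"
      unfolding n using o fc
      by (simp add: S.Cmp_koszul_left S.Cmp_koszul_right S.Mor_koszul_koszul S.Cmp_assoc S.Cmp_closed xc)
    also have "?C ?Fs ?Fl ?Gl (x l) (zeta_pow P a ?Fl) =
        koszul (Mor (scat P) ?Fs ?Gl) (a * p) (?C ?Fs ?Gs ?Gl (zeta_pow P a ?Gl)
            (fmap (shift_pow P a) ?Fl ?Gl (x l)))"
      using o by (simp add: zeta_pow_natural[OF _ _ xh] S.Mor_koszul_koszul S.Cmp_closed xc)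
    also have "?k (b * p + p * (q + a + b)) (?C ?Fs ?Gm ?Gt (zeta_pow_inv P b ?Gm)
        (?C ?Fs ?Gl ?Gm (fmap G l m f) (koszul (Mor (scat P) ?Fs ?Gl) (a * p)
          (?C ?Fs ?Gs ?Gl (zeta_pow P a ?Gl) (fmap (shift_pow P a) ?Fl ?Gl (x l)))))) =
      ?k (p * q) (?C ?Fs ?Gs ?Gt (?C ?Gs ?Gm ?Gt (zeta_pow_inv P b ?Gm)
        (?C ?Gs ?Gl ?Gm (fmap G l m f) (zeta_pow P a ?Gl))) (fmap (shift_pow P a) ?Fl ?Gl (x l)))"
    proof -
      have "b * p + p * (q + a + b) + a * p = p * q"
        by (cases a; cases b; cases p; simp)
      then show ?thesis
        using o fc by (simp add: S.Cmp_koszul_right S.Mor_koszul_koszul S.Cmp_assoc S.Cmp_closed xc)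
    qed
    finally show "?C (fob ?F s) (fob ?F t) (fob ?G t) (extend_trans A P F G x t) (fmap ?F s t f) =
        koszul (Mor (scat P) (fob ?F s) (fob ?G t)) (p * q)
          (?C (fob ?F s) (fob ?G s) (fob ?G t) (fmap ?G s t f) (extend_trans A P F G x s))"
      using o fc by (simp add: st extend_trans_def)
  qed
qed

section \<open>Superfunctors between hom-supercategories\<close>

definition hom_functor ::
  "'k ring \<Rightarrow> ('o, 'k, 'm) supercat \<Rightarrow> ('p, 'k, 'n) supercat
    \<Rightarrow> (('o, 'm, 'p, 'n) fctr \<Rightarrow> ('q, 'l, 'r, 'j) fctr)
    \<Rightarrow> (('o, 'm, 'p, 'n) fctr \<Rightarrow> ('o, 'm, 'p, 'n) fctr \<Rightarrow> ('o \<Rightarrow> 'n) \<Rightarrow> 'q \<Rightarrow> 'j)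
    \<Rightarrow> (('o, 'm, 'p, 'n) fctr, 'o \<Rightarrow> 'n, ('q, 'l, 'r, 'j) fctr, 'q \<Rightarrow> 'j) fctr" where
  "hom_functor K A B X T = \<lparr>
    fob = (\<lambda>F\<in>Ob (hom_supercat K A B). X F),
    fmap = (\<lambda>F\<in>Ob (hom_supercat K A B). \<lambda>G\<in>Ob (hom_supercat K A B).
      \<lambda>x\<in>carrier (Mor (hom_supercat K A B) F G). T F G x)\<rparr>"

text \<open>Extension and restriction both send a transformation x to the family with entry H_a
  (x_(j a)) at a. For extension H_a is a power of \<Pi> and j the first projection; for restriction
  H_a is the identity and j comes from the functor restricted along. Linearity and functoriality are
  then inherited from H_a componentwise, and supernaturality has to be supplied for homogeneous x
  only.\<close>

lemma superfunctor_hom_functor: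
  fixes K :: "'k ring" and A' :: "('q, 'k, 'l) supercat" and B' :: "('r, 'k, 'j) supercat"
  assumes cats: "supercategory K A" "supercategory K B" "supercategory K A'" "supercategory K B'"
    and H: "\<And>a. a \<in> Ob A' \<Longrightarrow> superfunctor K B B' (H a)"
    and j: "\<And>a. a \<in> Ob A' \<Longrightarrow> j a \<in> Ob A"
    and X: "\<And>F. superfunctor K A B F \<Longrightarrow> superfunctor K A' B' (X F)"
    and fob: "\<And>F a. \<lbrakk>superfunctor K A B F; a \<in> Ob A'\<rbrakk> \<Longrightarrow> fob (X F) a = fob (H a) (fob F (j a))"
    and T: "\<And>F G x. \<lbrakk>superfunctor K A B F; superfunctor K A B G; supernatural A B F G x\<rbrakk>
      \<Longrightarrow> T F G x = (\<lambda>a\<in>Ob A'. fmap (H a) (fob F (j a)) (fob G (j a)) (x (j a)))"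
    and parity: "\<And>F G p x. \<lbrakk>superfunctor K A B F; superfunctor K A B G; supernatural_of_parity p A B F G x\<rbrakk>
      \<Longrightarrow> supernatural_of_parity p A' B' (X F) (X G) (T F G x)"
  shows "superfunctor K (hom_supercat K A B) (hom_supercat K A' B') (hom_functor K A B X T)"
proof -
  let ?H = "hom_supercat K A B" and ?H' = "hom_supercat K A' B'" and ?X = "hom_functor K A B X T"
  note o = superfunctor_is_functor[THEN is_functor.fob_Ob]
  note h = superfunctor_is_functor[OF H]
  note add = superfunctor.axioms(3)[OF H, THEN linear_functor.fmap_add]
    and smult = superfunctor.axioms(3)[OF H, THEN linear_functor.fmap_smult]
  have ps: "parallel_superfunctors K A B F G" if "superfunctor K A B F" "superfunctor K A B G" for F G
    using that cats by (simp add: parallel_superfunctors_def)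
  note c = parallel_superfunctors.supernatural_carrier[OF ps]
  have T_add: "T F G (\<lambda>a\<in>Ob A. x a \<oplus>\<^bsub>Mor B (fob F a) (fob G a)\<^esub> y a) =
      (\<lambda>a\<in>Ob A'. T F G x a \<oplus>\<^bsub>Mor B' (fob (X F) a) (fob (X G) a)\<^esub> T F G y a)"
    if FG: "superfunctor K A B F" "superfunctor K A B G"
      and xy: "supernatural A B F G x" "supernatural A B F G y" for F G x y
    using that parallel_superfunctors.supernatural_add[OF ps[OF FG] xy]
    by (auto simp: T fob add o j c intro!: restrict_ext)
  have supernatural: "supernatural A' B' (X F) (X G) (T F G x)"
    if FG: "superfunctor K A B F" "superfunctor K A B G" and x: "supernatural A B F G x" for F G x
  proof -
    interpret parallel_superfunctors K A B F G using FG by (rule ps)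
    interpret Y: parallel_superfunctors K A' B' "X F" "X G"
      using X[OF FG(1)] X[OF FG(2)] cats by (simp add: parallel_superfunctors_def)
    obtain y z where yz: "supernatural_of_parity 0 A B F G y" "supernatural_of_parity 1 A B F G z"
      and xyz: "x = (\<lambda>a\<in>Ob A. y a \<oplus>\<^bsub>Mor B (fob F a) (fob G a)\<^esub> z a)"
      using supernatural_decomp[OF x] .
    show ?thesis
      using Y.supernatural_add[OF yz[THEN parity[OF FG], THEN Y.supernatural_of_parity_supernatural]]
        T_add[OF FG yz[THEN supernatural_of_parity_supernatural]] by (simp add: xyz)
  qed
  show ?thesis
  proof (rule superfunctorI)
    show "supercategory K ?H" "supercategory K ?H'" using cats by (simp_all add: supercategory_hom)
    show "fob ?X \<in> Ob ?H \<rightarrow>\<^sub>E Ob ?H'" by (auto simp: hom_functor_def X)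
    show "fmap ?X \<in> (\<Pi>\<^sub>E F\<in>Ob ?H. \<Pi>\<^sub>E G\<in>Ob ?H. carrier (Mor ?H F G) \<rightarrow>\<^sub>E carrier (Mor ?H' (fob ?X F) (fob ?X G)))"
      by (auto simp: hom_functor_def supernatural)
  next
    fix F G p x assume "F \<in> Ob ?H" "G \<in> Ob ?H" "x \<in> homog (Mor ?H F G) p"
    then show "fmap ?X F G x \<in> homog (Mor ?H' (fob ?X F) (fob ?X G)) p"
      using parity[of F G p x] by (simp add: hom_functor_def supernatural_of_parity_def)
  next
    fix F G L p q x y
    assume "F \<in> Ob ?H" "G \<in> Ob ?H" "L \<in> Ob ?H" "x \<in> homog (Mor ?H F G) p" "y \<in> homog (Mor ?H G L) q"
    then have *: "superfunctor K A B F" "superfunctor K A B G" "superfunctor K A B L"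
      "supernatural A B F G x" "supernatural A B G L y"
      by (simp_all add: supernatural_of_parity_def)
    then show "fmap ?X F L (Cmp ?H F G L y x) = Cmp ?H' (fob ?X F) (fob ?X G) (fob ?X L) (fmap ?X G L y)
        (fmap ?X F G x)"
      using supernatural_vcomp[OF *]
      by (auto simp: hom_functor_def T vcomp_def is_functor.fmap_Cmp[OF h] fob o c j intro!: restrict_ext)
  next
    fix F assume "F \<in> Ob ?H"
    then have F: "superfunctor K A B F" by simp
    then show "fmap ?X F F (Idt ?H F) = Idt ?H' (fob ?X F)"
      using supernatural_id[OF F]
      by (auto simp: hom_functor_def T id_trans_def is_functor.fmap_Idt[OF h] fob o j supernatural_of_parity_def
          intro!: restrict_ext)
  next
    fix F G x y assume "F \<in> Ob ?H" "G \<in> Ob ?H" "x \<in> carrier (Mor ?H F G)" "y \<in> carrier (Mor ?H F G)"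
    then show "fmap ?X F G (x \<oplus>\<^bsub>Mor ?H F G\<^esub> y) = fmap ?X F G x \<oplus>\<^bsub>Mor ?H' (fob ?X F) (fob ?X G)\<^esub> fmap ?X F G y"
      using parallel_superfunctors.supernatural_add[OF ps, of F G x y] by (simp add: hom_functor_def T_add)
  next
    fix F G r x assume "F \<in> Ob ?H" "G \<in> Ob ?H" "r \<in> carrier K" "x \<in> carrier (Mor ?H F G)"
    then show "fmap ?X F G (r \<odot>\<^bsub>Mor ?H F G\<^esub> x) = r \<odot>\<^bsub>Mor ?H' (fob ?X F) (fob ?X G)\<^esub> fmap ?X F G x"
      using parallel_superfunctors.supernatural_smult[OF ps, of F G r x]
      by (auto simp: hom_functor_def T fob smult o j c intro!: restrict_ext)
  qed
qed

definition extension ::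
  "'k ring \<Rightarrow> ('o, 'k, 'm) supercat \<Rightarrow> ('p, 'k, 'n) pi_supercat
    \<Rightarrow> (('o, 'm, 'p, 'n) fctr, 'o \<Rightarrow> 'n, ('o \<times> bit, 'm, 'p, 'n) fctr, 'o \<times> bit \<Rightarrow> 'n) fctr" where
  "extension K A P = hom_functor K A (scat P) (extend_functor A P) (extend_trans A P)"

lemma superfunctor_extension:
  assumes A: "supercategory K A" and P: "pi_supercategory K P"
  shows "superfunctor K (hom_supercat K A (scat P)) (hom_supercat K (envelope_cat A) (scat P))
      (extension K A P)"
proof -
  interpret pi_supercategory K P by fact
  show ?thesis
    unfolding extension_def
    by (rule superfunctor_hom_functor[where H = "\<lambda>a. shift_pow P (snd a)" and j = fst])
      (auto simp: A scat_supercategory supercategory_envelope_cat superfunctor_shift_pow extend_trans_def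
        superfunctor_extend_functor[OF P] supernatural_extend_trans[OF P, unfolded extend_trans_def
            envelope_cat_simps(1)])
qed

section \<open>Restriction along the unit of the envelope\<close>

definition whisker :: "('o, 'm, 'h) cat \<Rightarrow> ('o, 'm, 'p, 'n) fctr \<Rightarrow> ('p \<Rightarrow> 'l) \<Rightarrow> 'o \<Rightarrow> 'l" where
  "whisker A J x = (\<lambda>a\<in>Ob A. x (fob J a))"

definition precomposition ::
  "'k ring \<Rightarrow> ('o, 'k, 'm) supercat \<Rightarrow> ('p, 'k, 'n) supercat \<Rightarrow> ('q, 'k, 'l) supercat \<Rightarrow> ('o, 'm, 'p, 'n) fctr
    \<Rightarrow> (('p, 'n, 'q, 'l) fctr, 'p \<Rightarrow> 'l, ('o, 'm, 'q, 'l) fctr, 'o \<Rightarrow> 'l) fctr" where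
  "precomposition K A B C J = hom_functor K B C (\<lambda>F. comp_functor A F J) (\<lambda>F G. whisker A J)"

text \<open>J preserves parity, so the sign rule for x at J f is the one required at f.\<close>

lemma supernatural_whisker:
  assumes J: "superfunctor K A B J" and x: "supernatural B C F G x"
  shows "supernatural A C (comp_functor A F J) (comp_functor A G J) (whisker A J x)"
proof -
  interpret J: superfunctor K A B J by fact
  show ?thesis
    using x unfolding supernatural_def families_def whisker_def
    by (auto simp: PiE_iff J.fmap_even J.A.homog_carrier)
qed

lemma superfunctor_precomposition:
  fixes K :: "'k ring"
  assumes J: "superfunctor K A B J" and C: "supercategory K C"
  shows "superfunctor K (hom_supercat K B C) (hom_supercat K A C) (precomposition K A B C J)"
proof -
  interpret J: superfunctor K A B J by fact
  have "x (fob J a) \<in> carrier (Mor C (fob F (fob J a)) (fob G (fob J a)))"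
    if "supernatural B C F G x" "a \<in> Ob A" for F G x a
    using that by (auto simp: supernatural_def families_def PiE_iff)
  then show ?thesis
    unfolding precomposition_def
    by (intro superfunctor_hom_functor[where H = "\<lambda>a. id_functor C" and j = "fob J"])
      (auto simp: C J.A.supercategory_axioms J.B.supercategory_axioms superfunctor_id superfunctor_comp[OF J]
        supernatural_whisker[OF J, unfolded whisker_def] supernatural_of_parity_def whisker_def
            superfunctor_is_functor[THEN is_functor.fob_Ob]
        intro!: restrict_ext)
qed

definition envelope_unit :: "('o, 'k, 'm) supercat \<Rightarrow> ('o, 'm, 'o \<times> bit, 'm) fctr" where
  "envelope_unit A = \<lparr>fob = (\<lambda>l\<in>Ob A. (l, 0)),
    fmap = (\<lambda>l\<in>Ob A. \<lambda>m\<in>Ob A. \<lambda>f\<in>carrier (Mor A l m). f)\<rparr>"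

lemma envelope_unit_simps [simp]:
  "l \<in> Ob A \<Longrightarrow> fob (envelope_unit A) l = (l, 0)"
  "\<lbrakk>l \<in> Ob A; m \<in> Ob A; f \<in> carrier (Mor A l m)\<rbrakk> \<Longrightarrow> fmap (envelope_unit A) l m f = f"
  by (simp_all add: envelope_unit_def)

lemma superfunctor_envelope_unit:
  assumes "supercategory K A"
  shows "superfunctor K A (envelope_cat A) (envelope_unit A)"
proof -
  interpret supercategory K A by fact
  show ?thesis
  proof (rule superfunctorI)
    show "supercategory K A" "supercategory K (envelope_cat A)"
      using assms by (simp_all add: supercategory_envelope_cat)
  qed (auto simp: envelope_unit_def Idt_closed Cmp_closed homog_carrier)
qed

text \<open>On the nose \<open>R \<circ> \<Phi> = 1\<close>, where \<open>\<Phi>\<close> is extension and \<open>R\<close> is restriction.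
  The isomorphism \<open>\<Phi> R G \<Rightarrow> G\<close> at \<open>\<Pi>\<^sup>a \<lambda>\<close> is \<open>G (1\<^sub>\<lambda>)\<^sub>0\<^sup>a \<circ> \<zeta>\<^sup>a\<close>, which is even because both
  factors have parity \<open>a\<close>.\<close>

definition extension_counit ::
  "('o, 'k, 'm) supercat \<Rightarrow> ('p, 'k, 'n) pi_supercat \<Rightarrow> ('o \<times> bit, 'm, 'p, 'n) fctr \<Rightarrow> 'o \<times> bit \<Rightarrow> 'n" where
  "extension_counit A P G = (\<lambda>s\<in>Ob (envelope_cat A).
    Cmp (scat P) (fob (shift_pow P (snd s)) (fob G (fst s, 0))) (fob G (fst s, 0)) (fob G s)
      (fmap G (fst s, 0) s (Idt A (fst s))) (zeta_pow P (snd s) (fob G (fst s, 0))))"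

lemma supernatural_iso_extension_counit:
  assumes A: "supercategory K A" and P: "pi_supercategory K P" and G: "superfunctor K (envelope_cat A)
      (scat P) G"
  shows "supernatural_iso_of_parity 0 (envelope_cat A) (scat P)
    (extend_functor A P (comp_functor A G (envelope_unit A))) G (extension_counit A P G)"
proof -
  interpret A: supercategory K A by fact
  interpret pi_supercategory K P by fact
  let ?E = "envelope_cat A" and ?F = "extend_functor A P (comp_functor A G (envelope_unit A))" and ?C
      = "Cmp (scat P)"
  interpret G: superfunctor K ?E "scat P" G by fact
  have "superfunctor K ?E (scat P) ?F"
    by (intro superfunctor_extend_functor superfunctor_comp[OF superfunctor_envelope_unit[OF A]] P G)
  then interpret X: parallel_superfunctors K ?E "scat P" ?F G
    using G by (simp add: parallel_superfunctors_def superfunctor_def)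
  let ?G0 = "\<lambda>s. fob G (fst s, 0)"
  let ?i = "\<lambda>s. fmap G (fst s, 0) s (Idt A (fst s))"
  have o: "?G0 s \<in> Ob (scat P)" if "fst s \<in> Ob A" for s using that by simp
  have o': "fob G s \<in> Ob (scat P)" if "fst s \<in> Ob A" for s using that G.fob_Ob[of s] by
      (simp add: mem_Times_iff)
  have i: "?i s \<in> homog (Mor (scat P) (?G0 s) (fob G s)) (snd s)" if "fst s \<in> Ob A" for s
    using that G.fmap_even[of "(fst s, 0)" s "Idt A (fst s)" "snd s"] by (simp add: mem_Times_iff A.Idt_even)
  have ic: "?i s \<in> carrier (Mor (scat P) (?G0 s) (fob G s))" if "fst s \<in> Ob A" for s
    using S.homog_carrier[OF o[OF that] o'[OF that] i[OF that]] .
  \<comment> \<open>The identity of \<open>A\<close>, read as a morphism from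
    \<open>(fst s, 0)\<close> to s, is an isomorphism of the envelope even when it is odd
    there.\<close>
  have iso: "iso_mor (scat P) (?G0 s) (fob G s) (?i s)" if "fst s \<in> Ob A" for s
  proof (rule G.fmap_iso(1))
    show "iso_mor ?E (fst s, 0) s (Idt A (fst s))"
      using A.iso_mor_Idt[OF that] by (simp add: iso_mor_def)
  qed (use that in \<open>simp_all add: mem_Times_iff\<close>)
  have C: "fob (shift_pow P a) (?G0 s) \<in> Ob (scat P)" if "fst s \<in> Ob A" for s a using that by simp
  have c: "extension_counit A P G s = ?C (fob (shift_pow P (snd s)) (?G0 s)) (?G0 s) (fob G s) (?i s)
      (zeta_pow P (snd s) (?G0 s))"
    if "fst s \<in> Ob A" for s using that by (simp add: extension_counit_def mem_Times_iff)
  show ?thesis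
    unfolding supernatural_iso_of_parity_def X.supernatural_of_parity_iff
  proof (intro conjI ballI allI)
    show "extension_counit A P G \<in> families ?E (scat P) ?F G"
      using ic o' by (auto simp: families_def extension_counit_def mem_Times_iff intro!: S.Cmp_closed)
    fix s assume "s \<in> Ob ?E"
    then have s: "fst s \<in> Ob A" by auto
    show "extension_counit A P G s \<in> homog (Mor (scat P) (fob ?F s) (fob G s)) 0"
      using S.Cmp_even[OF C[OF s] o[OF s] o'[OF s] zeta_pow_homog[OF o[OF s], of "snd s"] i[OF s]] s by
          (simp add: c)
    show "iso_mor (scat P) (fob ?F s) (fob G s) (extension_counit A P G s)"
      using S.iso_mor_Cmp[OF C[OF s] o[OF s] o'[OF s] zeta_pow_iso[OF o[OF s]] iso[OF s]] s by (simp add: c)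
    fix t q f assume "t \<in> Ob ?E" and f: "f \<in> homog (Mor ?E s t) q"
    then have t: "fst t \<in> Ob A" by auto
    have fc: "f \<in> carrier (Mor A (fst s) (fst t))" using A.homog_carrier[OF s t, of f] f by simp
    note st = o[OF s] o[OF t] o'[OF s] o'[OF t] C[OF s] C[OF t] ic[OF s] ic[OF t]
    let ?f = "fmap G (fst s, 0) (fst t, 0) f" and ?g = "fmap G s t f"
    have fg: "?f \<in> carrier (Mor (scat P) (?G0 s) (?G0 t))" "?g \<in> carrier (Mor (scat P) (fob G s) (fob G t))"
      using fc s t by (simp_all add: mem_Times_iff)
    \<comment> \<open>Both sides are G applied to f regarded as a morphism from the unshifted source
      to t, factored through the unshifted target or through s.\<close>
    have n: "?C (?G0 s) (?G0 t) (fob G t) (?i t) ?f = ?C (?G0 s) (fob G s) (fob G t) ?g (?i s)"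
      using fc s t G.fmap_Cmp[of "(fst s, 0)" "(fst t, 0)" t f "Idt A (fst t)"]
        G.fmap_Cmp[of "(fst s, 0)" s t "Idt A (fst s)" f]
      by (simp add: mem_Times_iff A.Idt_closed A.Idt_left A.Idt_right)
    let ?s = "fob (shift_pow P (snd s)) (?G0 s)" and ?t = "fob (shift_pow P (snd t)) (?G0 t)"
    have "?C ?s ?t (fob G t) (extension_counit A P G t) (fmap ?F s t f) =
      ?C ?s (?G0 t) (fob G t) (?i t) (?C ?s ?t (?G0 t) (zeta_pow P (snd t) (?G0 t))
        (?C ?s (?G0 t) ?t (zeta_pow_inv P (snd t) (?G0 t))
            (?C ?s (?G0 s) (?G0 t) ?f (zeta_pow P (snd s) (?G0 s)))))"
      using s t fc st fg by (simp add: c S.Cmp_assoc S.Cmp_closed)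
    also have "\<dots> = ?C ?s (?G0 s) (fob G t) (?C (?G0 s) (?G0 t) (fob G t) (?i t) ?f)
        (zeta_pow P (snd s) (?G0 s))"
      using s t fc st fg by (simp add: S.Cmp_assoc S.Cmp_closed zeta_pow_cancel)
    also have "\<dots> = ?C ?s (fob G s) (fob G t) ?g (extension_counit A P G s)"
      unfolding n using s t fc st fg by (simp add: c S.Cmp_assoc)
    finally show "?C (fob ?F s) (fob ?F t) (fob G t) (extension_counit A P G t) (fmap ?F s t f) =
        koszul (Mor (scat P) (fob ?F s) (fob G t)) (0 * q)
          (?C (fob ?F s) (fob G s) (fob G t) (fmap G s t f) (extension_counit A P G s))"
      using s t by simp
  qed
qed

text \<open>Let a be the shift of s. Moving \<Pi>^a x past \<zeta>^a costs (-1)^(pa). The relabelled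
  identity from \<open>(fst s, 0)\<close> to s has parity a in the envelope, so moving x past its
  images under G and H costs the same sign, and the two cancel.\<close>

lemma extension_counit_natural:
  assumes A: "supercategory K A" and P: "pi_supercategory K P"
    and G: "superfunctor K (envelope_cat A) (scat P) G" and H: "superfunctor K (envelope_cat A) (scat P) H"
    and x: "supernatural_of_parity p (envelope_cat A) (scat P) G H x" and s: "fst s \<in> Ob A"
  shows "Cmp (scat P) (fob (shift_pow P (snd s)) (fob G (fst s, 0)))
      (fob (shift_pow P (snd s)) (fob H (fst s, 0))) (fob H s)
      (extension_counit A P H s) (fmap (shift_pow P (snd s)) (fob G (fst s, 0)) (fob H (fst s, 0))
          (x (fst s, 0))) =
    Cmp (scat P) (fob (shift_pow P (snd s)) (fob G (fst s, 0))) (fob G s) (fob H s) (x s)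
        (extension_counit A P G s)"
proof -
  interpret A: supercategory K A by fact
  interpret pi_supercategory K P by fact
  let ?E = "envelope_cat A" and ?C = "Cmp (scat P)"
  interpret X: parallel_superfunctors K ?E "scat P" G H
    using G H by (simp add: parallel_superfunctors_def superfunctor_def)
  note x' = x[unfolded X.supernatural_of_parity_iff]
  let ?o = "(fst s, 0)"
  have sE: "?o \<in> Ob ?E" "s \<in> Ob ?E" using s by (auto simp: mem_Times_iff)
  let ?G0 = "fob G ?o" and ?H0 = "fob H ?o" and ?k = "\<lambda>a b. koszul (Mor (scat P) a b) (p * snd s)"
  let ?i = "\<lambda>G. fmap G ?o s (Idt A (fst s))"
  let ?pG = "fob (shift_pow P (snd s)) ?G0" and ?pH = "fob (shift_pow P (snd s)) ?H0"
  note o = X.F.fob_Ob[OF sE(1)] X.F.fob_Ob[OF sE(2)] X.G.fob_Ob[OF sE(1)] X.G.fob_Ob[OF sE(2)]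
  have xh: "x ?o \<in> homog (Mor (scat P) ?G0 ?H0) p" using x' sE by blast
  note xc = X.supernatural_carrier[OF X.supernatural_of_parity_supernatural[OF x]]
  have Ih: "Idt A (fst s) \<in> homog (Mor ?E ?o s) (snd s)" using s by (simp add: A.Idt_even)
  then have Ic: "Idt A (fst s) \<in> carrier (Mor ?E ?o s)" using s by (simp add: A.Idt_closed)
  note ic = X.F.fmap_carrier[OF sE Ic] X.G.fmap_carrier[OF sE Ic]
  have n: "?C ?G0 (fob G s) (fob H s) (x s) (?i G) = ?k ?G0 (fob H s) (?C ?G0 ?H0 (fob H s) (?i H) (x ?o))"
    using x' sE Ih by blast
  have "?C ?pG ?pH (fob H s) (?C ?pH ?H0 (fob H s) (?i H) (zeta_pow P (snd s) ?H0))
      (fmap (shift_pow P (snd s)) ?G0 ?H0 (x ?o))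
    = ?C ?pG ?H0 (fob H s) (?i H) (?C ?pG ?pH ?H0 (zeta_pow P (snd s) ?H0) (fmap (shift_pow P (snd s)) ?G0
        ?H0 (x ?o)))"
    using o xc[OF sE(1)] ic by (simp add: S.Cmp_assoc)
  also have "\<dots> = ?k ?pG (fob H s) (?C ?pG ?G0 (fob H s) (?C ?G0 ?H0 (fob H s) (?i H) (x ?o))
      (zeta_pow P (snd s) ?G0))"
    unfolding zeta_pow_natural[OF o(1,3) xh] using o xc[OF sE(1)] ic
    by (simp add: S.Cmp_assoc S.Cmp_koszul_right S.Cmp_closed mult.commute)
  also have "\<dots> = ?C ?pG ?G0 (fob H s) (?k ?G0 (fob H s) (?C ?G0 ?H0 (fob H s) (?i H) (x ?o)))
      (zeta_pow P (snd s) ?G0)"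
    using o xc[OF sE(1)] ic by (simp add: S.Cmp_koszul_left S.Cmp_closed)
  also have "\<dots> = ?C ?pG (fob G s) (fob H s) (x s) (?C ?pG ?G0 (fob G s) (?i G) (zeta_pow P (snd s) ?G0))"
    unfolding n[symmetric] using o xc[OF sE(2)] ic by (simp add: S.Cmp_assoc)
  finally show ?thesis using sE by (simp add: extension_counit_def)
qed

section \<open>Restriction is quasi-inverse to extension\<close>

lemma superequivalence_extension:
  assumes A: "supercategory K A" and P: "pi_supercategory K P"
  shows "superequivalence K (hom_supercat K A (scat P)) (hom_supercat K (envelope_cat A) (scat P))
      (extension K A P)"
proof -
  interpret A: supercategory K A by fact
  interpret pi_supercategory K P by fact
  let ?E = "envelope_cat A" and ?J = "envelope_unit A" and ?X = "extension K A P"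
  let ?H = "hom_supercat K A (scat P)" and ?H' = "hom_supercat K ?E (scat P)" and ?R
      = "precomposition K A ?E (scat P) ?J"
  note J = superfunctor_envelope_unit[OF A]
  have E: "supercategory K ?E" using A by (rule supercategory_envelope_cat)
  have X: "superfunctor K ?H ?H' ?X" using A P by (rule superfunctor_extension)
  have R: "superfunctor K ?H' ?H ?R" using J scat_supercategory by (rule superfunctor_precomposition)
  have H: "supercategory K ?H" and H': "supercategory K ?H'"
    using A E scat_supercategory by (simp_all add: supercategory_hom)
  interpret RX: superfunctor K ?H ?H "comp_functor ?H ?R ?X" using X R by (rule superfunctor_comp)
  interpret XR: superfunctor K ?H' ?H' "comp_functor ?H' ?X ?R" using R X by (rule superfunctor_comp)
  have RF: "comp_functor A (extend_functor A P F) ?J = F" if F: "superfunctor K A (scat P) F" for F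
  proof -
    interpret F: superfunctor K A "scat P" F by fact
    note e = superfunctor_comp[OF J superfunctor_extend_functor[OF P F], THEN superfunctor_is_functor]
    show ?thesis
    proof (rule functor_eqI[OF e F.is_functor_axioms])
      show "fob (comp_functor A (extend_functor A P F) ?J) a = fob F a" if "a \<in> Ob A" for a
        using that by (simp add: shift_pow_def)
      \<comment> \<open>At unshifted objects the conjugating factors of the extension are
        identities, which makes restriction a strict left inverse.\<close>
      have z: "zeta_pow P 0 c = Idt (scat P) c" "zeta_pow_inv P 0 c = Idt (scat P) c" if "c \<in> Ob (scat P)" for c
        using that zeta_pow_inv_right[OF that, of 0] zeta_pow_inv_closed[OF that, of 0]
        by (simp_all add: zeta_pow_def shift_pow_def S.Idt_left)
      show "fmap (comp_functor A (extend_functor A P F) ?J) a b f = fmap F a b f"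
        if "a \<in> Ob A" "b \<in> Ob A" "f \<in> carrier (Mor A a b)" for a b f
        using that by (simp add: z, simp add: shift_pow_def S.Idt_left S.Idt_right)
    qed
  qed
  have "comp_functor ?H ?R ?X = id_functor ?H"
  proof (rule functor_eqI[OF RX.is_functor_axioms is_functor_id])
    show "category ?H" by (rule RX.A.category_axioms)
    show "fob (comp_functor ?H ?R ?X) F = fob (id_functor ?H) F" if "F \<in> Ob ?H" for F
      using that by (simp add: precomposition_def extension_def hom_functor_def
          superfunctor_extend_functor[OF P] RF)
    fix F G x assume "F \<in> Ob ?H" "G \<in> Ob ?H" "x \<in> carrier (Mor ?H F G)"
    then have *: "superfunctor K A (scat P) F" "superfunctor K A (scat P) G" "supernatural A (scat P) F G x"
        by simp_all
    interpret ps: parallel_superfunctors K A "scat P" F G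
      using * by (simp add: parallel_superfunctors_def superfunctor_def)
    have ex: "supernatural ?E (scat P) (extend_functor A P F) (extend_functor A P G) (extend_trans A P F G x)"
      using superfunctor.axioms(3)[OF X, THEN linear_functor.axioms(3), THEN is_functor.fmap_carrier, of F G
          x] *
      by (simp add: extension_def hom_functor_def)
    have "whisker A ?J (extend_trans A P F G x) = x"
    proof (rule supernatural_ext[OF _ *(3)])
      show "supernatural A (scat P) F G (whisker A ?J (extend_trans A P F G x))"
        using supernatural_whisker[OF J ex]
        by (simp add: RF *)
      show "whisker A ?J (extend_trans A P F G x) a = x a" if "a \<in> Ob A" for a
        using that ps.supernatural_carrier[OF *(3) that] by
            (simp add: whisker_def extend_trans_def shift_pow_def)
    qed
    then show "fmap (comp_functor ?H ?R ?X) F G x = fmap (id_functor ?H) F G x"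
      using * ex by (simp add: precomposition_def extension_def hom_functor_def
          superfunctor_extend_functor[OF P])
  qed
  then have RX: "\<exists>x. supernatural_iso_of_parity 0 ?H ?H (comp_functor ?H ?R ?X) (id_functor ?H) x"
    using supernatural_id[OF superfunctor_id[OF H]] RX.A.iso_mor_Idt
    by (auto simp: supernatural_iso_of_parity_def id_trans_def intro!:
        exI[of _ "id_trans ?H ?H (id_functor ?H)"])
  interpret C: parallel_superfunctors K ?H' ?H' "comp_functor ?H' ?X ?R" "id_functor ?H'"
    using XR.superfunctor_axioms superfunctor_id[OF H'] H' by (simp add: parallel_superfunctors_def)
  \<comment> \<open>A transformation between endofunctors of a hom-supercategory: its component at G
    is itself a family indexed by the objects of the envelope.\<close>
  let ?y = "\<lambda>G\<in>Ob ?H'. extension_counit A P G"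
  have R_ob: "superfunctor K A (scat P) (comp_functor A G ?J)" if "superfunctor K ?E (scat P) G" for G
    using J that by (rule superfunctor_comp)
  have XR_ob: "fob (comp_functor ?H' ?X ?R) G = extend_functor A P (comp_functor A G ?J)"
    if "superfunctor K ?E (scat P) G" for G
    using that R_ob[OF that] by (simp add: precomposition_def extension_def hom_functor_def)
  note X_ob = superfunctor_extend_functor[OF P R_ob]
  note y = supernatural_iso_extension_counit[OF A P]
  note y' = y[unfolded supernatural_iso_of_parity_def, THEN conjunct1]
    y[unfolded supernatural_iso_of_parity_def supernatural_of_parity_def, THEN conjunct1, THEN conjunct1]
  have "supernatural_iso_of_parity 0 ?H' ?H' (comp_functor ?H' ?X ?R) (id_functor ?H') ?y"
    unfolding supernatural_iso_of_parity_def C.supernatural_of_parity_iff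
  proof (intro conjI ballI allI)
    show "?y \<in> families ?H' ?H' (comp_functor ?H' ?X ?R) (id_functor ?H')"
      using y' XR_ob by (auto simp: families_def simp del: fob_comp_functor)
    fix G assume "G \<in> Ob ?H'"
    then have G: "superfunctor K ?E (scat P) G" by simp
    show "?y G \<in> homog (Mor ?H' (fob (comp_functor ?H' ?X ?R) G) (fob (id_functor ?H') G)) 0"
      using y'(1)[OF G] XR_ob[OF G] G by (simp del: fob_comp_functor)
    show "iso_mor ?H' (fob (comp_functor ?H' ?X ?R) G) (fob (id_functor ?H') G) (?y G)"
      using hom_supercat_isoI[OF X_ob[OF G] G y[OF G]] XR_ob[OF G] G by (simp del: fob_comp_functor)
    fix H p x assume "H \<in> Ob ?H'" and "x \<in> homog (Mor ?H' G H) p"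
    then have H: "superfunctor K ?E (scat P) H" and x: "supernatural_of_parity p ?E (scat P) G H x" by simp_all
    interpret ps: parallel_superfunctors K ?E "scat P" G H
      using G H by (simp add: parallel_superfunctors_def superfunctor_def)
    note xs = ps.supernatural_of_parity_supernatural[OF x]
    have wx: "supernatural A (scat P) (comp_functor A G ?J) (comp_functor A H ?J) (whisker A ?J x)"
      using supernatural_whisker[OF J xs] .
    have "vcomp ?E (scat P) (extend_functor A P (comp_functor A G ?J))
        (extend_functor A P (comp_functor A H ?J)) H
        (extension_counit A P H) (extend_trans A P (comp_functor A G ?J) (comp_functor A H ?J)
            (whisker A ?J x)) =
      vcomp ?E (scat P) (extend_functor A P (comp_functor A G ?J)) G H x (extension_counit A P G)"
      unfolding vcomp_def
      using extension_counit_natural[OF A P G H x]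
      by (intro restrict_ext) (auto simp: extend_trans_def whisker_def)
    then show "Cmp ?H' (fob (comp_functor ?H' ?X ?R) G) (fob (comp_functor ?H' ?X ?R) H)
        (fob (id_functor ?H') H) (?y H)
        (fmap (comp_functor ?H' ?X ?R) G H x) =
      koszul (Mor ?H' (fob (comp_functor ?H' ?X ?R) G) (fob (id_functor ?H') H)) (0 * p)
       (Cmp ?H' (fob (comp_functor ?H' ?X ?R) G) (fob (id_functor ?H') G) (fob (id_functor ?H') H)
         (fmap (id_functor ?H') G H x) (?y G))"
      using G H xs wx R_ob[OF G] R_ob[OF H] by (simp add: precomposition_def extension_def hom_functor_def)
  qed
  then show ?thesis
    unfolding superequivalence_def using X R RX by blast
qed

section \<open>The category of Pi-categories\<close>

lemma natural_iso_iff: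
  "natural_iso A B F G x \<longleftrightarrow> x \<in> extensional (Ob A) \<and>
    (\<forall>a\<in>Ob A. x a \<in> carrier (Mor B (fob F a) (fob G a))) \<and>
    (\<forall>a\<in>Ob A. \<forall>b\<in>Ob A. \<forall>f\<in>carrier (Mor A a b).
      Cmp B (fob F a) (fob F b) (fob G b) (x b) (fmap F a b f) =
      Cmp B (fob F a) (fob G a) (fob G b) (fmap G a b f) (x a)) \<and>
    (\<forall>a\<in>Ob A. iso_mor B (fob F a) (fob G a) (x a))"
  unfolding natural_iso_def natural_def families_def PiE_iff by blast

context pi_category
begin

abbreviation (input) "C \<equiv> lcat P"
abbreviation (input) "s \<equiv> fob (lshift P)"
abbreviation (input) "sm \<equiv> fmap (lshift P)"

sublocale L: linear_category K "lcat P" by (rule lcat_linear_category)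
sublocale Sh: linear_functor K "lcat P" "lcat P" "lshift P" by (rule lshift_linear_functor)

lemma
  assumes "a \<in> Ob C"
  shows xi_closed [simp]: "xi P a \<in> carrier (Mor C (s (s a)) a)"
    and xi_iso_mor: "iso_mor C (s (s a)) a (xi P a)"
  using xi_iso assms unfolding natural_iso_iff lshift2_def by auto

lemma xi_natural:
  assumes "a \<in> Ob C" "b \<in> Ob C" "f \<in> carrier (Mor C a b)"
  shows "Cmp C (s (s a)) (s (s b)) b (xi P b) (sm (s a) (s b) (sm a b f)) = Cmp C (s (s a)) a b f (xi P a)"
  using xi_iso assms unfolding natural_iso_iff lshift2_def by simp

lemma fmap_xi:
  assumes "a \<in> Ob C"
  shows "sm (s (s a)) a (xi P a) = xi P (s a)"
  using fun_cong[OF xi_shift, of a] assms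
  by (simp add: hcomp_def id_trans_def lshift2_def Sh.fmap_Idt L.Idt_closed L.Idt_left L.Idt_right)

end

lemma pi_categoryI:
  assumes "linear_category K (lcat P)" and "linear_functor K (lcat P) (lcat P) (lshift P)"
    and "xi P \<in> extensional (Ob (lcat P))"
    and "\<And>a. a \<in> Ob (lcat P) \<Longrightarrow> iso_mor (lcat P) (fob (lshift P) (fob (lshift P) a)) a (xi P a)"
    and "\<And>a b f. \<lbrakk>a \<in> Ob (lcat P); b \<in> Ob (lcat P); f \<in> carrier (Mor (lcat P) a b)\<rbrakk> \<Longrightarrow>
      Cmp (lcat P) (fob (lshift P) (fob (lshift P) a)) (fob (lshift P) (fob (lshift P) b)) b (xi P b)
        (fmap (lshift P) (fob (lshift P) a) (fob (lshift P) b) (fmap (lshift P) a b f)) =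
      Cmp (lcat P) (fob (lshift P) (fob (lshift P) a)) a b f (xi P a)"
    and "\<And>a. a \<in> Ob (lcat P) \<Longrightarrow>
      fmap (lshift P) (fob (lshift P) (fob (lshift P) a)) a (xi P a) = xi P (fob (lshift P) a)"
  shows "pi_category K P"
proof -
  interpret L: linear_category K "lcat P" by fact
  interpret Sh: linear_functor K "lcat P" "lcat P" "lshift P" by fact
  have c: "xi P a \<in> carrier (Mor (lcat P) (fob (lshift P) (fob (lshift P) a)) a)" if "a \<in> Ob (lcat P)" for a
    using assms(4) that by (simp add: iso_mor_def)
  show ?thesis
    by (intro pi_category.intro)
      (use assms c in \<open>auto simp: natural_iso_iff lshift2_def hcomp_def id_trans_def Sh.fmap_Idt L.Idt_closed
        L.Idt_left L.Idt_right intro!: restrict_ext\<close>)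
qed

text \<open>The coherence condition of a \<open>\<Pi>\<close>-functor with the inverse of \<open>\<xi>\<close> moved to the other side.\<close>

lemma pi_functor_iff:
  "pi_functor K P Q F \<beta> \<longleftrightarrow> pi_category K P \<and> pi_category K Q \<and> linear_functor K (lcat P) (lcat Q) F \<and>
    natural_iso (lcat P) (lcat Q) (comp_functor (lcat P) (lshift Q) F) (comp_functor (lcat P) F (lshift P)) \<beta> \<and>
    (\<forall>a\<in>Ob (lcat P). Cmp (lcat Q) (fob (lshift Q) (fob (lshift Q) (fob F a)))
        (fob F (fob (lshift P) (fob (lshift P) a))) (fob F a)
      (fmap F (fob (lshift P) (fob (lshift P) a)) a (xi P a))
      (Cmp (lcat Q) (fob (lshift Q) (fob (lshift Q) (fob F a))) (fob (lshift Q) (fob F (fob (lshift P) a)))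
          (fob F (fob (lshift P) (fob (lshift P) a)))
        (\<beta> (fob (lshift P) a))
        (fmap (lshift Q) (fob (lshift Q) (fob F a)) (fob F (fob (lshift P) a)) (\<beta> a))) =
      xi Q (fob F a))"
    (is "_ \<longleftrightarrow> ?P \<and> ?Q \<and> ?F \<and> ?N \<and> ?X")
proof (cases "?P \<and> ?Q \<and> ?F \<and> ?N")
  case True
  then interpret P: pi_category K P by blast
  from True interpret Q: pi_category K Q by blast
  from True interpret F: linear_functor K "lcat P" "lcat Q" F by blast
  let ?s = "fob (lshift P)" and ?t = "fob (lshift Q)" and ?f = "fob F" and ?C = "Cmp (lcat Q)"
  have N: ?N using True by blast
  have c: "\<beta> a \<in> carrier (Mor (lcat Q) (?t (?f a)) (?f (?s a)))" if "a \<in> Ob (lcat P)" for a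
    using N that unfolding natural_iso_iff by simp
  \<comment> \<open>By naturality of \<xi> the horizontal composite on the left is F of the inverse
    of \<xi> after \<xi> at F a. Composing with the isomorphism F \<xi>, which can be cancelled,
    moves it to the other side.\<close>
  have eq: "(?C (?t (?t (?f a))) (?t (?t (?f (?s (?s a))))) (?f (?s (?s a))) (xi Q (?f (?s (?s a))))
      (fmap (lshift Q) (?t (?f a)) (?t (?f (?s (?s a)))) (fmap (lshift Q) (?f a) (?f (?s (?s a)))
         (fmap F a (?s (?s a)) (inv_mor (lcat P) (?s (?s a)) a (xi P a))))) = r) \<longleftrightarrow>
    (?C (?t (?t (?f a))) (?f (?s (?s a))) (?f a) (fmap F (?s (?s a)) a (xi P a)) r = xi Q (?f a))"
    if a: "a \<in> Ob (lcat P)" and r: "r \<in> carrier (Mor (lcat Q) (?t (?t (?f a))) (?f (?s (?s a))))" for a r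
  proof -
    have sa: "?s (?s a) \<in> Ob (lcat P)" using a by simp
    note i = P.L.inv_mor_closed[OF sa a P.xi_iso_mor[OF a]] P.L.inv_mor_right[OF sa a P.xi_iso_mor[OF a]]
      P.xi_closed[OF a]
    note Fi = F.fmap_iso[OF sa a P.xi_iso_mor[OF a]]
    let ?l = "?C (?t (?t (?f a))) (?f a) (?f (?s (?s a)))
        (fmap F a (?s (?s a)) (inv_mor (lcat P) (?s (?s a)) a (xi P a))) (xi Q (?f a))"
    have FF: "?C (?f a) (?f (?s (?s a))) (?f a) (fmap F (?s (?s a)) a (xi P a))
        (fmap F a (?s (?s a)) (inv_mor (lcat P) (?s (?s a)) a (xi P a))) = Idt (lcat Q) (?f a)"
      using F.fmap_Cmp[OF a sa a i(1,3), symmetric] a i(2) by (simp add: F.fmap_Idt)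
    have l: "?C (?t (?t (?f a))) (?f (?s (?s a))) (?f a) (fmap F (?s (?s a)) a (xi P a)) ?l = xi Q (?f a)"
      using a i by (simp add: Q.L.Cmp_assoc[symmetric] FF Q.L.Idt_left)
    have "?l = r \<longleftrightarrow> ?C (?t (?t (?f a))) (?f (?s (?s a))) (?f a) (fmap F (?s (?s a)) a (xi P a)) ?l =
        ?C (?t (?t (?f a))) (?f (?s (?s a))) (?f a) (fmap F (?s (?s a)) a (xi P a)) r"
      using a r i Q.L.cancel_left[of "?t (?t (?f a))" "?f (?s (?s a))" "?f a" ?l r
          "fmap F (?s (?s a)) a (xi P a)"] Fi
      by (auto simp: Q.L.Cmp_closed)
    then show ?thesis
      using a i l by (auto simp: Q.xi_natural)
  qed
  have "pi_functor K P Q F \<beta> \<longleftrightarrow> (\<forall>a\<in>Ob (lcat P).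
      (?C (?t (?t (?f a))) (?t (?t (?f (?s (?s a))))) (?f (?s (?s a))) (xi Q (?f (?s (?s a))))
      (fmap (lshift Q) (?t (?f a)) (?t (?f (?s (?s a)))) (fmap (lshift Q) (?f a) (?f (?s (?s a)))
         (fmap F a (?s (?s a)) (inv_mor (lcat P) (?s (?s a)) a (xi P a)))))) =
      ?C (?t (?t (?f a))) (?t (?f (?s a))) (?f (?s (?s a))) (\<beta> (?s a))
          (fmap (lshift Q) (?t (?f a)) (?f (?s a)) (\<beta> a)))"
    using True unfolding pi_functor_def hcomp_through_def hcomp_def vcomp_def restrict_def fun_eq_iff
    by (auto simp: lshift2_def inv_trans_def id_trans_def c F.fmap_Idt Q.Sh.fmap_Idt Q.L.Idt_left Q.L.Idt_right
        Q.L.Idt_closed P.L.Idt_closed P.L.inv_mor_closed P.xi_iso_mor)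
  also have "\<dots> \<longleftrightarrow> ?X"
    by (intro ball_cong refl eq) (auto intro!: Q.L.Cmp_closed simp: c)
  finally show ?thesis using True by blast
next
  case False
  then show ?thesis by (auto simp: pi_functor_def)
qed

section \<open>Componentwise laws of \<Pi>-functors and their composition\<close>

locale pi_functor_laws = P: pi_category K P + Q: pi_category K Q + F: linear_functor K "lcat P" "lcat Q" F
  for K :: "'k ring" and P :: "('o, 'k, 'm) pi_cat" and Q :: "('p, 'k, 'n) pi_cat" and F +
  fixes \<beta> :: "'o \<Rightarrow> 'n"
  assumes beta_extensional: "\<beta> \<in> extensional (Ob P.C)"
    and beta_iso_mor: "a \<in> Ob P.C \<Longrightarrow>
      iso_mor Q.C (Q.s (fob F a)) (fob F (P.s a)) (\<beta> a)"
    and beta_natural: "\<lbrakk>a \<in> Ob P.C; b \<in> Ob P.C; f \<in> carrier (Mor P.C a b)\<rbrakk> \<Longrightarrow>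
      Cmp Q.C (Q.s (fob F a)) (Q.s (fob F b)) (fob F (P.s b))
        (\<beta> b) (Q.sm (fob F a) (fob F b) (fmap F a b f)) =
      Cmp Q.C (Q.s (fob F a)) (fob F (P.s a)) (fob F (P.s b))
        (fmap F (P.s a) (P.s b) (P.sm a b f)) (\<beta> a)"
    and beta_xi: "a \<in> Ob P.C \<Longrightarrow>
      Cmp Q.C (Q.s (Q.s (fob F a))) (fob F (P.s (P.s a))) (fob F a)
      (fmap F (P.s (P.s a)) a (xi P a))
      (Cmp Q.C (Q.s (Q.s (fob F a))) (Q.s (fob F (P.s a)))
          (fob F (P.s (P.s a)))
        (\<beta> (P.s a))
        (Q.sm (Q.s (fob F a)) (fob F (P.s a)) (\<beta> a))) =
      xi Q (fob F a)"

lemma (in pi_functor_laws) beta_closed [simp]: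
  "a \<in> Ob (lcat P) \<Longrightarrow> \<beta> a \<in> carrier (Mor (lcat Q) (fob (lshift Q) (fob F a)) (fob F (fob (lshift P) a)))"
  using beta_iso_mor by (simp add: iso_mor_def)

lemma pi_functor_eq_laws: "pi_functor K P Q F \<beta> \<longleftrightarrow> pi_functor_laws K P Q F \<beta>"
proof
  assume "pi_functor K P Q F \<beta>"
  then show "pi_functor_laws K P Q F \<beta>"
    unfolding pi_functor_iff natural_iso_iff
    by (intro pi_functor_laws.intro pi_functor_laws_axioms.intro)
      (auto simp: linear_functor_def is_functor_def is_functor.fob_Ob[OF linear_functor.axioms(3)]
        is_functor.fmap_carrier[OF linear_functor.axioms(3)])
next
  assume "pi_functor_laws K P Q F \<beta>"
  then interpret pi_functor_laws K P Q F \<beta> .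
  show "pi_functor K P Q F \<beta>"
    unfolding pi_functor_iff natural_iso_iff
    using beta_extensional beta_iso_mor beta_natural beta_xi
    by (simp add: P.pi_category_axioms Q.pi_category_axioms F.linear_functor_axioms)
qed

lemma comp_beta_eq:
  assumes "pi_functor K P Q F \<beta>F" "pi_functor K Q R G \<beta>G"
  shows "comp_beta P Q R G \<beta>G F \<beta>F = (\<lambda>a\<in>Ob (lcat P).
    Cmp (lcat R) (fob (lshift R) (fob G (fob F a))) (fob G (fob (lshift Q) (fob F a)))
        (fob G (fob F (fob (lshift P) a)))
      (fmap G (fob (lshift Q) (fob F a)) (fob F (fob (lshift P) a)) (\<beta>F a)) (\<beta>G (fob F a)))"
proof -
  interpret F: pi_functor_laws K P Q F \<beta>F using assms by (simp add: pi_functor_eq_laws)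
  interpret G: pi_functor_laws K Q R G \<beta>G using assms by (simp add: pi_functor_eq_laws)
  show ?thesis
    unfolding comp_beta_def vcomp_def hcomp_def
    by (rule restrict_ext) (simp add: id_trans_def G.F.fmap_Idt G.Q.Sh.fmap_Idt G.Q.L.Idt_left
        G.Q.L.Idt_right F.Q.L.Idt_closed)
qed

text \<open>Naturality of \<beta>_G at the morphism \<beta>_F a brings the two copies of \<beta>_F
  together. Inside G they combine with F \<xi> to \<xi> at F a by the coherence of F, after which
  the coherence of G at F a applies.\<close>

lemma pi_functor_comp:
  assumes F: "pi_functor K P Q F \<beta>F" and G: "pi_functor K Q R G \<beta>G"
  shows "pi_functor K P R (comp_functor (lcat P) G F) (comp_beta P Q R G \<beta>G F \<beta>F)"
proof -
  interpret F: pi_functor_laws K P Q F \<beta>F using F by (simp add: pi_functor_eq_laws)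
  interpret G: pi_functor_laws K Q R G \<beta>G using G by (simp add: pi_functor_eq_laws)
  interpret GF: linear_functor K "lcat P" "lcat R" "comp_functor (lcat P) G F"
    by (rule linear_functor_comp) unfold_locales
  let ?b = "comp_beta P Q R G \<beta>G F \<beta>F" and ?GF = "comp_functor (lcat P) G F"
  let ?s = "fob (lshift P)" and ?t = "fob (lshift Q)" and ?u = "fob (lshift R)" and ?f = "fob F" and ?g
      = "fob G"
  let ?C = "Cmp (lcat R)" and ?S = "fmap (lshift R)" and ?G = "fmap G"
  have b: "?b a = ?C (?u (?g (?f a))) (?g (?t (?f a))) (?g (?f (?s a))) (?G (?t (?f a)) (?f (?s a)) (\<beta>F a))
      (\<beta>G (?f a))"
    if "a \<in> Ob (lcat P)" for a using that comp_beta_eq[OF F G] by simp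
  show ?thesis
    unfolding pi_functor_eq_laws
  proof (intro pi_functor_laws.intro pi_functor_laws_axioms.intro)
    show "pi_category K P" "pi_category K R" "linear_functor K (lcat P) (lcat R) (comp_functor (lcat P) G F)"
      by unfold_locales
    show "?b \<in> extensional (Ob (lcat P))" using comp_beta_eq[OF F G] by simp
    fix a assume a: "a \<in> Ob (lcat P)"
    show "iso_mor (lcat R) (?u (fob ?GF a)) (fob ?GF (?s a)) (?b a)"
      using a by (auto simp: b intro!: G.Q.L.iso_mor_Cmp G.F.fmap_iso F.beta_iso_mor G.beta_iso_mor)
    {
      fix c f assume c: "c \<in> Ob (lcat P)" and f: "f \<in> carrier (Mor (lcat P) a c)"
      let ?Ff = "fmap F a c f" and ?tF = "fmap (lshift Q) (?f a) (?f c) (fmap F a c f)"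
      have "?C (?u (?g (?f a))) (?u (?g (?f c))) (?g (?f (?s c))) (?b c)
          (?S (?g (?f a)) (?g (?f c)) (?G (?f a) (?f c) ?Ff))
        = ?C (?u (?g (?f a))) (?g (?t (?f c))) (?g (?f (?s c))) (?G (?t (?f c)) (?f (?s c)) (\<beta>F c))
            (?C (?u (?g (?f a))) (?u (?g (?f c))) (?g (?t (?f c))) (\<beta>G (?f c))
                (?S (?g (?f a)) (?g (?f c)) (?G (?f a) (?f c) ?Ff)))"
        using a c f by (simp add: b G.Q.L.Cmp_assoc)
      also have "\<dots> = ?C (?u (?g (?f a))) (?g (?t (?f a))) (?g (?f (?s c))) (?G (?t (?f a)) (?f (?s c))
          (Cmp (lcat Q) (?t (?f a)) (?t (?f c)) (?f (?s c)) (\<beta>F c) ?tF)) (\<beta>G (?f a))"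
        using a c f by (simp add: G.beta_natural G.F.fmap_Cmp G.Q.L.Cmp_assoc)
      also have "\<dots> = ?C (?u (?g (?f a))) (?g (?f (?s a))) (?g (?f (?s c)))
          (?G (?f (?s a)) (?f (?s c)) (fmap F (?s a) (?s c) (fmap (lshift P) a c f))) (?b a)"
        using a c f by (simp add: F.beta_natural G.F.fmap_Cmp G.Q.L.Cmp_assoc b)
      finally show "?C (?u (fob ?GF a)) (?u (fob ?GF c))
          (fob ?GF (?s c)) (?b c)
          (?S (fob ?GF a) (fob ?GF c) (fmap ?GF a c f)) =
        ?C (?u (fob ?GF a)) (fob ?GF (?s a))
          (fob ?GF (?s c))
          (fmap ?GF (?s a) (?s c) (fmap (lshift P) a c f)) (?b a)"
        using a c f by simp
    }
    let ?X = "?g (?f a)"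
    have n: "?C (?u (?g (?t (?f a)))) (?u (?g (?f (?s a)))) (?g (?t (?f (?s a)))) (\<beta>G (?f (?s a)))
        (?S (?g (?t (?f a))) (?g (?f (?s a))) (?G (?t (?f a)) (?f (?s a)) (\<beta>F a))) =
      ?C (?u (?g (?t (?f a)))) (?g (?t (?t (?f a)))) (?g (?t (?f (?s a))))
        (?G (?t (?t (?f a))) (?t (?f (?s a))) (fmap (lshift Q) (?t (?f a)) (?f (?s a)) (\<beta>F a)))
            (\<beta>G (?t (?f a)))"
      using a by (intro G.beta_natural) simp_all
    let ?M = "Cmp (lcat Q) (?t (?t (?f a))) (?t (?f (?s a))) (?f (?s (?s a))) (\<beta>F (?s a))
          (fmap (lshift Q) (?t (?f a)) (?f (?s a)) (\<beta>F a))"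
    have "?C (?u (?u ?X)) (?u (?g (?f (?s a)))) (?g (?f (?s (?s a)))) (?b (?s a))
        (?S (?u ?X) (?g (?f (?s a))) (?b a)) =
      ?C (?u (?u ?X)) (?g (?t (?f (?s a)))) (?g (?f (?s (?s a)))) (?G (?t (?f (?s a))) (?f (?s (?s a)))
          (\<beta>F (?s a)))
       (?C (?u (?u ?X)) (?u (?g (?t (?f a)))) (?g (?t (?f (?s a))))
         (?C (?u (?g (?t (?f a)))) (?u (?g (?f (?s a)))) (?g (?t (?f (?s a)))) (\<beta>G (?f (?s a)))
           (?S (?g (?t (?f a))) (?g (?f (?s a))) (?G (?t (?f a)) (?f (?s a)) (\<beta>F a))))
         (?S (?u ?X) (?g (?t (?f a))) (\<beta>G (?f a))))"
      using a by (simp add: b G.Q.Sh.fmap_Cmp G.Q.L.Cmp_assoc G.Q.L.Cmp_closed)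
    also have "\<dots> = ?C (?u (?u ?X)) (?g (?t (?t (?f a)))) (?g (?f (?s (?s a))))
        (?G (?t (?t (?f a))) (?f (?s (?s a))) ?M)
       (?C (?u (?u ?X)) (?u (?g (?t (?f a)))) (?g (?t (?t (?f a)))) (\<beta>G (?t (?f a)))
           (?S (?u ?X) (?g (?t (?f a))) (\<beta>G (?f a))))"
      unfolding n using a by (simp add: G.F.fmap_Cmp G.Q.L.Cmp_assoc G.Q.L.Cmp_closed)
    finally have e: "?C (?u (?u ?X)) (?u (?g (?f (?s a)))) (?g (?f (?s (?s a)))) (?b (?s a))
        (?S (?u ?X) (?g (?f (?s a))) (?b a)) = \<dots>" .
    have "?C (?u (?u ?X)) (?g (?f (?s (?s a)))) ?X (?G (?f (?s (?s a))) (?f a) (fmap F (?s (?s a)) a (xi P a)))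
        (?C (?u (?u ?X)) (?u (?g (?f (?s a)))) (?g (?f (?s (?s a)))) (?b (?s a))
            (?S (?u ?X) (?g (?f (?s a))) (?b a))) =
      ?C (?u (?u ?X)) (?g (?t (?t (?f a)))) ?X (?G (?t (?t (?f a))) (?f a)
        (Cmp (lcat Q) (?t (?t (?f a))) (?f (?s (?s a))) (?f a) (fmap F (?s (?s a)) a (xi P a)) ?M))
       (?C (?u (?u ?X)) (?u (?g (?t (?f a)))) (?g (?t (?t (?f a)))) (\<beta>G (?t (?f a)))
           (?S (?u ?X) (?g (?t (?f a))) (\<beta>G (?f a))))"
      unfolding e using a by (simp add: G.F.fmap_Cmp G.Q.L.Cmp_assoc G.Q.L.Cmp_closed F.Q.L.Cmp_closed)
    also have "\<dots> = xi R ?X" unfolding F.beta_xi[OF a] using a by (intro G.beta_xi) simp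
    finally show "?C (?u (?u (fob ?GF a))) (fob ?GF (?s (?s a)))
        (fob ?GF a) (fmap ?GF (?s (?s a)) a (xi P a))
        (?C (?u (?u (fob ?GF a))) (?u (fob ?GF (?s a)))
          (fob ?GF (?s (?s a))) (?b (?s a))
          (?S (?u (fob ?GF a)) (fob ?GF (?s a)) (?b a))) =
        xi R (fob ?GF a)"
      using a by simp
  qed
qed

lemma pi_functor_id:
  assumes "pi_category K P"
  shows "pi_functor K P P (id_functor (lcat P)) (id_trans (lcat P) (lcat P) (lshift P))"
proof -
  interpret pi_category K P by fact
  interpret I: linear_functor K "lcat P" "lcat P" "id_functor (lcat P)"
    by (rule linear_functor_id) unfold_locales
  show ?thesis
    unfolding pi_functor_eq_laws
    by (intro pi_functor_laws.intro pi_functor_laws_axioms.intro)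
      (auto simp: assms I.linear_functor_axioms id_trans_def L.iso_mor_Idt L.Idt_closed L.Idt_left
          L.Idt_right Sh.fmap_Idt)
qed

lemma PiCat_simps [simp]:
  "Ob (PiCat K) = {P. pi_category K P}"
  "carrier (Mor (PiCat K) P Q) = {(F, \<beta>). pi_functor K P Q F \<beta>}"
  "Cmp (PiCat K) P Q R (G, \<beta>G) (F, \<beta>F) = (comp_functor (lcat P) G F, comp_beta P Q R G \<beta>G F \<beta>F)"
  "Idt (PiCat K) P = (id_functor (lcat P), id_trans (lcat P) (lcat P) (lshift P))"
  by (simp_all add: PiCat_def)

lemma pi_functor_is_functor: "pi_functor K P Q F \<beta> \<Longrightarrow> is_functor (lcat P) (lcat Q) F"
  by (simp add: pi_functor_def linear_functor_def)

lemma category_PiCat: "category (PiCat K)"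
proof unfold_locales
  fix P Q f assume "P \<in> Ob (PiCat K)" "Q \<in> Ob (PiCat K)" "f \<in> carrier (Mor (PiCat K) P Q)"
  then obtain F b where f: "f = (F, b)" and F: "pi_functor K P Q F b" and P: "pi_category K P" and Q:
      "pi_category K Q" by auto
  interpret F: pi_functor_laws K P Q F b using F by (simp add: pi_functor_eq_laws)
  have "comp_beta P Q Q (id_functor (lcat Q)) (id_trans (lcat Q) (lcat Q) (lshift Q)) F b = b"
    "comp_beta P P Q F b (id_functor (lcat P)) (id_trans (lcat P) (lcat P) (lshift P)) = b"
    unfolding comp_beta_eq[OF F pi_functor_id[OF Q]] comp_beta_eq[OF pi_functor_id[OF P] F]
    by (auto intro!: extensionalityI[OF _ F.beta_extensional]
        simp: id_trans_def F.Q.L.Idt_left F.Q.L.Idt_right F.F.fmap_Idt)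
  then show "Cmp (PiCat K) P Q Q (Idt (PiCat K) Q) f = f" "Cmp (PiCat K) P P Q f (Idt (PiCat K) P) = f"
    using pi_functor_is_functor[OF F] by (simp_all add: f comp_functor_id_left comp_functor_id_right)
next
  fix P Q R S f g h
  assume "P \<in> Ob (PiCat K)" "Q \<in> Ob (PiCat K)" "R \<in> Ob (PiCat K)" "S \<in> Ob (PiCat K)"
    "f \<in> carrier (Mor (PiCat K) P Q)" "g \<in> carrier (Mor (PiCat K) Q R)" "h \<in> carrier (Mor (PiCat K) R S)"
  then obtain F b G c H d where fgh: "f = (F, b)" "g = (G, c)" "h = (H, d)"
    and F: "pi_functor K P Q F b" and G: "pi_functor K Q R G c" and H: "pi_functor K R S H d" by auto
  interpret F: pi_functor_laws K P Q F b using F by (simp add: pi_functor_eq_laws)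
  interpret G: pi_functor_laws K Q R G c using G by (simp add: pi_functor_eq_laws)
  interpret H: pi_functor_laws K R S H d using H by (simp add: pi_functor_eq_laws)
  have "comp_beta P Q S (comp_functor (lcat Q) H G) (comp_beta Q R S H d G c) F b =
      comp_beta P R S H d (comp_functor (lcat P) G F) (comp_beta P Q R G c F b)"
    unfolding comp_beta_eq[OF F pi_functor_comp[OF G H]] comp_beta_eq[OF pi_functor_comp[OF F G] H]
    by (rule restrict_ext)
      (simp add: comp_beta_eq[OF G H] comp_beta_eq[OF F G] H.F.fmap_Cmp H.Q.L.Cmp_assoc)
  then show "Cmp (PiCat K) P Q S (Cmp (PiCat K) Q R S h g) f = Cmp (PiCat K) P R S h (Cmp (PiCat K) P Q R g f)"
    using F G H by (auto simp: fgh intro!: comp_functor_assoc intro: pi_functor_is_functor)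
qed (auto simp: pi_functor_id pi_functor_comp)

section \<open>Equivalences from fully faithful essentially surjective functors\<close>

text \<open>Choice supplies objects \<open>r b\<close> with isomorphisms \<open>e b\<close> from F
  (r b) to b, and preimages \<open>m\<close> of morphisms. By faithfulness every equation between
  morphisms of A can be checked after applying F.\<close>

lemma cat_equivalenceI:
  assumes F: "is_functor A B F"
    and full: "\<And>a b h. \<lbrakk>a \<in> Ob A; b \<in> Ob A; h \<in> carrier (Mor B (fob F a) (fob F b))\<rbrakk>
      \<Longrightarrow> \<exists>f\<in>carrier (Mor A a b). fmap F a b f = h"
    and faithful: "\<And>a b f g. \<lbrakk>a \<in> Ob A; b \<in> Ob A; f \<in> carrier (Mor A a b); g \<in> carrier (Mor A a b);
      fmap F a b f = fmap F a b g\<rbrakk> \<Longrightarrow> f = g"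
    and surj: "\<And>b. b \<in> Ob B \<Longrightarrow> \<exists>a\<in>Ob A. \<exists>h. iso_mor B (fob F a) b h"
  shows "cat_equivalence A B F"
proof -
  interpret is_functor A B F by fact
  obtain r e where r: "\<And>b. b \<in> Ob B \<Longrightarrow> r b \<in> Ob A"
    and e: "\<And>b. b \<in> Ob B \<Longrightarrow> iso_mor B (fob F (r b)) b (e b)"
    using surj by metis
  obtain m where m: "\<And>a b h. \<lbrakk>a \<in> Ob A; b \<in> Ob A; h \<in> carrier (Mor B (fob F a) (fob F b))\<rbrakk>
      \<Longrightarrow> m a b h \<in> carrier (Mor A a b) \<and> fmap F a b (m a b h) = h"
    using full by metis
  note m1 [simp] = m[THEN conjunct1] and m2 [simp] = m[THEN conjunct2]
  note [simp] = r B.Cmp_closed A.Cmp_closed B.Idt_closed A.Idt_closed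
  let ?f = "fob F" and ?e' = "\<lambda>b. inv_mor B (fob F (r b)) b (e b)"
  have ec [simp]: "e b \<in> carrier (Mor B (?f (r b)) b)" "?e' b \<in> carrier (Mor B b (?f (r b)))"
    "Cmp B (?f (r b)) b (?f (r b)) (?e' b) (e b) = Idt B (?f (r b))" "Cmp B b (?f (r b)) b (e b) (?e' b)
        = Idt B b"
    if "b \<in> Ob B" for b
    using that e[OF that] B.iso_mor_carrier B.inv_mor_closed B.inv_mor_left B.inv_mor_right by simp_all
  have cancel [simp]: "Cmp B c (?f (r b)) b (e b) (Cmp B c b (?f (r b)) (?e' b) h) = h"
    if "b \<in> Ob B" "c \<in> Ob B" "h \<in> carrier (Mor B c b)" for b c h
    using that B.Cmp_assoc[of c b "?f (r b)" b h "?e' b" "e b"] by (simp add: B.Idt_left)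
  have cancel' [simp]: "Cmp B c b (?f (r b)) (?e' b) (Cmp B c (?f (r b)) b (e b) h') = h'"
    if "b \<in> Ob B" "c \<in> Ob B" "h' \<in> carrier (Mor B c (?f (r b)))" for b c h'
    using that B.Cmp_assoc[of c "?f (r b)" b "?f (r b)" h' "e b" "?e' b"] by (simp add: B.Idt_left)
  \<comment> \<open>Transports h from b -> c to the chosen images F (r b) -> F (r c), where fullness
    provides the preimage that serves as the value of G.\<close>
  let ?t = "\<lambda>b c h. Cmp B (?f (r b)) c (?f (r c)) (?e' c) (Cmp B (?f (r b)) b c h (e b))"
  define G where "G = \<lparr>fob = (\<lambda>b\<in>Ob B. r b), fmap
      = (\<lambda>b\<in>Ob B. \<lambda>c\<in>Ob B. \<lambda>h\<in>carrier (Mor B b c). m (r b) (r c) (?t b c h))\<rparr>"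
  have G [simp]: "b \<in> Ob B \<Longrightarrow> fob G b = r b"
    "\<lbrakk>b \<in> Ob B; c \<in> Ob B; h \<in> carrier (Mor B b c)\<rbrakk> \<Longrightarrow> fmap G b c h = m (r b) (r c) (?t b c h)" for b c h
    by (simp_all add: G_def)
  have "is_functor B A G"
  proof unfold_locales
    show "fob G \<in> Ob B \<rightarrow>\<^sub>E Ob A" by (auto simp: G_def)
    show "fmap G \<in> (\<Pi>\<^sub>E b\<in>Ob B. \<Pi>\<^sub>E c\<in>Ob B. carrier (Mor B b c) \<rightarrow>\<^sub>E carrier (Mor A (fob G b) (fob G c)))"
      by (auto simp: G_def)
  next
    fix b assume b: "b \<in> Ob B"
    then show "fmap G b b (Idt B b) = Idt A (fob G b)"
      by (intro faithful[of "r b" "r b"]) (simp_all add: fmap_Idt B.Idt_left)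
  next
    fix a b c f g assume abc: "a \<in> Ob B" "b \<in> Ob B" "c \<in> Ob B" and fg: "f \<in> carrier (Mor B a b)" "g
        \<in> carrier (Mor B b c)"
    have "?t a c (Cmp B a b c g f) = Cmp B (?f (r a)) (?f (r b)) (?f (r c)) (?t b c g) (?t a b f)"
      using abc fg by (simp add: B.Cmp_assoc)
    then show "fmap G a c (Cmp B a b c g f) = Cmp A (fob G a) (fob G b) (fob G c) (fmap G b c g) (fmap G a b f)"
      using abc fg by (intro faithful[of "r a" "r c"]) (simp_all add: fmap_Cmp)
  qed
  then interpret G: is_functor B A G .
  \<comment> \<open>By construction F maps this to \<open>e (?f a)\<close>, so its naturality and
    invertibility can be read off in B.\<close>
  let ?x = "\<lambda>a\<in>Ob A. m (r (?f a)) a (e (?f a))"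
  have "natural_iso A A (comp_functor A G F) (id_functor A) ?x"
    unfolding natural_iso_iff
  proof (intro conjI ballI)
    fix a assume a: "a \<in> Ob A"
    show "?x a \<in> carrier (Mor A (fob (comp_functor A G F) a) (fob (id_functor A) a))" using a by simp
    show "iso_mor A (fob (comp_functor A G F) a) (fob (id_functor A) a) (?x a)"
    proof (rule A.iso_morI)
      let ?y = "m a (r (?f a)) (?e' (?f a))"
      show "?x a \<in> carrier (Mor A (fob (comp_functor A G F) a) (fob (id_functor A) a))"
        "?y \<in> carrier (Mor A (fob (id_functor A) a) (fob (comp_functor A G F) a))" using a by simp_all
      show "Cmp A (fob (comp_functor A G F) a) (fob (id_functor A) a) (fob (comp_functor A G F) a) ?y (?x a) =
          Idt A (fob (comp_functor A G F) a)"
        using a by (intro faithful[of "r (?f a)" "r (?f a)"]) (simp_all add: fmap_Cmp fmap_Idt)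
      show "Cmp A (fob (id_functor A) a) (fob (comp_functor A G F) a) (fob (id_functor A) a) (?x a) ?y =
          Idt A (fob (id_functor A) a)"
        using a by (intro faithful[of a a]) (simp_all add: fmap_Cmp fmap_Idt)
    qed
    fix b f assume b: "b \<in> Ob A" and f: "f \<in> carrier (Mor A a b)"
    show "Cmp A (fob (comp_functor A G F) a) (fob (comp_functor A G F) b) (fob (id_functor A) b) (?x b)
        (fmap (comp_functor A G F) a b f) =
      Cmp A (fob (comp_functor A G F) a) (fob (id_functor A) a) (fob (id_functor A) b)
          (fmap (id_functor A) a b f) (?x a)"
      using a b f by (intro faithful[of "r (?f a)" b]) (simp_all add: fmap_Cmp)
  qed simp
  moreover have "natural_iso B B (comp_functor B F G) (id_functor B) (\<lambda>b\<in>Ob B. e b)"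
    unfolding natural_iso_iff using e by auto
  ultimately show ?thesis
    unfolding cat_equivalence_def using F G.is_functor_axioms by blast
qed

section \<open>The underlying Pi-category\<close>

definition zeta_inv :: "('o, 'k, 'm) pi_supercat \<Rightarrow> 'o \<Rightarrow> 'm" where
  "zeta_inv P a = inv_mor (scat P) (fob (sshift P) a) a (zeta P a)"

context pi_supercategory
begin

context
  fixes a assumes a: "a \<in> Ob C"
begin

lemma zeta_closed [simp]: "zeta P a \<in> carrier (Mor C (s a) a)"
  using S.homog_carrier[OF _ _ zeta_homog] a by simp

lemma zeta_inv_homog [simp]: "zeta_inv P a \<in> homog (Mor C a (s a)) 1"
  unfolding zeta_inv_def using a zeta_iso by (simp add: S.inv_mor_homog)

lemma zeta_inv_closed [simp]: "zeta_inv P a \<in> carrier (Mor C a (s a))"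
  using S.homog_carrier[OF _ _ zeta_inv_homog] a by simp

lemma zeta_inv_left [simp]:
  "Cmp C (s a) a (s a) (zeta_inv P a) (zeta P a) = Idt C (s a)"
  unfolding zeta_inv_def using a zeta_iso by (simp add: S.inv_mor_left)

lemma zeta_inv_right [simp]:
  "Cmp C a (s a) a (zeta P a) (zeta_inv P a) = Idt C a"
  unfolding zeta_inv_def using a zeta_iso by (simp add: S.inv_mor_right)

lemma zeta_cancel [simp]:
  assumes "b \<in> Ob C" "f \<in> carrier (Mor C b a)"
  shows "Cmp C b (s a) a (zeta P a) (Cmp C b a (s a) (zeta_inv P a) f) = f"
  using a assms S.Cmp_assoc[of b a "s a" a f "zeta_inv P a" "zeta P a"] by (simp add: S.Idt_left)

lemma zeta_inv_iso: "iso_mor C a (s a) (zeta_inv P a)"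
  unfolding zeta_inv_def using a zeta_iso by (simp add: S.iso_mor_inv)

end

text \<open>The naturality square of \<zeta> at the odd morphism \<zeta> carries a sign; cancelling
  the outer \<zeta> leaves this equation.\<close>

lemma fmap_zeta:
  assumes a: "a \<in> Ob C"
  shows "sm (s a) a (zeta P a) =
    \<ominus>\<^bsub>Mor C (s (s a)) (s a)\<^esub> zeta P (s a)"
proof (rule S.cancel_left[OF _ _ _ _ _ zeta_iso[OF a]])
  show "Cmp C (s (s a)) (s a) a (zeta P a)
      (sm (s a) a (zeta P a)) =
    Cmp C (s (s a)) (s a) a (zeta P a)
      (\<ominus>\<^bsub>Mor C (s (s a)) (s a)\<^esub> zeta P (s a))"
    using a zeta_natural[OF _ a zeta_homog[OF a]] by (simp add: S.Cmp_neg_right koszul_def)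
qed (use a in simp_all)

lemma zeta_inv_natural:
  assumes "a \<in> Ob C" "b \<in> Ob C" "f \<in> homog (Mor C a b) 0"
  shows "Cmp C a (s a) (s b) (sm a b f) (zeta_inv P a) =
    Cmp C a b (s b) (zeta_inv P b) f"
  using zeta_pow_inv_natural[OF assms, of 1]
  by (simp add: zeta_pow_inv_def zeta_pow_def[abs_def] shift_pow_def zeta_inv_def)

end

lemma underlying_cat_simps [simp]:
  "Ob (underlying_cat A) = Ob A"
  "carrier (Mor (underlying_cat A) a b) = homog (Mor A a b) 0"
  "add (Mor (underlying_cat A) a b) = add (Mor A a b)"
  "zero (Mor (underlying_cat A) a b) = zero (Mor A a b)"
  "smult (Mor (underlying_cat A) a b) = smult (Mor A a b)"
  "Cmp (underlying_cat A) = Cmp A"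
  "Idt (underlying_cat A) = Idt A"
  by (simp_all add: underlying_cat_def module.defs)

lemma underlying_map_simps [simp]:
  "fob (underlying_map A F) = fob F"
  "\<lbrakk>a \<in> Ob A; b \<in> Ob A; f \<in> homog (Mor A a b) 0\<rbrakk> \<Longrightarrow> fmap (underlying_map A F) a b f = fmap F a b f"
  by (simp_all add: underlying_map_def)

lemma linear_category_underlying_cat:
  assumes "supercategory K A"
  shows "linear_category K (underlying_cat A)"
proof -
  interpret supercategory K A by fact
  have m: "module K (Mor (underlying_cat A) a b)" if ab: "a \<in> Ob A" "b \<in> Ob A" for a b
  proof -
    interpret M: superspace K "Mor A a b" using ab by (rule Mor_superspace)
    note c = M.homog_carrier[of _ 0]
    have "\<exists>y\<in>homog (Mor A a b) 0. x \<oplus>\<^bsub>Mor A a b\<^esub> y = \<zero>\<^bsub>Mor A a b\<^esub>" if "x \<in> homog (Mor A a b) 0" for x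
      by (rule bexI[of _ "\<ominus>\<^bsub>Mor A a b\<^esub> x"]) (simp_all add: that c M.r_neg)
    then show ?thesis
      by (intro moduleI[OF is_cring]) (auto intro!: abelian_groupI simp: c M.smult_l_distr M.smult_r_distr
          M.smult_assoc1
          M.a_ac)
  qed
  have "Cmp A a b c g f \<in> homog (Mor A a c) 0" if "a \<in> Ob A" "b \<in> Ob A" "c \<in> Ob A"
    "f \<in> homog (Mor A a b) 0" "g \<in> homog (Mor A b c) 0" for a b c f g
    using Cmp_even[OF that] by simp
  then show ?thesis
    by (intro linear_category.intro category.intro linear_category_axioms.intro field_axioms)
      (simp_all add: m Idt_even Idt_left Idt_right Cmp_assoc Cmp_add_left Cmp_add_right Cmp_smult_left
        Cmp_smult_right homog_carrier)
qed

text \<open>The inverse of an even isomorphism is even by \<open>inv_mor_homog\<close>, hence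
  survives in the underlying category.\<close>

lemma (in supercategory) iso_mor_underlying_iff:
  assumes "a \<in> Ob C" "b \<in> Ob C"
  shows "iso_mor (underlying_cat C) a b f \<longleftrightarrow> f \<in> homog (Mor C a b) 0 \<and> iso_mor C a b f"
proof
  assume "iso_mor (underlying_cat C) a b f"
  then show "f \<in> homog (Mor C a b) 0 \<and> iso_mor C a b f"
    using assms homog_carrier unfolding iso_mor_def by fastforce
next
  assume f: "f \<in> homog (Mor C a b) 0 \<and> iso_mor C a b f"
  then show "iso_mor (underlying_cat C) a b f"
    using inv_mor_homog[OF assms, of f 0] inv_mor_left[OF assms, of f] inv_mor_right[OF assms, of f]
    unfolding iso_mor_def by auto
qed

lemma linear_functor_underlying_map:
  assumes "superfunctor K A B F"
  shows "linear_functor K (underlying_cat A) (underlying_cat B) (underlying_map A F)"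
proof -
  interpret superfunctor K A B F by fact
  interpret UA: linear_category K "underlying_cat A" by (rule linear_category_underlying_cat) unfold_locales
  interpret UB: linear_category K "underlying_cat B" by (rule linear_category_underlying_cat) unfold_locales
  have "Cmp A a b c g f \<in> homog (Mor A a c) 0" if "a \<in> Ob A" "b \<in> Ob A" "c \<in> Ob A"
    "f \<in> homog (Mor A a b) 0" "g \<in> homog (Mor A b c) 0" for a b c f g
    using A.Cmp_even[OF that] by simp
  then show ?thesis
    using fob_closed
    by (intro linear_functor.intro is_functor.intro is_functor_axioms.intro linear_functor_axioms.intro
        UA.linear_category_axioms UB.linear_category_axioms UA.category_axioms UB.category_axioms)
      (simp_all add: A.Idt_even fmap_Idt fmap_Cmp fmap_add fmap_smult A.homog_carrier,
       auto simp: underlying_map_def fmap_even)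
qed

lemma underlying_simps [simp]:
  "lcat (underlying P) = underlying_cat (scat P)"
  "lshift (underlying P) = underlying_map (scat P) (sshift P)"
  "a \<in> Ob (scat P) \<Longrightarrow> xi (underlying P) a =
    Cmp (scat P) (fob (sshift P) (fob (sshift P) a)) (fob (sshift P) a) a (zeta P a)
      (fmap (sshift P) (fob (sshift P) a) a (zeta P a))"
  by (simp_all add: underlying_def hcomp_def)

context pi_supercategory
begin

text \<open>Replacing \<Pi> \<zeta> by \<open>fmap_zeta\<close> exhibits \<xi> as a product of two
  odd morphisms up to sign, from which its evenness is immediate.\<close>

lemma xi_underlying:
  "a \<in> Ob C \<Longrightarrow> xi (underlying P) a = \<ominus>\<^bsub>Mor C (s (s a)) a\<^esub>
    Cmp C (s (s a)) (s a) a (zeta P a) (zeta P (s a))"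
  by (simp add: fmap_zeta S.Cmp_neg_right)

lemma xi_underlying_homog:
  assumes "a \<in> Ob C"
  shows "xi (underlying P) a \<in> homog (Mor C (s (s a)) a) 0"
  unfolding xi_underlying[OF assms]
  using S.Cmp_even[OF _ _ _ zeta_homog[of "s a"] zeta_homog[OF assms]] assms by simp

lemma pi_category_underlying: "pi_category K (underlying P)"
proof (rule pi_categoryI, unfold underlying_simps(1,2) underlying_map_simps(1) underlying_cat_simps)
  show "linear_category K (underlying_cat C)"
    by (simp add: linear_category_underlying_cat scat_supercategory)
  show "linear_functor K (underlying_cat C) (underlying_cat C) (underlying_map C (sshift P))"
    by (simp add: linear_functor_underlying_map sshift_superfunctor)
  show "xi (underlying P) \<in> extensional (Ob C)"
    by (simp add: underlying_def hcomp_def)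
next
  fix a assume a: "a \<in> Ob C"
  have "iso_mor C (s (s a)) a (xi (underlying P) a)"
    using a by (auto intro!: S.iso_mor_Cmp Sh.fmap_iso zeta_iso)
  then show "iso_mor (underlying_cat C) (s (s a)) a (xi (underlying P) a)"
    using a xi_underlying_homog[OF a] by (simp add: S.iso_mor_underlying_iff del: underlying_simps(3))
  \<comment> \<open>Applying \<Pi> to the two factors of \<xi> gives one minus sign each by
    \<open>fmap_zeta\<close>, and the two signs cancel.\<close>
  have "sm (s (s a)) a (xi (underlying P) a) = xi (underlying P) (s a)"
    using a by (simp add: Sh.fmap_Cmp fmap_zeta Sh.fmap_neg S.Cmp_neg_left S.Cmp_neg_right S.Cmp_closed)
  then show "fmap (underlying_map C (sshift P)) (s (s a)) a (xi (underlying P) a) = xi (underlying P) (s a)"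
    using a xi_underlying_homog[OF a] by (simp del: underlying_simps(3))
  fix b f assume b: "b \<in> Ob C" and f: "f \<in> homog (Mor C a b) 0"
  note fc = S.homog_carrier[OF a b f]
  let ?C = "Cmp C" and sm = "fmap (sshift P)"
  have z: "Cmp C (s a) (s b) b (zeta P b) (sm a b f) = Cmp C (s a) a b f (zeta P a)"
    using zeta_natural[OF a b f] by simp
  have "Cmp C (s (s a)) (s (s b)) b (xi (underlying P) b) (sm (s a) (s b) (sm a b f)) =
      Cmp C (s (s a)) (s b) b (zeta P b) (sm (s a) b (Cmp C (s a) (s b) b (zeta P b) (sm a b f)))"
    using a b fc by (simp add: S.Cmp_assoc Sh.fmap_Cmp)
  also have "\<dots> = Cmp C (s (s a)) (s a) b (Cmp C (s a) (s b) b (zeta P b) (sm a b f)) (sm (s a) a (zeta P a))"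
    unfolding z using a b fc by (simp add: S.Cmp_assoc[symmetric] Sh.fmap_Cmp z)
  also have "\<dots> = Cmp C (s (s a)) a b f (xi (underlying P) a)"
    unfolding z using a b fc by (simp add: S.Cmp_assoc)
  finally show "Cmp C (s (s a)) (s (s b)) b (xi (underlying P) b)
      (fmap (underlying_map C (sshift P)) (s a) (s b) (fmap (underlying_map C (sshift P)) a b f)) =
    Cmp C (s (s a)) a b f (xi (underlying P) a)"
    using a b f by (simp add: Sh.fmap_even)
qed

end

section \<open>The structure isomorphism carried by a superfunctor\<close>

locale pi_supercategory_functor = P: pi_supercategory K P + Q: pi_supercategory K Q + F: superfunctor K
    "scat P" "scat Q" F
  for K :: "'k ring" and P :: "('o, 'k, 'm) pi_supercat" and Q :: "('p, 'k, 'n) pi_supercat" and F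
begin

abbreviation (input) "s \<equiv> fob (sshift P)"
abbreviation (input) "t \<equiv> fob (sshift Q)"

text \<open>The minus sign in the definition of \<beta> cancels the one from moving the odd \<zeta>
  past F of the inverse of \<zeta>, which is odd as well. The sign-free form that remains is the one
  used in computations.\<close>

lemma beta_eq:
  assumes a: "a \<in> Ob (scat P)"
  shows "beta P Q F a =
    Cmp (scat Q) (t (fob F a)) (fob F a) (fob F (s a)) (fmap F a (s a) (zeta_inv P a)) (zeta Q (fob F a))"
proof -
  have "fmap F a (s a) (zeta_inv P a) \<in> homog (Mor (scat Q) (fob F a) (fob F (s a))) 1"
    using a by (simp add: F.fmap_even)
  from Q.zeta_natural[OF _ _ this] show ?thesis
    using a by (simp add: beta_def hcomp_through_def hcomp_def id_trans_def inv_trans_def Q.S.Idt_left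
        koszul_def Q.S.Cmp_closed flip: zeta_inv_def)
qed

lemma beta_homog:
  assumes "a \<in> Ob (scat P)"
  shows "beta P Q F a \<in> homog (Mor (scat Q) (t (fob F a)) (fob F (s a))) 0"
  using assms Q.S.Cmp_even[of "t (fob F a)" "fob F a" "fob F (s a)" "zeta Q (fob F a)" 1
      "fmap F a (s a) (zeta_inv P a)" 1]
  by (simp add: beta_eq F.fmap_even)

text \<open>Even morphisms pass both factors of \<beta> without sign, which gives naturality. In the
  coherence law two signs meet: one from moving \<zeta> past F of the inverse of \<zeta>, and one
  because \<xi> composed with the inverse of \<zeta> at \<Pi> a is - \<zeta>. They cancel.\<close>

lemma pi_functor_underlying: "pi_functor K (underlying P) (underlying Q) (underlying_map (scat P) F)
    (beta P Q F)"
  unfolding pi_functor_eq_laws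
proof (intro pi_functor_laws.intro pi_functor_laws_axioms.intro,
    unfold underlying_simps(1,2) underlying_map_simps(1) underlying_cat_simps)
  show "pi_category K (underlying P)" "pi_category K (underlying Q)"
    by (rule P.pi_category_underlying Q.pi_category_underlying)+
  show "linear_functor K (underlying_cat (scat P)) (underlying_cat (scat Q)) (underlying_map (scat P) F)"
    by (rule linear_functor_underlying_map) (rule F.superfunctor_axioms)
  show "beta P Q F \<in> extensional (Ob (scat P))" by (simp add: beta_def)
next
  let ?C = "Cmp (scat Q)" and ?F = "fmap F" and ?f = "fob F" and ?S = "fmap (sshift Q)"
    and ?UF = "fmap (underlying_map (scat P) F)" and ?US = "fmap (underlying_map (scat Q) (sshift Q))"
  fix a assume a: "a \<in> Ob (scat P)"
  have "iso_mor (scat Q) (t (?f a)) (?f (s a)) (beta P Q F a)"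
    using a by (auto simp: beta_eq intro!: Q.S.iso_mor_Cmp F.fmap_iso Q.zeta_iso P.zeta_inv_iso)
  then show "iso_mor (underlying_cat (scat Q)) (t (?f a)) (?f (s a)) (beta P Q F a)"
    using a beta_homog[OF a] by (simp add: Q.S.iso_mor_underlying_iff)
  {
    fix b f assume b: "b \<in> Ob (scat P)" and f: "f \<in> homog (Mor (scat P) a b) 0"
    note fc = P.S.homog_carrier[OF a b f]
    have z: "?C (t (?f a)) (t (?f b)) (?f b) (zeta Q (?f b)) (?S (?f a) (?f b) (?F a b f)) =
        ?C (t (?f a)) (?f a) (?f b) (?F a b f) (zeta Q (?f a))"
      using a b f Q.zeta_natural[of "?f a" "?f b" "?F a b f" 0] by (simp add: F.fmap_even)
    have "?C (t (?f a)) (t (?f b)) (?f (s b)) (beta P Q F b) (?S (?f a) (?f b) (?F a b f)) =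
        ?C (t (?f a)) (?f a) (?f (s b)) (?F a (s b) (Cmp (scat P) a b (s b) (zeta_inv P b) f)) (zeta Q (?f a))"
      using a b fc by (simp add: beta_eq Q.S.Cmp_assoc z F.fmap_Cmp)
    also have "\<dots> = ?C (t (?f a)) (?f (s a)) (?f (s b)) (?F (s a) (s b) (fmap (sshift P) a b f)) (beta P Q F a)"
      unfolding P.zeta_inv_natural[OF a b f, symmetric]
      using a b fc by (simp add: beta_eq Q.S.Cmp_assoc F.fmap_Cmp)
    finally show "?C (t (?f a)) (t (?f b)) (?f (s b)) (beta P Q F b) (?US (?f a) (?f b) (?UF a b f)) =
      ?C (t (?f a)) (?f (s a)) (?f (s b)) (?UF (s a) (s b) (fmap (underlying_map (scat P) (sshift P)) a b
          f)) (beta P Q F a)"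
      using a b f by (simp add: F.fmap_even P.Sh.fmap_even)
  }
  let ?tt = "t (t (?f a))" and ?xi = "xi (underlying P) a" and ?xiF = "xi (underlying Q) (?f a)"
  have i: "?F a (s a) (zeta_inv P a) \<in> homog (Mor (scat Q) (?f a) (?f (s a))) 1"
    using a by (simp add: F.fmap_even)
  have z: "?C (t (?f a)) (t (?f (s a))) (?f (s a)) (zeta Q (?f (s a)))
      (?S (?f a) (?f (s a)) (?F a (s a) (zeta_inv P a))) =
      \<ominus>\<^bsub>Mor (scat Q) (t (?f a)) (?f (s a))\<^esub> ?C (t (?f a)) (?f a) (?f (s a)) (?F a (s a) (zeta_inv P a))
          (zeta Q (?f a))"
    using a Q.zeta_natural[OF _ _ i] by (simp add: koszul_def)
  have x: "Cmp (scat P) (s a) (s (s a)) a ?xi (zeta_inv P (s a)) = \<ominus>\<^bsub>Mor (scat P) (s a) a\<^esub> zeta P a"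
    unfolding P.xi_underlying[OF a] using a by
        (simp add: P.S.Cmp_neg_left P.S.Cmp_closed P.S.Cmp_assoc P.S.Idt_right)
  have xc: "?xi \<in> carrier (Mor (scat P) (s (s a)) a)"
    using P.S.homog_carrier[OF _ _ P.xi_underlying_homog[OF a]] a by simp
  have "?C ?tt (?f (s (s a))) (?f a) (?F (s (s a)) a ?xi)
      (?C ?tt (t (?f (s a))) (?f (s (s a))) (beta P Q F (s a)) (?S (t (?f a)) (?f (s a)) (beta P Q F a))) =
    ?C ?tt (?f (s a)) (?f a) (?F (s a) a (Cmp (scat P) (s a) (s (s a)) a ?xi (zeta_inv P (s a))))
      (?C ?tt (t (?f a)) (?f (s a))
        (?C (t (?f a)) (t (?f (s a))) (?f (s a)) (zeta Q (?f (s a)))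
            (?S (?f a) (?f (s a)) (?F a (s a) (zeta_inv P a))))
        (?S (t (?f a)) (?f a) (zeta Q (?f a))))"
    using a xc by (simp add: beta_eq F.fmap_Cmp Q.Sh.fmap_Cmp Q.S.Cmp_assoc Q.S.Cmp_closed del:
        underlying_simps(3))
  also have "\<dots> = ?C ?tt (?f (s a)) (?f a) (?F (s a) a (zeta P a))
      (?C ?tt (?f a) (?f (s a)) (?F a (s a) (zeta_inv P a)) ?xiF)"
    unfolding x z using a by (simp add: F.fmap_neg Q.S.Cmp_neg_left Q.S.Cmp_neg_right Q.S.Cmp_assoc
        Q.S.Cmp_closed)
  also have "\<dots> = ?C ?tt (?f a) (?f a) (?C (?f a) (?f (s a)) (?f a) (?F (s a) a (zeta P a))
      (?F a (s a) (zeta_inv P a))) ?xiF"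
    using a by (simp add: Q.S.Cmp_assoc Q.S.Cmp_closed)
  also have "?C (?f a) (?f (s a)) (?f a) (?F (s a) a (zeta P a)) (?F a (s a) (zeta_inv P a))
      = Idt (scat Q) (?f a)"
    using a F.fmap_Cmp[of a "s a" a "zeta_inv P a" "zeta P a", symmetric] by (simp add: F.fmap_Idt)
  also have "?C ?tt (?f a) (?f a) \<dots> ?xiF = ?xiF"
    using a by (simp add: Q.S.Idt_left Q.S.Cmp_closed)
  finally show "?C ?tt (?f (s (s a))) (?f a) (?UF (s (s a)) a ?xi)
      (?C ?tt (t (?f (s a))) (?f (s (s a))) (beta P Q F (s a)) (?US (t (?f a)) (?f (s a)) (beta P Q F a)))
          = ?xiF"
    using a beta_homog[OF a] P.xi_underlying_homog[OF a] by (simp del: underlying_simps(3))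
qed

end

section \<open>Functoriality of the passage to underlying \<Pi>-categories\<close>

lemma underlying_map_id:
  assumes "supercategory K A"
  shows "underlying_map A (id_functor A) = id_functor (underlying_cat A)"
proof -
  interpret U: linear_functor K "underlying_cat A" "underlying_cat A" "underlying_map A (id_functor A)"
    by (intro linear_functor_underlying_map superfunctor_id) fact
  interpret supercategory K A by fact
  show ?thesis
    by (rule functor_eqI[OF U.is_functor_axioms is_functor_id[OF U.A.category_axioms]])
        (simp_all add: homog_carrier)
qed

lemma underlying_map_comp:
  assumes "superfunctor K A B F" "superfunctor K B C G"
  shows "underlying_map A (comp_functor A G F)
      = comp_functor (underlying_cat A) (underlying_map B G) (underlying_map A F)"
proof -
  interpret F: superfunctor K A B F by fact
  note e = linear_functor_underlying_map[OF superfunctor_comp[OF assms]]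
    linear_functor_comp[OF assms[THEN linear_functor_underlying_map]]
  note e' = e[THEN linear_functor.axioms(3)]
  show ?thesis
    by (rule functor_eqI[OF e']) (simp_all add: F.A.homog_carrier F.fmap_even)
qed

lemma is_functor_underlying: "is_functor (PiSCat K) (PiCat K) (underlying_functor K)"
proof (intro is_functor.intro is_functor_axioms.intro category_PiSCat category_PiCat)
  have l: "pi_supercategory_functor K P Q F"
    if "pi_supercategory K P" "pi_supercategory K Q" "superfunctor K (scat P) (scat Q) F" for P Q F
    using that by (simp add: pi_supercategory_functor_def)
  show "fob (underlying_functor K) \<in> Ob (PiSCat K) \<rightarrow>\<^sub>E Ob (PiCat K)"
    by (auto simp: underlying_functor_def pi_supercategory.pi_category_underlying)
  show "fmap (underlying_functor K) \<in> (\<Pi>\<^sub>E P\<in>Ob (PiSCat K). \<Pi>\<^sub>E Q\<in>Ob (PiSCat K). carrier (Mor (PiSCat K) P Q) \<rightarrow>\<^sub>E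
      carrier (Mor (PiCat K) (fob (underlying_functor K) P) (fob (underlying_functor K) Q)))"
    by (auto simp: underlying_functor_def pi_supercategory_functor.pi_functor_underlying[OF l])
  fix P assume "P \<in> Ob (PiSCat K)"
  then have P: "pi_supercategory K P" by simp
  then interpret P: pi_supercategory K P .
  have I: "superfunctor K (scat P) (scat P) (id_functor (scat P))"
    by (rule superfunctor_id) (rule P.scat_supercategory)
  have "beta P P (id_functor (scat P)) = id_trans (lcat (underlying P)) (lcat (underlying P))
      (lshift (underlying P))"
  proof (rule extensionalityI[of _ "Ob (scat P)"])
    show "beta P P (id_functor (scat P)) \<in> extensional (Ob (scat P))" by (simp add: beta_def)
  qed (simp_all add: id_trans_def pi_supercategory_functor.beta_eq[OF l[OF P P I]])
  then show "fmap (underlying_functor K) P P (Idt (PiSCat K) P) = Idt (PiCat K) (fob (underlying_functor K) P)"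
    using P I by (simp add: underlying_functor_def underlying_map_id[OF P.scat_supercategory])
  fix Q R F G assume "Q \<in> Ob (PiSCat K)" "R \<in> Ob (PiSCat K)" "F \<in> carrier (Mor (PiSCat K) P Q)" "G
      \<in> carrier (Mor (PiSCat K) Q R)"
  then have QR: "pi_supercategory K Q" "pi_supercategory K R" and F: "superfunctor K (scat P) (scat Q) F"
    and G: "superfunctor K (scat Q) (scat R) G" by simp_all
  interpret F: pi_supercategory_functor K P Q F using P QR F by (rule_tac l)
  interpret G: pi_supercategory_functor K Q R G using QR G by (rule_tac l)
  have GF: "superfunctor K (scat P) (scat R) (comp_functor (scat P) G F)" using F G by (rule superfunctor_comp)
  interpret GF: pi_supercategory_functor K P R "comp_functor (scat P) G F" using P QR GF by (rule_tac l)
  \<comment> \<open>In G \<beta>_F after \<beta>_G, the factor G \<zeta>_Q meets G of its inverse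
    and cancels. What is left is GF of the inverse of \<zeta>_P after \<zeta>_R.\<close>
  have "beta P R (comp_functor (scat P) G F) =
    comp_beta (underlying P) (underlying Q) (underlying R) (underlying_map (scat Q) G) (beta Q R G)
        (underlying_map (scat P) F) (beta P Q F)"
    (is "_ = ?r")
  proof (rule extensionalityI[of _ "Ob (scat P)"])
    show "beta P R (comp_functor (scat P) G F) \<in> extensional (Ob (scat P))" by (simp add: beta_def)
    show "?r \<in> extensional (Ob (scat P))"
      unfolding comp_beta_eq[OF F.pi_functor_underlying G.pi_functor_underlying] by simp
    fix a assume a: "a \<in> Ob (scat P)"
    let ?C = "Cmp (scat R)" and ?s = "fob (sshift P)" and ?t = "fob (sshift Q)" and ?u
        = "fob (sshift R)" and ?f = "fob F" and ?g = "fob G"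
    have "?C (?u (?g (?f a))) (?g (?t (?f a))) (?g (?f (?s a))) (fmap G (?t (?f a)) (?f (?s a))
        (beta P Q F a)) (beta Q R G (?f a)) =
      ?C (?u (?g (?f a))) (?g (?f a)) (?g (?f (?s a))) (fmap G (?f a) (?f (?s a))
        (Cmp (scat Q) (?f a) (?t (?f a)) (?f (?s a)) (beta P Q F a) (zeta_inv Q (?f a)))) (zeta R (?g (?f a)))"
      using a F.Q.S.homog_carrier[OF _ _ F.beta_homog[OF a]] by
          (simp add: G.beta_eq G.F.fmap_Cmp G.Q.S.Cmp_assoc)
    also have "Cmp (scat Q) (?f a) (?t (?f a)) (?f (?s a)) (beta P Q F a) (zeta_inv Q (?f a))
        = fmap F a (?s a) (zeta_inv P a)"
      using a by (simp add: F.beta_eq F.Q.S.Cmp_assoc F.Q.S.Idt_right)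
    finally show "beta P R (comp_functor (scat P) G F) a = ?r a"
      unfolding comp_beta_eq[OF F.pi_functor_underlying G.pi_functor_underlying]
      using a F.beta_homog[OF a] by (simp add: GF.beta_eq)
  qed
  then show "fmap (underlying_functor K) P R (Cmp (PiSCat K) P Q R G F) =
      Cmp (PiCat K) (fob (underlying_functor K) P) (fob (underlying_functor K) Q) (fob (underlying_functor K) R)
        (fmap (underlying_functor K) Q R G) (fmap (underlying_functor K) P Q F)"
    using P QR F G GF by (simp add: underlying_functor_def underlying_map_comp[OF F G])
qed

section \<open>Full faithfulness\<close>

text \<open>An odd morphism u is \<zeta> composed with an even morphism, namely u followed by the
  inverse of \<zeta>. So a superfunctor is determined by its even part and its values on \<zeta>,
  and these values are recovered from \<beta> by cancelling \<zeta> of the target and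
  inverting.\<close>

lemma underlying_faithful:
  assumes P: "pi_supercategory K P" and Q: "pi_supercategory K Q"
    and F: "superfunctor K (scat P) (scat Q) F" and G: "superfunctor K (scat P) (scat Q) G"
    and map: "underlying_map (scat P) F = underlying_map (scat P) G" and beta: "beta P Q F = beta P Q G"
  shows "F = G"
proof -
  interpret F: pi_supercategory_functor K P Q F using P Q F by (simp add: pi_supercategory_functor_def)
  interpret G: pi_supercategory_functor K P Q G using P Q G by (simp add: pi_supercategory_functor_def)
  let ?s = "fob (sshift P)" and ?f = "fob F"
  have fob: "fob G = fob F" using arg_cong[OF map, of fob] by simp
  have even: "fmap F a b f = fmap G a b f" if "a \<in> Ob (scat P)" "b \<in> Ob (scat P)" "f
      \<in> homog (Mor (scat P) a b) 0" for a b f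
    using that map underlying_map_simps(2)[OF that, of F] underlying_map_simps(2)[OF that, of G] by simp
  have inv: "fmap F a (?s a) (zeta_inv P a) = fmap G a (?s a) (zeta_inv P a)" if a: "a \<in> Ob (scat P)" for a
  proof (rule F.Q.S.cancel_right[OF _ _ _ _ _ F.Q.zeta_iso[of "?f a"]])
    show "Cmp (scat Q) (fob (sshift Q) (?f a)) (?f a) (?f (?s a)) (fmap F a (?s a) (zeta_inv P a))
        (zeta Q (?f a)) =
        Cmp (scat Q) (fob (sshift Q) (?f a)) (?f a) (?f (?s a)) (fmap G a (?s a) (zeta_inv P a))
            (zeta Q (?f a))"
      using F.beta_eq[OF a] G.beta_eq[OF a] beta fob by simp
    show "fmap G a (?s a) (zeta_inv P a) \<in> carrier (Mor (scat Q) (?f a) (?f (?s a)))"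
      using G.F.fmap_carrier[OF a _ F.P.zeta_inv_closed[OF a]] a fob by simp
  qed (use a in simp_all)
  have zeta: "fmap F (?s a) a (zeta P a) = fmap G (?s a) a (zeta P a)" if a: "a \<in> Ob (scat P)" for a
  proof -
    have *: "inv_mor (scat P) a (?s a) (zeta_inv P a) = zeta P a"
      using a by (intro F.P.S.inv_mor_equality) simp_all
    show ?thesis
      using F.F.fmap_iso(2)[OF a _ F.P.zeta_inv_iso[OF a]] G.F.fmap_iso(2)[OF a _ F.P.zeta_inv_iso[OF a]] a
          fob inv[OF a]
      by (simp add: *)
  qed
  show ?thesis
  proof (rule functor_eqI[OF F.F.is_functor_axioms G.F.is_functor_axioms])
    fix a b f assume a: "a \<in> Ob (scat P)" and b: "b \<in> Ob (scat P)" and f: "f \<in> carrier (Mor (scat P) a b)"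
    show "fmap F a b f = fmap G a b f"
      using f
    proof (induction rule: F.P.S.Mor_homog_induct[OF a b, consumes 1, case_names homog add])
      case (homog p u)
      show ?case
      proof (cases "p = 0")
        case True
        then show ?thesis using even a b homog by simp
      next
        case False
        then have u: "u \<in> homog (Mor (scat P) a b) 1" using homog by simp
        note uc = F.P.S.homog_carrier[OF a b u]
        let ?h = "Cmp (scat P) a b (?s b) (zeta_inv P b) u"
        have h: "?h \<in> homog (Mor (scat P) a (?s b)) 0"
          using F.P.S.Cmp_even[OF a b _ u F.P.zeta_inv_homog[OF b]] b by simp
        note hc = F.P.S.homog_carrier[OF a _ h]
        have "fmap F a b (Cmp (scat P) a (?s b) b (zeta P b) ?h)
            = fmap G a b (Cmp (scat P) a (?s b) b (zeta P b) ?h)"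
          using a b hc even[OF a _ h] zeta[OF b] fob
          by (simp add: F.F.fmap_Cmp[of a "?s b" b] G.F.fmap_Cmp[of a "?s b" b] del: F.P.zeta_cancel)
        then show ?thesis using a b uc by simp
      qed
    next
      case (add u w)
      then show ?case using a b fob by (simp add: F.F.fmap_add G.F.fmap_add)
    qed
  qed (simp add: fob)
qed

text \<open>An odd morphism \<open>f : a \<rightarrow> b\<close> is \<open>\<zeta>\<^sub>b\<close> composed with the even morphism \<open>\<zeta>\<^sub>b\<^sup>-\<^sup>1 f\<close>. So a superfunctor is
  determined on odd morphisms by its values \<open>\<theta>\<^sub>b\<close> on the \<open>\<zeta>\<^sub>b\<close>, and \<open>\<beta>\<close> forces \<open>\<theta>\<^sub>b = \<zeta>\<^sub>F\<^sub>b \<beta>\<^sub>b\<^sup>-\<^sup>1\<close>.\<close>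

locale underlying_pi_functor = P: pi_supercategory K P + Q: pi_supercategory K Q
  for K :: "'k ring" and P :: "('o, 'k, 'm) pi_supercat" and Q :: "('p, 'k, 'n) pi_supercat" +
  fixes F \<beta>
  assumes pi_functor: "pi_functor K (underlying P) (underlying Q) F \<beta>"
begin

sublocale B: pi_functor_laws K "underlying P" "underlying Q" F \<beta>
  using pi_functor by (simp add: pi_functor_eq_laws)

abbreviation (input) "A \<equiv> scat P"
abbreviation (input) "B \<equiv> scat Q"
abbreviation (input) "s \<equiv> fob (sshift P)"
abbreviation (input) "t \<equiv> fob (sshift Q)"
abbreviation (input) "fo \<equiv> fob F"

definition "theta b = Cmp B (fo (s b)) (t (fo b)) (fo b) (zeta Q (fo b)) (inv_mor B (t (fo b)) (fo (s b))
    (\<beta> b))"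

definition lifted :: "('o, 'm, 'p, 'n) fctr" where
  "lifted = \<lparr>fob = fo, fmap = (\<lambda>a\<in>Ob A. \<lambda>b\<in>Ob A. \<lambda>f\<in>carrier (Mor A a b).
    fmap F a b (component (Mor A a b) 0 f) \<oplus>\<^bsub>Mor B (fo a) (fo b)\<^esub>
      Cmp B (fo a) (fo (s b)) (fo b) (theta b)
        (fmap F a (s b) (Cmp A a b (s b) (zeta_inv P b) (component (Mor A a b) 1 f))))\<rparr>"

lemma fo_Ob [simp]: "a \<in> Ob A \<Longrightarrow> fo a \<in> Ob B"
  using B.F.fob_Ob by simp

lemma F_homog:
  "\<lbrakk>a \<in> Ob A; b \<in> Ob A; f \<in> homog (Mor A a b) 0\<rbrakk> \<Longrightarrow> fmap F a b f \<in> homog (Mor B (fo a) (fo b)) 0"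
  using B.F.fmap_carrier by simp

lemma F_closed [simp]:
  "\<lbrakk>a \<in> Ob A; b \<in> Ob A; f \<in> homog (Mor A a b) 0\<rbrakk> \<Longrightarrow> fmap F a b f \<in> carrier (Mor B (fo a) (fo b))"
  by (rule Q.S.homog_carrier[OF _ _ F_homog]) simp_all

lemma F_Cmp:
  "\<lbrakk>a \<in> Ob A; b \<in> Ob A; c \<in> Ob A; f \<in> homog (Mor A a b) 0; g \<in> homog (Mor A b c) 0\<rbrakk>
    \<Longrightarrow> fmap F a c (Cmp A a b c g f) = Cmp B (fo a) (fo b) (fo c) (fmap F b c g) (fmap F a b f)"
  using B.F.fmap_Cmp by simp

lemma F_add:
  "\<lbrakk>a \<in> Ob A; b \<in> Ob A; f \<in> homog (Mor A a b) 0; g \<in> homog (Mor A a b) 0\<rbrakk>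
    \<Longrightarrow> fmap F a b (f \<oplus>\<^bsub>Mor A a b\<^esub> g) = fmap F a b f \<oplus>\<^bsub>Mor B (fo a) (fo b)\<^esub> fmap F a b g"
  using B.F.fmap_add by simp

lemma F_smult:
  "\<lbrakk>a \<in> Ob A; b \<in> Ob A; r \<in> carrier K; f \<in> homog (Mor A a b) 0\<rbrakk>
    \<Longrightarrow> fmap F a b (r \<odot>\<^bsub>Mor A a b\<^esub> f) = r \<odot>\<^bsub>Mor B (fo a) (fo b)\<^esub> fmap F a b f"
  using B.F.fmap_smult by simp

lemma F_zero: "\<lbrakk>a \<in> Ob A; b \<in> Ob A\<rbrakk> \<Longrightarrow> fmap F a b \<zero>\<^bsub>Mor A a b\<^esub> = \<zero>\<^bsub>Mor B (fo a) (fo b)\<^esub>"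
  using F_smult[of a b "\<zero>\<^bsub>K\<^esub>" "\<zero>\<^bsub>Mor A a b\<^esub>"]
  by (simp flip: P.S.Mor_null_smult Q.S.Mor_null_smult)

lemma F_neg:
  "\<lbrakk>a \<in> Ob A; b \<in> Ob A; f \<in> homog (Mor A a b) 0\<rbrakk>
    \<Longrightarrow> fmap F a b (\<ominus>\<^bsub>Mor A a b\<^esub> f) = \<ominus>\<^bsub>Mor B (fo a) (fo b)\<^esub> fmap F a b f"
  by (simp add: P.S.Mor_neg_smult P.S.homog_carrier Q.S.Mor_neg_smult F_smult)

context
  fixes b assumes b: "b \<in> Ob A"
begin

lemma beta_homog: "\<beta> b \<in> homog (Mor B (t (fo b)) (fo (s b))) 0"
  using B.beta_closed b by simp

lemma beta_closed [simp]: "\<beta> b \<in> carrier (Mor B (t (fo b)) (fo (s b)))"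
  using Q.S.homog_carrier[OF _ _ beta_homog] b by simp

lemma beta_iso: "iso_mor B (t (fo b)) (fo (s b)) (\<beta> b)"
  using B.beta_iso_mor b by (simp add: Q.S.iso_mor_underlying_iff)

lemma beta_inv_homog: "inv_mor B (t (fo b)) (fo (s b)) (\<beta> b) \<in> homog (Mor B (fo (s b)) (t (fo b))) 0"
  using b beta_homog beta_iso by (intro Q.S.inv_mor_homog) simp_all

lemma beta_inv_closed [simp]: "inv_mor B (t (fo b)) (fo (s b)) (\<beta> b) \<in> carrier (Mor B (fo (s b)) (t (fo b)))"
  using Q.S.homog_carrier[OF _ _ beta_inv_homog] b by simp

lemma theta_homog: "theta b \<in> homog (Mor B (fo (s b)) (fo b)) 1"
  unfolding theta_def
  using Q.S.Cmp_even[OF _ _ _ beta_inv_homog Q.zeta_homog] b by simp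

lemma theta_closed [simp]: "theta b \<in> carrier (Mor B (fo (s b)) (fo b))"
  using Q.S.homog_carrier[OF _ _ theta_homog] b by simp

lemma theta_beta: "Cmp B (t (fo b)) (fo (s b)) (fo b) (theta b) (\<beta> b) = zeta Q (fo b)"
  unfolding theta_def using b
  by (simp add: Q.S.Cmp_assoc Q.S.inv_mor_left beta_iso Q.S.Idt_right)

end

lemma beta_natural:
  assumes "a \<in> Ob A" "b \<in> Ob A" "f \<in> homog (Mor A a b) 0"
  shows "Cmp B (t (fo a)) (t (fo b)) (fo (s b)) (\<beta> b) (fmap (sshift Q) (fo a) (fo b) (fmap F a b f)) =
    Cmp B (t (fo a)) (fo (s a)) (fo (s b)) (fmap F (s a) (s b) (fmap (sshift P) a b f)) (\<beta> a)"
  using B.beta_natural[of a b f] assms by (simp add: F_homog)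

lemma beta_xi:
  assumes "a \<in> Ob A"
  shows "Cmp B (t (t (fo a))) (fo (s (s a))) (fo a) (fmap F (s (s a)) a (xi (underlying P) a))
      (Cmp B (t (t (fo a))) (t (fo (s a))) (fo (s (s a))) (\<beta> (s a)) (fmap (sshift Q) (t (fo a)) (fo (s a))
          (\<beta> a))) =
    xi (underlying Q) (fo a)"
  using B.beta_xi[of a] assms by (simp add: beta_homog)

text \<open>By construction \<open>\<theta> \<beta> = \<zeta>\<close>; the next two identities can therefore be checked after composition with
  components of \<open>\<beta>\<close>.\<close>

lemma theta_natural:
  assumes a: "a \<in> Ob A" and b: "b \<in> Ob A" and f: "f \<in> homog (Mor A a b) 0"
  shows "Cmp B (fo (s a)) (fo (s b)) (fo b) (theta b) (fmap F (s a) (s b) (fmap (sshift P) a b f)) =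
    Cmp B (fo (s a)) (fo a) (fo b) (fmap F a b f) (theta a)"
proof (rule Q.S.cancel_right[OF _ _ _ _ _ beta_iso[OF a]])
  note [simp] = P.Sh.fmap_even[OF a b f]
  have z: "Cmp B (t (fo a)) (t (fo b)) (fo b) (zeta Q (fo b)) (fmap (sshift Q) (fo a) (fo b) (fmap F a b f)) =
      Cmp B (t (fo a)) (fo a) (fo b) (fmap F a b f) (zeta Q (fo a))"
    using Q.zeta_natural[OF _ _ F_homog[OF a b f]] a b by simp
  show "Cmp B (t (fo a)) (fo (s a)) (fo b) (Cmp B (fo (s a)) (fo (s b)) (fo b) (theta b)
      (fmap F (s a) (s b) (fmap (sshift P) a b f))) (\<beta> a) =
    Cmp B (t (fo a)) (fo (s a)) (fo b) (Cmp B (fo (s a)) (fo a) (fo b) (fmap F a b f) (theta a)) (\<beta> a)"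
    using a b f by (simp add: Q.S.Cmp_assoc theta_beta flip: beta_natural z)
      (simp add: Q.S.Cmp_assoc[symmetric] theta_beta)
qed (use a b f in \<open>simp_all add: Q.S.Cmp_closed P.Sh.fmap_even\<close>)

lemma theta_theta:
  assumes a: "a \<in> Ob A"
  shows "Cmp B (fo (s (s a))) (fo (s a)) (fo a) (theta a) (theta (s a)) =
    \<ominus>\<^bsub>Mor B (fo (s (s a))) (fo a)\<^esub> fmap F (s (s a)) a (xi (underlying P) a)"
proof -
  let ?bb = "Cmp B (t (t (fo a))) (t (fo (s a))) (fo (s (s a))) (\<beta> (s a))
      (fmap (sshift Q) (t (fo a)) (fo (s a)) (\<beta> a))"
  have xF: "fmap F (s (s a)) a (xi (underlying P) a) \<in> carrier (Mor B (fo (s (s a))) (fo a))"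
    using a P.xi_underlying_homog[OF a] by (simp del: underlying_simps(3))
  have iso: "iso_mor B (t (t (fo a))) (fo (s (s a))) ?bb"
    using a by (auto intro!: Q.S.iso_mor_Cmp Q.Sh.fmap_iso beta_iso)
  have z: "Cmp B (t (t (fo a))) (t (fo (s a))) (fo (s a)) (zeta Q (fo (s a)))
      (fmap (sshift Q) (t (fo a)) (fo (s a)) (\<beta> a)) =
      Cmp B (t (t (fo a))) (t (fo a)) (fo (s a)) (\<beta> a) (zeta Q (t (fo a)))"
    using a Q.zeta_natural[OF _ _ beta_homog[OF a]] by simp
  have "Cmp B (t (t (fo a))) (fo (s (s a))) (fo a) (Cmp B (fo (s (s a))) (fo (s a)) (fo a) (theta a)
      (theta (s a))) ?bb =
    Cmp B (t (t (fo a))) (fo (s a)) (fo a) (theta a) (Cmp B (t (t (fo a))) (t (fo (s a))) (fo (s a))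
      (Cmp B (t (fo (s a))) (fo (s (s a))) (fo (s a)) (theta (s a)) (\<beta> (s a)))
      (fmap (sshift Q) (t (fo a)) (fo (s a)) (\<beta> a)))"
    using a by (simp add: Q.S.Cmp_assoc Q.S.Cmp_closed)
  also have "\<dots> = Cmp B (t (t (fo a))) (fo (s a)) (fo a) (theta a)
      (Cmp B (t (t (fo a))) (t (fo a)) (fo (s a)) (\<beta> a) (zeta Q (t (fo a))))"
    using a by (simp add: theta_beta z)
  also have "\<dots> = Cmp B (t (t (fo a))) (t (fo a)) (fo a)
      (Cmp B (t (fo a)) (fo (s a)) (fo a) (theta a) (\<beta> a)) (zeta Q (t (fo a)))"
    using a by (simp add: Q.S.Cmp_assoc)
  also have "\<dots> = \<ominus>\<^bsub>Mor B (t (t (fo a))) (fo a)\<^esub> xi (underlying Q) (fo a)"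
    using a by (simp add: theta_beta Q.xi_underlying Q.S.Cmp_closed del: underlying_simps(3))
  also have "\<dots> = Cmp B (t (t (fo a))) (fo (s (s a))) (fo a)
      (\<ominus>\<^bsub>Mor B (fo (s (s a))) (fo a)\<^esub> fmap F (s (s a)) a (xi (underlying P) a)) ?bb"
    unfolding beta_xi[OF a, symmetric] using a xF
    by (simp add: Q.S.Cmp_neg_left Q.S.Cmp_closed del: underlying_simps(3))
  finally show ?thesis
    using a xF iso
    by - (rule Q.S.cancel_right[of "t (t (fo a))" "fo (s (s a))" "fo a" _ _ ?bb],
      simp_all add: Q.S.Cmp_closed del: underlying_simps(3))
qed

lemma lifted_even:
  assumes "a \<in> Ob A" "b \<in> Ob A" "f \<in> homog (Mor A a b) 0"
  shows "fmap lifted a b f = fmap F a b f"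
  using assms P.S.homog_carrier[OF assms]
  by (simp add: lifted_def P.S.Mor_component_of_homog F_zero)

lemma lifted_odd:
  assumes "a \<in> Ob A" "b \<in> Ob A" "f \<in> homog (Mor A a b) 1"
  shows "fmap lifted a b f = Cmp B (fo a) (fo (s b)) (fo b) (theta b)
      (fmap F a (s b) (Cmp A a b (s b) (zeta_inv P b) f))"
  using assms P.S.homog_carrier[OF assms] P.S.Cmp_even[OF assms(1,2) _ assms(3) P.zeta_inv_homog]
  by (simp add: lifted_def P.S.Mor_component_of_homog F_zero Q.S.Cmp_closed)

lemma zeta_inv_even:
  assumes "a \<in> Ob A" "b \<in> Ob A" "f \<in> homog (Mor A a b) 1"
  shows "Cmp A a b (s b) (zeta_inv P b) f \<in> homog (Mor A a (s b)) 0"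
  using P.S.Cmp_even[OF assms(1,2) _ assms(3) P.zeta_inv_homog] assms by simp

text \<open>For f even, functoriality of F and associativity suffice. For f odd,
  \<open>theta_natural\<close> moves \<theta> at b to the left of the image of g or of the even
  factor g' of g. If g is odd too, this produces \<theta> \<theta>, which \<open>theta_theta\<close>
  replaces by - F \<xi>, in accordance with g f = - \<xi> (\<Pi> g') f' in the source.\<close>

lemma lifted_Cmp:
  assumes a: "a \<in> Ob A" and b: "b \<in> Ob A" and c: "c \<in> Ob A"
    and f: "f \<in> homog (Mor A a b) p" and g: "g \<in> homog (Mor A b c) q"
  shows "fmap lifted a c (Cmp A a b c g f) = Cmp B (fo a) (fo b) (fo c) (fmap lifted b c g) (fmap lifted a b f)"
proof -
  note gf = P.S.Cmp_even[OF a b c f g]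
  note fc = P.S.homog_carrier[OF a b f] and gc = P.S.homog_carrier[OF b c g]
  let ?f = "Cmp A a b (s b) (zeta_inv P b) f" and ?g = "Cmp A b c (s c) (zeta_inv P c) g"
  let ?h = "fmap (sshift P) b (s c) ?g"
  show ?thesis
  proof (cases p; cases q)
    assume pq: "p = 0" "q = 0"
    then show ?thesis using a b c f g gf by (simp add: lifted_even F_Cmp)
  next
    assume pq: "p = 0" "q = 1"
    have "Cmp A a c (s c) (zeta_inv P c) (Cmp A a b c g f) = Cmp A a b (s c) ?g f"
      using a b c fc gc by (simp add: P.S.Cmp_assoc)
    then show ?thesis
      using a b c f g gf pq zeta_inv_even[OF b c, of g]
      by (simp add: lifted_even lifted_odd F_Cmp Q.S.Cmp_assoc)
  next
    assume pq: "p = 1" "q = 0"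
    have "Cmp A a c (s c) (zeta_inv P c) (Cmp A a b c g f)
        = Cmp A a b (s c) (Cmp A b c (s c) (zeta_inv P c) g) f"
      using a b c fc gc by (simp add: P.S.Cmp_assoc)
    also have "\<dots> = Cmp A a (s b) (s c) (fmap (sshift P) b c g) ?f"
      using a b c fc gc g pq by (simp add: P.zeta_inv_natural[symmetric] P.S.Cmp_assoc)
    finally have "fmap lifted a c (Cmp A a b c g f) = Cmp B (fo a) (fo (s c)) (fo c) (theta c)
        (Cmp B (fo a) (fo (s b)) (fo (s c)) (fmap F (s b) (s c) (fmap (sshift P) b c g)) (fmap F a (s b) ?f))"
      using a b c f g gf pq zeta_inv_even[OF a b, of f]
      by (simp add: lifted_odd F_Cmp P.Sh.fmap_even)
    also have "\<dots> = Cmp B (fo a) (fo (s b)) (fo c)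
        (Cmp B (fo (s b)) (fo b) (fo c) (fmap F b c g) (theta b)) (fmap F a (s b) ?f)"
      using a b c f g pq zeta_inv_even[OF a b, of f]
      by (simp add: theta_natural[symmetric] Q.S.Cmp_assoc P.Sh.fmap_even)
    finally show ?thesis
      using a b c f g pq zeta_inv_even[OF a b, of f] by (simp add: lifted_even lifted_odd Q.S.Cmp_assoc)
  next
    assume pq: "p = 1" "q = 1"
    have f1: "f \<in> homog (Mor A a b) 1" and g1: "g \<in> homog (Mor A b c) 1" and gf0: "Cmp A a b c g f
        \<in> homog (Mor A a c) 0"
      using f g gf pq by simp_all
    note fe = zeta_inv_even[OF a b f1] and ge = zeta_inv_even[OF b c g1]
    have he: "?h \<in> homog (Mor A (s b) (s (s c))) 0" using b c ge by (simp add: P.Sh.fmap_even)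
    note ec = P.S.homog_carrier[OF _ _ fe] P.S.homog_carrier[OF _ _ ge] P.S.homog_carrier[OF _ _ he]
    have xh: "xi (underlying P) c \<in> homog (Mor A (s (s c)) c) 0" using c by (rule P.xi_underlying_homog)
    have hf: "Cmp A a (s b) (s (s c)) ?h ?f \<in> homog (Mor A a (s (s c))) 0"
      using P.S.Cmp_even[OF a _ _ fe he] a b c by simp
    \<comment> \<open>In the source, \<Pi> g' passes the inverse of \<zeta> because g' is even. The
      two factors of \<xi> then cancel against two inverses of \<zeta>, which leaves - g f.\<close>
    have "Cmp A a (s b) (s (s c)) ?h ?f = Cmp A a b (s (s c)) (Cmp A b (s b) (s (s c)) ?h (zeta_inv P b)) f"
      using a b c fc ec by (simp add: P.S.Cmp_assoc)
    also have "\<dots> = Cmp A a (s c) (s (s c)) (zeta_inv P (s c)) (Cmp A a b (s c) ?g f)"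
      using a b c fc gc ec ge by (simp add: P.zeta_inv_natural P.S.Cmp_assoc)
    finally have "Cmp A a (s (s c)) c (xi (underlying P) c) (Cmp A a (s b) (s (s c)) ?h ?f) =
        \<ominus>\<^bsub>Mor A a c\<^esub> Cmp A a b c g f"
      unfolding P.xi_underlying[OF c]
      using a b c fc gc ec by (simp add: P.S.Cmp_neg_left P.S.Cmp_closed P.S.Cmp_assoc)
    then have "fmap F a c (\<ominus>\<^bsub>Mor A a c\<^esub> Cmp A a b c g f) = fmap F a c (Cmp A a (s (s c)) c (xi (underlying P) c)
        (Cmp A a (s b) (s (s c)) ?h ?f))" by simp
    also have "\<dots> = Cmp B (fo a) (fo (s (s c))) (fo c) (fmap F (s (s c)) c (xi (underlying P) c))
        (Cmp B (fo a) (fo (s b)) (fo (s (s c))) (fmap F (s b) (s (s c)) ?h) (fmap F a (s b) ?f))"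
      using a b c xh hf he fe by (simp add: F_Cmp del: underlying_simps(3))
    finally have 1: "\<ominus>\<^bsub>Mor B (fo a) (fo c)\<^esub> fmap F a c (Cmp A a b c g f) =
      Cmp B (fo a) (fo (s (s c))) (fo c) (fmap F (s (s c)) c (xi (underlying P) c))
        (Cmp B (fo a) (fo (s b)) (fo (s (s c))) (fmap F (s b) (s (s c)) ?h) (fmap F a (s b) ?f))"
      using a c gf0 by (simp add: F_neg)
    have "Cmp B (fo a) (fo b) (fo c) (fmap lifted b c g) (fmap lifted a b f) =
      Cmp B (fo a) (fo (s c)) (fo c) (theta c) (Cmp B (fo a) (fo (s b)) (fo (s c))
        (Cmp B (fo (s b)) (fo b) (fo (s c)) (fmap F b (s c) ?g) (theta b)) (fmap F a (s b) ?f))"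
      using a b c f1 g1 fe ge by (simp add: lifted_odd Q.S.Cmp_assoc Q.S.Cmp_closed)
    also have "\<dots> = Cmp B (fo a) (fo (s (s c))) (fo c) (Cmp B (fo (s (s c))) (fo (s c)) (fo c) (theta c)
        (theta (s c)))
        (Cmp B (fo a) (fo (s b)) (fo (s (s c))) (fmap F (s b) (s (s c)) ?h) (fmap F a (s b) ?f))"
      unfolding theta_natural[OF b P.Sh.fob_Ob[OF c] ge, symmetric]
      using a b c fe he by (simp add: Q.S.Cmp_assoc Q.S.Cmp_closed)
    also have "\<dots> = fmap F a c (Cmp A a b c g f)"
      unfolding theta_theta[OF c] using a b c fe he xh gf0
      by (simp add: Q.S.Cmp_neg_left Q.S.Cmp_closed 1[symmetric] del: underlying_simps(3))
    finally show ?thesis using a c gf0 by (simp add: lifted_even)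
  qed
qed

lemma superfunctor_lifted: "superfunctor K (scat P) (scat Q) lifted"
proof (rule superfunctorI)
  have ext: "fob F \<in> extensional (Ob A)" using B.F.fob_closed by (auto simp: PiE_iff)
  show "fob lifted \<in> Ob A \<rightarrow>\<^sub>E Ob B" using ext by (auto simp: lifted_def PiE_iff)
  have fl [simp]: "fob lifted = fo" by (simp add: lifted_def)
  show "fmap lifted \<in> (\<Pi>\<^sub>E a\<in>Ob A. \<Pi>\<^sub>E b\<in>Ob A. carrier (Mor A a b)
      \<rightarrow>\<^sub>E carrier (Mor B (fob lifted a) (fob lifted b)))"
    using zeta_inv_even by (auto simp: lifted_def intro!: Q.S.Mor_add_closed Q.S.Cmp_closed)
  show "fmap lifted a a (Idt A a) = Idt B (fob lifted a)" if "a \<in> Ob A" for a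
    using that B.F.fmap_Idt by (simp add: lifted_even P.S.Idt_even)
  show "fmap lifted a c (Cmp A a b c g f) = Cmp B (fob lifted a) (fob lifted b) (fob lifted c)
      (fmap lifted b c g) (fmap lifted a b f)"
    if "a \<in> Ob A" "b \<in> Ob A" "c \<in> Ob A" "f \<in> homog (Mor A a b) p" "g \<in> homog (Mor A b c) q" for a b c f g p q
    using lifted_Cmp[OF that] by simp
next
  fix a b p f assume a: "a \<in> Ob A" and b: "b \<in> Ob A" and f: "f \<in> homog (Mor A a b) p"
  show "fmap lifted a b f \<in> homog (Mor B (fob lifted a) (fob lifted b)) p"
  proof (cases p)
    assume "p = 0"
    then show ?thesis using a b f by (simp add: lifted_even F_homog) (simp add: lifted_def F_homog)
  next
    assume "p = 1"
    then have f: "f \<in> homog (Mor A a b) 1" using f by simp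
    have "Cmp B (fo a) (fo (s b)) (fo b) (theta b) (fmap F a (s b) (Cmp A a b (s b) (zeta_inv P b) f))
        \<in> homog (Mor B (fo a) (fo b)) (0 + 1)"
      using a b zeta_inv_even[OF a b f] by (intro Q.S.Cmp_even) (simp_all add: F_homog theta_homog)
    then show ?thesis using \<open>p = 1\<close> by (simp add: lifted_odd[OF a b f]) (simp add: lifted_def)
  qed
next
  fix a b f g assume a: "a \<in> Ob A" and b: "b \<in> Ob A" and f: "f \<in> carrier (Mor A a b)" and g: "g
      \<in> carrier (Mor A a b)"
  let ?z = "\<lambda>f. Cmp A a b (s b) (zeta_inv P b) (component (Mor A a b) 1 f)"
  interpret M: module K "Mor B (fo a) (fo b)" using a b by (simp add: Q.S.Mor_module)
  have z: "?z f \<in> homog (Mor A a (s b)) 0" "?z g \<in> homog (Mor A a (s b)) 0"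
    using a b f g by (simp_all add: zeta_inv_even)
  show "fmap lifted a b (f \<oplus>\<^bsub>Mor A a b\<^esub> g) = fmap lifted a b f
      \<oplus>\<^bsub>Mor B (fob lifted a) (fob lifted b)\<^esub> fmap lifted a b g"
    using a b f g z by (simp add: lifted_def P.S.Mor_component_add P.S.Cmp_add_right F_add Q.S.Cmp_add_right
        M.a_ac Q.S.Cmp_closed)
next
  fix a b r f assume a: "a \<in> Ob A" and b: "b \<in> Ob A" and r: "r \<in> carrier K" and f: "f \<in> carrier (Mor A a b)"
  let ?z = "Cmp A a b (s b) (zeta_inv P b) (component (Mor A a b) 1 f)"
  interpret M: module K "Mor B (fo a) (fo b)" using a b by (simp add: Q.S.Mor_module)
  have z: "?z \<in> homog (Mor A a (s b)) 0" using a b f by (simp add: zeta_inv_even)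
  show "fmap lifted a b (r \<odot>\<^bsub>Mor A a b\<^esub> f) = r \<odot>\<^bsub>Mor B (fob lifted a) (fob lifted b)\<^esub> fmap lifted a b f"
    using a b r f z by (simp add: lifted_def P.S.Mor_component_smult P.S.Cmp_smult_right F_smult
        Q.S.Cmp_smult_right
        M.smult_r_distr Q.S.Cmp_closed)
qed (rule P.scat_supercategory Q.scat_supercategory)+

lemma underlying_map_lifted: "underlying_map (scat P) lifted = F"
proof -
  note u = linear_functor_underlying_map[OF superfunctor_lifted, THEN linear_functor.axioms(3)]
  have F: "is_functor (underlying_cat A) (underlying_cat B) F" using B.F.is_functor_axioms by simp
  show ?thesis
    by (rule functor_eqI[OF u F]) (simp_all add: lifted_even, simp add: lifted_def)
qed

text \<open>The lift sends \<zeta> to \<theta>, hence the inverse of \<zeta> to the inverse of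
  \<theta>. Its structure isomorphism is therefore the inverse of \<theta> after \<zeta>, and this
  is \<beta> because \<theta> \<beta> = \<zeta>.\<close>

lemma beta_lifted: "beta P Q lifted = \<beta>"
proof (rule extensionalityI[of _ "Ob A"])
  interpret L: pi_supercategory_functor K P Q lifted
    by (simp add: pi_supercategory_functor_def P.pi_supercategory_axioms Q.pi_supercategory_axioms
        superfunctor_lifted)
  have fl [simp]: "fob lifted = fo" by (simp add: lifted_def)
  show "beta P Q lifted \<in> extensional (Ob A)" by (simp add: beta_def)
  show "\<beta> \<in> extensional (Ob A)" using B.beta_extensional by simp
  fix a assume a: "a \<in> Ob A"
  have th: "fmap lifted (s a) a (zeta P a) = theta a"
  proof -
    have "fmap F (s a) (s a) (Idt A (s a)) = Idt B (fo (s a))" using B.F.fmap_Idt[of "s a"] a by simp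
    then show ?thesis using a by (simp add: lifted_odd Q.S.Idt_right)
  qed
  have i: "fmap lifted a (s a) (zeta_inv P a) \<in> carrier (Mor B (fo a) (fo (s a)))"
    using L.F.fmap_carrier[of a "s a" "zeta_inv P a"] a by simp
  have "Cmp B (fo (s a)) (fo a) (fo (s a)) (fmap lifted a (s a) (zeta_inv P a)) (theta a) = Idt B (fo (s a))"
    using a L.F.fmap_Cmp[of "s a" a "s a" "zeta P a" "zeta_inv P a"] L.F.fmap_Idt[of "s a"] by (simp add: th)
  then have "Cmp B (t (fo a)) (fo (s a)) (fo (s a)) (Cmp B (fo (s a)) (fo a) (fo (s a))
      (fmap lifted a (s a) (zeta_inv P a)) (theta a)) (\<beta> a) = \<beta> a"
    using a by (simp add: Q.S.Idt_left)
  then show "beta P Q lifted a = \<beta> a"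
    using a i by (simp add: L.beta_eq Q.S.Cmp_assoc theta_beta)
qed

end

lemma underlying_full:
  assumes "pi_supercategory K P" "pi_supercategory K Q" "pi_functor K (underlying P) (underlying Q) F \<beta>"
  shows "\<exists>G. superfunctor K (scat P) (scat Q) G \<and> underlying_map (scat P) G = F \<and> beta P Q G = \<beta>"
proof -
  interpret underlying_pi_functor K P Q F \<beta>
    using assms by (simp add: underlying_pi_functor_def underlying_pi_functor_axioms_def)
  show ?thesis using superfunctor_lifted underlying_map_lifted beta_lifted by blast
qed

section \<open>Essential surjectivity\<close>

lemma (in linear_functor) fmap_zero [simp]:
  "\<lbrakk>a \<in> Ob A; b \<in> Ob A\<rbrakk> \<Longrightarrow> fmap F a b \<zero>\<^bsub>Mor A a b\<^esub> = \<zero>\<^bsub>Mor B (fob F a) (fob F b)\<^esub>"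
  using fmap_smult[of a b "\<zero>" "\<zero>\<^bsub>Mor A a b\<^esub>"] by (simp flip: A.Mor_null_smult B.Mor_null_smult)

text \<open>Every \<open>\<Pi>\<close>-category \<open>C\<close> underlies the \<open>\<Pi>\<close>-supercategory with the same objects, even morphisms
  \<open>C(a, b)\<close> and odd morphisms \<open>C(a, \<Pi> b)\<close>. The sign in the composite \<open>- \<xi> \<Pi>(g) f\<close> of two odd morphisms is
  forced by \<open>\<xi> = \<zeta>\<zeta>\<close> and the odd parity of \<open>\<zeta>\<close>. Objects and morphisms have fixed types
  in this category of categories, so an injection \<open>e\<close> encodes pairs of morphisms in the original type.\<close>

locale pi_category_doubling = pi_category K P for K :: "'k ring" and P :: "('o, 'k, 'm) pi_cat" +
  fixes e :: "'m \<times> 'm \<Rightarrow> 'm"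
  assumes inj: "inj e"
begin

abbreviation ev :: "'m \<Rightarrow> 'm" where "ev x \<equiv> fst (inv_into UNIV e x)"
abbreviation od :: "'m \<Rightarrow> 'm" where "od x \<equiv> snd (inv_into UNIV e x)"

lemma inv_e [simp]: "inv_into UNIV e (e x) = x"
  using inj by (rule inv_f_f)

lemma e_eq_iff [simp]: "e x = e y \<longleftrightarrow> x = y"
  using inj by (simp add: inj_eq)

definition doubled :: "('o, 'k, 'm) supercat" where
  "doubled = \<lparr>
    Ob = Ob C,
    Mor = (\<lambda>a b. \<lparr>
      carrier = e ` (carrier (Mor C a b) \<times> carrier (Mor C a (s b))),
      mult = undefined,
      one = undefined,
      zero = e (\<zero>\<^bsub>Mor C a b\<^esub>, \<zero>\<^bsub>Mor C a (s b)\<^esub>),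
      add = (\<lambda>x y. e (ev x \<oplus>\<^bsub>Mor C a b\<^esub> ev y, od x \<oplus>\<^bsub>Mor C a (s b)\<^esub> od y)),
      smult = (\<lambda>r x. e (r \<odot>\<^bsub>Mor C a b\<^esub> ev x, r \<odot>\<^bsub>Mor C a (s b)\<^esub> od x)),
      homog = (\<lambda>p. if p = 0 then e ` (carrier (Mor C a b) \<times> {\<zero>\<^bsub>Mor C a (s b)\<^esub>})
        else e ` ({\<zero>\<^bsub>Mor C a b\<^esub>} \<times> carrier (Mor C a (s b))))\<rparr>),
    Cmp = (\<lambda>a b c y x. e (
      Cmp C a b c (ev y) (ev x) \<oplus>\<^bsub>Mor C a c\<^esub>
        (\<ominus>\<^bsub>Mor C a c\<^esub> Cmp C a (s (s c)) c (xi P c) (Cmp C a (s b) (s (s c)) (sm b (s c) (od y)) (od x))),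
      Cmp C a (s b) (s c) (sm b c (ev y)) (od x) \<oplus>\<^bsub>Mor C a (s c)\<^esub> Cmp C a b (s c) (od y) (ev x))),
    Idt = (\<lambda>a. e (Idt C a, \<zero>\<^bsub>Mor C a (s a)\<^esub>))\<rparr>"

text \<open>The minus sign on odd parts is what supernaturality of an odd \<zeta> demands of the
  shift.\<close>

definition doubled_shift :: "('o, 'm, 'o, 'm) fctr" where
  "doubled_shift = \<lparr>fob = (\<lambda>a\<in>Ob C. s a),
    fmap = (\<lambda>a\<in>Ob C. \<lambda>b\<in>Ob C. \<lambda>x\<in>carrier (Mor doubled a b).
      e (sm a b (ev x), \<ominus>\<^bsub>Mor C (s a) (s (s b))\<^esub> sm a (s b) (od x)))\<rparr>"

text \<open>Odd morphisms from \<Pi> a to a are the elements of \<open>C(\<Pi> a, \<Pi> a)\<close>;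
  the identity among them is the canonical choice of \<zeta>.\<close>

definition doubled_pi :: "('o, 'k, 'm) pi_supercat" where
  "doubled_pi = \<lparr>scat = doubled, sshift = doubled_shift,
    zeta = (\<lambda>a\<in>Ob C. e (\<zero>\<^bsub>Mor C (s a) a\<^esub>, Idt C (s a)))\<rparr>"

section \<open>The doubled category is a supercategory\<close>

lemma doubled_simps [simp]:
  "Ob doubled = Ob C"
  "carrier (Mor doubled a b) = e ` (carrier (Mor C a b) \<times> carrier (Mor C a (s b)))"
  "zero (Mor doubled a b) = e (\<zero>\<^bsub>Mor C a b\<^esub>, \<zero>\<^bsub>Mor C a (s b)\<^esub>)"
  "e (f, g) \<oplus>\<^bsub>Mor doubled a b\<^esub> e (f', g') = e (f \<oplus>\<^bsub>Mor C a b\<^esub> f', g \<oplus>\<^bsub>Mor C a (s b)\<^esub> g')"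
  "r \<odot>\<^bsub>Mor doubled a b\<^esub> e (f, g) = e (r \<odot>\<^bsub>Mor C a b\<^esub> f, r \<odot>\<^bsub>Mor C a (s b)\<^esub> g)"
  "homog (Mor doubled a b) 0 = e ` (carrier (Mor C a b) \<times> {\<zero>\<^bsub>Mor C a (s b)\<^esub>})"
  "homog (Mor doubled a b) 1 = e ` ({\<zero>\<^bsub>Mor C a b\<^esub>} \<times> carrier (Mor C a (s b)))"
  "Cmp doubled a b c (e (f', g')) (e (f, g)) = e (
      Cmp C a b c f' f \<oplus>\<^bsub>Mor C a c\<^esub>
        (\<ominus>\<^bsub>Mor C a c\<^esub> Cmp C a (s (s c)) c (xi P c) (Cmp C a (s b) (s (s c)) (sm b (s c) g') g)),
      Cmp C a (s b) (s c) (sm b c f') g \<oplus>\<^bsub>Mor C a (s c)\<^esub> Cmp C a b (s c) g' f)"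
  "Idt doubled a = e (Idt C a, \<zero>\<^bsub>Mor C a (s a)\<^esub>)"
  by (simp_all add: doubled_def)

lemma doubled_pi_simps [simp]:
  "scat doubled_pi = doubled"
  "sshift doubled_pi = doubled_shift"
  "a \<in> Ob C \<Longrightarrow> zeta doubled_pi a = e (\<zero>\<^bsub>Mor C (s a) a\<^esub>, Idt C (s a))"
  "a \<in> Ob C \<Longrightarrow> fob doubled_shift a = s a"
  "\<lbrakk>a \<in> Ob C; b \<in> Ob C; f \<in> carrier (Mor C a b); g \<in> carrier (Mor C a (s b))\<rbrakk> \<Longrightarrow>
    fmap doubled_shift a b (e (f, g)) = e (sm a b f, \<ominus>\<^bsub>Mor C (s a) (s (s b))\<^esub> sm a (s b) g)"
  by (simp_all add: doubled_pi_def doubled_shift_def image_iff)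

text \<open>Naturality of \<xi> with a further factor on the right, so that it applies inside
  right-associated composites.\<close>

lemma xi_natural_left:
  assumes "a \<in> Ob C" "b \<in> Ob C" "c \<in> Ob C" "f \<in> carrier (Mor C a b)" "k \<in> carrier (Mor C c (s (s a)))"
  shows "Cmp C c (s (s b)) b (xi P b) (Cmp C c (s (s a)) (s (s b)) (sm (s a) (s b) (sm a b f)) k) =
    Cmp C c a b f (Cmp C c (s (s a)) a (xi P a) k)"
  using assms xi_natural[of a b f] by (simp flip: L.Cmp_assoc)

lemma superspace_doubled:
  assumes a: "a \<in> Ob C" and b: "b \<in> Ob C"
  shows "superspace K (Mor doubled a b)"
proof -
  have sb: "s b \<in> Ob C" using b by simp
  interpret M: module K "Mor C a b" using a b by (rule L.Mor_module)
  interpret N: module K "Mor C a (s b)" using a sb by (rule L.Mor_module)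
  have "abelian_group (Mor doubled a b)"
  proof (rule abelian_groupI)
    fix x assume "x \<in> carrier (Mor doubled a b)"
    then obtain f g where x: "x = e (f, g)" "f \<in> carrier (Mor C a b)" "g \<in> carrier (Mor C a (s b))" by auto
    show "\<exists>y\<in>carrier (Mor doubled a b). y \<oplus>\<^bsub>Mor doubled a b\<^esub> x = \<zero>\<^bsub>Mor doubled a b\<^esub>"
      by (rule bexI[of _ "e (\<ominus>\<^bsub>Mor C a b\<^esub> f, \<ominus>\<^bsub>Mor C a (s b)\<^esub> g)"]) (use x in \<open>auto simp: M.l_neg N.l_neg\<close>)
  qed (auto simp: M.a_ac N.a_ac)
  then have "module K (Mor doubled a b)"
    by (intro moduleI[OF L.is_cring]) (auto simp: M.smult_l_distr N.smult_l_distr M.smult_r_distr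
        N.smult_r_distr
        M.smult_assoc1 N.smult_assoc1)
  then interpret D: module K "Mor doubled a b" .
  show ?thesis
  proof (intro superspace.intro superspace_axioms.intro)
    show "field K" by (rule L.field_axioms)
    show "module K (Mor doubled a b)" by (rule D.module_axioms)
    show "submodule (homog (Mor doubled a b) p) K (Mor doubled a b)" for p
      by (cases p; rule D.submoduleI_smult) auto
    show "homog (Mor doubled a b) 0 \<inter> homog (Mor doubled a b) 1 = {\<zero>\<^bsub>Mor doubled a b\<^esub>}"
      by auto
    fix v assume "v \<in> carrier (Mor doubled a b)"
    then obtain f g where v: "v = e (f, g)" "f \<in> carrier (Mor C a b)" "g \<in> carrier (Mor C a (s b))" by auto
    show "\<exists>u\<in>homog (Mor doubled a b) 0. \<exists>w\<in>homog (Mor doubled a b) 1. v = u \<oplus>\<^bsub>Mor doubled a b\<^esub> w"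
      by (rule bexI[of _ "e (f, \<zero>\<^bsub>Mor C a (s b)\<^esub>)"], rule bexI[of _ "e (\<zero>\<^bsub>Mor C a b\<^esub>, g)"]) (use v in auto)
  qed
qed

lemma neg_doubled:
  assumes ab: "a \<in> Ob C" "b \<in> Ob C" and fg: "f \<in> carrier (Mor C a b)" "g \<in> carrier (Mor C a (s b))"
  shows "\<ominus>\<^bsub>Mor doubled a b\<^esub> e (f, g) = e (\<ominus>\<^bsub>Mor C a b\<^esub> f, \<ominus>\<^bsub>Mor C a (s b)\<^esub> g)"
proof -
  have sb: "s b \<in> Ob C" using ab by simp
  interpret D: superspace K "Mor doubled a b" using ab by (rule superspace_doubled)
  show ?thesis
    using ab sb fg abelian_group.l_neg[OF L.Mor_abelian_group[OF ab] fg(1)]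
      abelian_group.l_neg[OF L.Mor_abelian_group[OF ab(1) sb] fg(2)]
    by (intro D.minus_equality) auto
qed

lemmas expand = L.Cmp_add_left L.Cmp_add_right L.Cmp_neg_left L.Cmp_neg_right L.Cmp_closed Sh.fmap_add
    Sh.fmap_neg
  Sh.fmap_Cmp L.Mor_neg_add

text \<open>Expanded by parity, only terms with at least two odd factors contain \<xi>. Naturality
  of \<xi> moves it past h0 in the term of h0, g1, f1. The term with three odd factors has \<Pi>
  \<xi> on one side and \<xi> before h1 on the other, so it needs naturality together with \<xi>
  \<Pi> = \<Pi> \<xi>.\<close>

lemma doubled_assoc:
  assumes o: "a \<in> Ob C" "b \<in> Ob C" "c \<in> Ob C" "d \<in> Ob C"
    and f: "f0 \<in> carrier (Mor C a b)" "f1 \<in> carrier (Mor C a (s b))"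
    and g: "g0 \<in> carrier (Mor C b c)" "g1 \<in> carrier (Mor C b (s c))"
    and h: "h0 \<in> carrier (Mor C c d)" "h1 \<in> carrier (Mor C c (s d))"
  shows "Cmp doubled a b d (Cmp doubled b c d (e (h0, h1)) (e (g0, g1))) (e (f0, f1)) =
    Cmp doubled a c d (e (h0, h1)) (Cmp doubled a b c (e (g0, g1)) (e (f0, f1)))"
proof -
  have sd: "s d \<in> Ob C" using o by simp
  interpret M: module K "Mor C a d" using o by (simp add: L.Mor_module)
  interpret N: module K "Mor C a (s d)" using o by (simp add: L.Mor_module)
  show ?thesis
    using assms by (simp add: expand L.Cmp_assoc xi_natural_left fmap_xi M.a_ac N.a_ac)
qed

lemma supercategory_doubled: "supercategory K doubled"
proof (intro supercategory.intro linear_category.intro category.intro linear_category_axioms.intro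
    supercategory_axioms.intro L.field_axioms)
  fix a b c d x y z
  assume "a \<in> Ob doubled" "b \<in> Ob doubled" "c \<in> Ob doubled" "d \<in> Ob doubled"
    "x \<in> carrier (Mor doubled a b)" "y \<in> carrier (Mor doubled b c)" "z \<in> carrier (Mor doubled c d)"
  then show "Cmp doubled a b d (Cmp doubled b c d z y) x = Cmp doubled a c d z (Cmp doubled a b c y x)"
    using doubled_assoc by (auto simp del: doubled_simps(8))
next
  fix a b assume "a \<in> Ob doubled" "b \<in> Ob doubled"
  then show "superspace K (Mor doubled a b)" by (simp add: superspace_doubled)
  then show "module K (Mor doubled a b)" by (rule superspace.axioms(2))
next
  fix a b c x y p q
  assume "a \<in> Ob doubled" "b \<in> Ob doubled" "c \<in> Ob doubled"
    "x \<in> homog (Mor doubled a b) p" "y \<in> homog (Mor doubled b c) q"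
  then show "Cmp doubled a b c y x \<in> homog (Mor doubled a c) (p + q)"
    by (cases p; cases q) (auto simp: L.Cmp_closed)
next
  fix a b c x y y'
  assume *: "a \<in> Ob doubled" "b \<in> Ob doubled" "c \<in> Ob doubled"
    "x \<in> carrier (Mor doubled a b)" "y \<in> carrier (Mor doubled b c)" "y' \<in> carrier (Mor doubled b c)"
  interpret M: module K "Mor C a c" using * by (simp add: L.Mor_module)
  interpret N: module K "Mor C a (s c)" using * by (simp add: L.Mor_module)
  show "Cmp doubled a b c (y \<oplus>\<^bsub>Mor doubled b c\<^esub> y') x =
      Cmp doubled a b c y x \<oplus>\<^bsub>Mor doubled a c\<^esub> Cmp doubled a b c y' x"
    using * by (auto simp: expand M.a_ac N.a_ac)
next
  fix a b c x x' y
  assume *: "a \<in> Ob doubled" "b \<in> Ob doubled" "c \<in> Ob doubled"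
    "x \<in> carrier (Mor doubled a b)" "x' \<in> carrier (Mor doubled a b)" "y \<in> carrier (Mor doubled b c)"
  interpret M: module K "Mor C a c" using * by (simp add: L.Mor_module)
  interpret N: module K "Mor C a (s c)" using * by (simp add: L.Mor_module)
  show "Cmp doubled a b c y (x \<oplus>\<^bsub>Mor doubled a b\<^esub> x') =
      Cmp doubled a b c y x \<oplus>\<^bsub>Mor doubled a c\<^esub> Cmp doubled a b c y x'"
    using * by (auto simp: expand M.a_ac N.a_ac)
qed (auto simp: L.Idt_closed L.Cmp_closed L.Idt_left L.Idt_right Sh.fmap_Idt
    L.Cmp_smult_left L.Cmp_smult_right Sh.fmap_smult L.Mor_smult_neg L.Mor_smult_add)

section \<open>The shift and \<zeta> on the doubled category\<close>

sublocale D: supercategory K doubled by (rule supercategory_doubled)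

text \<open>For two odd morphisms the signs introduced by the shift cancel, and \<Pi> \<xi> = \<xi>
  \<Pi> identifies what remains.\<close>

lemma superfunctor_doubled_shift: "superfunctor K doubled doubled doubled_shift"
proof (rule superfunctorI)
  show "fob doubled_shift \<in> Ob doubled \<rightarrow>\<^sub>E Ob doubled" by (auto simp: doubled_shift_def)
  show "fmap doubled_shift \<in> (\<Pi>\<^sub>E a\<in>Ob doubled. \<Pi>\<^sub>E b\<in>Ob doubled. carrier (Mor doubled a b) \<rightarrow>\<^sub>E
      carrier (Mor doubled (fob doubled_shift a) (fob doubled_shift b)))"
    by (auto simp: doubled_shift_def)
next
  fix a b p x assume *: "a \<in> Ob doubled" "b \<in> Ob doubled" "x \<in> homog (Mor doubled a b) p"
  then show "fmap doubled_shift a b x \<in> homog (Mor doubled (fob doubled_shift a) (fob doubled_shift b)) p"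
    by (cases p) auto
next
  fix a b c p q x y
  assume *: "a \<in> Ob doubled" "b \<in> Ob doubled" "c \<in> Ob doubled"
    "x \<in> homog (Mor doubled a b) p" "y \<in> homog (Mor doubled b c) q"
  then have "x \<in> carrier (Mor doubled a b)" "y \<in> carrier (Mor doubled b c)"
    using D.homog_carrier by blast+
  then show "fmap doubled_shift a c (Cmp doubled a b c y x) =
    Cmp doubled (fob doubled_shift a) (fob doubled_shift b) (fob doubled_shift c) (fmap doubled_shift b c y)
        (fmap doubled_shift a b x)"
    using *(1-3) by (auto simp: expand fmap_xi)
qed (auto simp: supercategory_doubled L.Idt_closed Sh.fmap_Idt Sh.fmap_add Sh.fmap_smult L.Mor_neg_add
    L.Mor_smult_neg)

sublocale DSh: superfunctor K doubled doubled doubled_shift by (rule superfunctor_doubled_shift)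

lemma pi_supercategory_doubled: "pi_supercategory K doubled_pi"
proof -
  interpret Z: parallel_superfunctors K doubled doubled doubled_shift "id_functor doubled"
    by (simp add: parallel_superfunctors_def superfunctor_doubled_shift superfunctor_id supercategory_doubled)
  have "supernatural_iso_of_parity 1 doubled doubled doubled_shift (id_functor doubled) (zeta doubled_pi)"
    unfolding supernatural_iso_of_parity_def Z.supernatural_of_parity_iff
  proof (intro conjI ballI allI)
    show "zeta doubled_pi \<in> families doubled doubled doubled_shift (id_functor doubled)"
      by (auto simp: families_def L.Idt_closed) (simp add: doubled_pi_def)
    fix a assume "a \<in> Ob doubled"
    then have a: "a \<in> Ob C" by simp
    show "zeta doubled_pi a \<in> homog (Mor doubled (fob doubled_shift a) (fob (id_functor doubled) a)) 1"
      using a by (auto simp: L.Idt_closed)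
    have sa: "s (s a) \<in> Ob C" using a by simp
    \<comment> \<open>The inverse of \<zeta> at a will be the odd morphism given by minus this; the
      sign compensates the one in the composite of two odd morphisms.\<close>
    let ?i = "inv_mor C (s (s a)) a (xi P a)"
    note i = L.inv_mor_closed[OF sa a xi_iso_mor[OF a]] L.inv_mor_left[OF sa a xi_iso_mor[OF a]]
      L.inv_mor_right[OF sa a xi_iso_mor[OF a]]
    \<comment> \<open>One of the two composites to be checked applies \<Pi> to the inverse of \<xi>
      and then \<xi> at \<Pi> a; the axiom \<xi> \<Pi> = \<Pi> \<xi> reduces it to an
      identity.\<close>
    have si: "Cmp C (s a) (s (s (s a))) (s a) (xi P (s a)) (sm a (s (s a)) ?i) = Idt C (s a)"
      using a i Sh.fmap_Cmp[of a "s (s a)" a ?i "xi P a", symmetric] by (simp add: fmap_xi Sh.fmap_Idt)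
    show "iso_mor doubled (fob doubled_shift a) (fob (id_functor doubled) a) (zeta doubled_pi a)"
      by (rule D.iso_morI[of _ _ _ "e (\<zero>\<^bsub>Mor C a (s a)\<^esub>, \<ominus>\<^bsub>Mor C a (s (s a))\<^esub> ?i)"])
        (use a i si in \<open>auto simp: L.Idt_closed L.Idt_left L.Idt_right Sh.fmap_Idt expand\<close>)
    fix b q x assume "b \<in> Ob doubled" "x \<in> homog (Mor doubled a b) q"
    then show "Cmp doubled (fob doubled_shift a) (fob doubled_shift b) (fob (id_functor doubled) b)
        (zeta doubled_pi b) (fmap doubled_shift a b x) =
      koszul (Mor doubled (fob doubled_shift a) (fob (id_functor doubled) b)) (1 * q)
       (Cmp doubled (fob doubled_shift a) (fob (id_functor doubled) a) (fob (id_functor doubled) b)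
         (fmap (id_functor doubled) a b x) (zeta doubled_pi a))"
      using a by (cases q) (auto simp: koszul_def neg_doubled L.Idt_closed L.Idt_left L.Idt_right
          Sh.fmap_Idt expand)
  qed
  then show ?thesis
    by (intro pi_supercategory.intro) (simp_all add: superfunctor_doubled_shift supercategory_doubled)
qed

sublocale DP: pi_supercategory K doubled_pi by (rule pi_supercategory_doubled)

text \<open>The minus sign of the shift on odd morphisms cancels that of the composite of two odd
  morphisms, so the original \<xi> is recovered and not its negative.\<close>

lemma xi_doubled: "a \<in> Ob C \<Longrightarrow> xi (underlying doubled_pi) a = e (xi P a, \<zero>\<^bsub>Mor C (s (s a)) (s a)\<^esub>)"
  by (simp add: L.Idt_closed Sh.fmap_Idt L.Idt_right expand)

section \<open>Comparison with the given \<Pi>-category\<close>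

definition decode :: "('o, 'm, 'o, 'm) fctr" where
  "decode = \<lparr>fob = (\<lambda>a\<in>Ob C. a), fmap = (\<lambda>a\<in>Ob C. \<lambda>b\<in>Ob C. \<lambda>x\<in>homog (Mor doubled a b) 0. ev x)\<rparr>"

definition encode :: "('o, 'm, 'o, 'm) fctr" where
  "encode = \<lparr>fob = (\<lambda>a\<in>Ob C. a),
    fmap = (\<lambda>a\<in>Ob C. \<lambda>b\<in>Ob C. \<lambda>f\<in>carrier (Mor C a b). e (f, \<zero>\<^bsub>Mor C a (s b)\<^esub>))\<rparr>"

lemma code_simps [simp]:
  "a \<in> Ob C \<Longrightarrow> fob decode a = a"
  "a \<in> Ob C \<Longrightarrow> fob encode a = a"
  "\<lbrakk>a \<in> Ob C; b \<in> Ob C; f \<in> carrier (Mor C a b)\<rbrakk> \<Longrightarrow> fmap decode a b (e (f, \<zero>\<^bsub>Mor C a (s b)\<^esub>)) = f"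
  "\<lbrakk>a \<in> Ob C; b \<in> Ob C; f \<in> carrier (Mor C a b)\<rbrakk> \<Longrightarrow> fmap encode a b f = e (f, \<zero>\<^bsub>Mor C a (s b)\<^esub>)"
  by (simp_all add: decode_def encode_def image_iff)

lemma linear_functor_decode: "linear_functor K (underlying_cat doubled) C decode"
proof -
  interpret U: linear_category K "underlying_cat doubled"
    using supercategory_doubled by (rule linear_category_underlying_cat)
  show ?thesis
  proof (intro linear_functor.intro is_functor.intro is_functor_axioms.intro linear_functor_axioms.intro
      U.linear_category_axioms L.linear_category_axioms U.category_axioms L.category_axioms)
    show "fob decode \<in> Ob (underlying_cat doubled) \<rightarrow>\<^sub>E Ob C" by (auto simp: decode_def)
    show "fmap decode \<in> (\<Pi>\<^sub>E a\<in>Ob (underlying_cat doubled). \<Pi>\<^sub>E b\<in>Ob (underlying_cat doubled).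
        carrier (Mor (underlying_cat doubled) a b) \<rightarrow>\<^sub>E carrier (Mor C (fob decode a) (fob decode b)))"
      by (auto simp: decode_def)
  qed (auto simp: L.Idt_closed L.Cmp_closed)
qed

lemma linear_functor_encode: "linear_functor K C (underlying_cat doubled) encode"
proof -
  interpret U: linear_category K "underlying_cat doubled"
    using supercategory_doubled by (rule linear_category_underlying_cat)
  show ?thesis
  proof (intro linear_functor.intro is_functor.intro is_functor_axioms.intro linear_functor_axioms.intro
      U.linear_category_axioms L.linear_category_axioms U.category_axioms L.category_axioms)
    show "fob encode \<in> Ob C \<rightarrow>\<^sub>E Ob (underlying_cat doubled)" by (auto simp: encode_def)
    show "fmap encode \<in> (\<Pi>\<^sub>E a\<in>Ob C. \<Pi>\<^sub>E b\<in>Ob C.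
        carrier (Mor C a b) \<rightarrow>\<^sub>E carrier (Mor (underlying_cat doubled) (fob encode a) (fob encode b)))"
      by (auto simp: encode_def)
  qed (auto simp: L.Idt_closed L.Cmp_closed)
qed

text \<open>Passing between a morphism and its code commutes strictly with the shift, so identities
  serve as structure isomorphisms.\<close>

definition "decode_beta = (\<lambda>a\<in>Ob C. Idt C (s a))"
definition "encode_beta = (\<lambda>a\<in>Ob C. Idt doubled (s a))"

lemma pi_functor_decode: "pi_functor K (underlying doubled_pi) P decode decode_beta"
  unfolding pi_functor_eq_laws
proof (intro pi_functor_laws.intro pi_functor_laws_axioms.intro,
    unfold underlying_simps(1,2) underlying_map_simps(1) underlying_cat_simps doubled_pi_simps(1,2)
        doubled_simps(1))
  show "pi_category K (underlying doubled_pi)" by (rule DP.pi_category_underlying)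
  fix a assume a: "a \<in> Ob C"
  let ?t = "fob doubled_shift"
  show "Cmp C (s (s (fob decode a))) (fob decode (?t (?t a))) (fob decode a)
      (fmap decode (?t (?t a)) a (xi (underlying doubled_pi) a))
      (Cmp C (s (s (fob decode a))) (s (fob decode (?t a))) (fob decode (?t (?t a))) (decode_beta (?t a))
        (sm (s (fob decode a)) (fob decode (?t a)) (decode_beta a))) = xi P (fob decode a)"
    using a xi_doubled[OF a] by (simp add: decode_beta_def L.Idt_closed Sh.fmap_Idt L.Idt_left L.Idt_right
        del: underlying_simps(3))
qed (auto simp: decode_beta_def L.Idt_left L.Idt_right L.iso_mor_Idt pi_category_axioms linear_functor_decode)

lemma pi_functor_encode: "pi_functor K P (underlying doubled_pi) encode encode_beta"
  unfolding pi_functor_eq_laws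
proof (intro pi_functor_laws.intro pi_functor_laws_axioms.intro,
    unfold underlying_simps(1,2) underlying_map_simps(1) underlying_cat_simps doubled_pi_simps(1,2)
        doubled_simps(1))
  interpret U: linear_category K "underlying_cat doubled"
    using supercategory_doubled by (rule linear_category_underlying_cat)
  show "pi_category K (underlying doubled_pi)" by (rule DP.pi_category_underlying)
  fix a assume a: "a \<in> Ob C"
  let ?t = "fob doubled_shift" and ?S = "fmap (underlying_map doubled doubled_shift)"
  show "iso_mor (underlying_cat doubled) (?t (fob encode a)) (fob encode (s a)) (encode_beta a)"
    using a U.iso_mor_Idt[of "s a"] by (simp add: encode_beta_def)
  show "Cmp doubled (?t (?t (fob encode a))) (fob encode (s (s a))) (fob encode a)
      (fmap encode (s (s a)) a (xi P a))
      (Cmp doubled (?t (?t (fob encode a))) (?t (fob encode (s a))) (fob encode (s (s a))) (encode_beta (s a))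
        (?S (?t (fob encode a)) (fob encode (s a)) (encode_beta a)))
            = xi (underlying doubled_pi) (fob encode a)"
    using a xi_doubled[OF a] by (simp add: encode_beta_def L.Idt_closed Sh.fmap_Idt L.Idt_left L.Idt_right
        del: underlying_simps(3))
qed (auto simp: encode_beta_def L.Idt_closed Sh.fmap_Idt L.Idt_left L.Idt_right pi_category_axioms
    linear_functor_encode)

text \<open>Even morphisms of the doubled category are codes of pairs with second entry zero. The
  underlying \<Pi>-category thus agrees with \<open>P\<close> up to relabelling of morphisms, which
  is an isomorphism and all that essential surjectivity asks for.\<close>

lemma underlying_doubled_iso: "iso_mor (PiCat K) (underlying doubled_pi) P (decode, decode_beta)"
proof -
  note comp = pi_functor_comp[OF pi_functor_decode pi_functor_encode] pi_functor_comp[OF pi_functor_encode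
      pi_functor_decode]
  have "comp_functor (lcat (underlying doubled_pi)) encode decode = id_functor (lcat (underlying doubled_pi))"
    by (rule functor_eqI[OF comp(1)[THEN pi_functor_is_functor]
          pi_functor_id[OF DP.pi_category_underlying, THEN pi_functor_is_functor]]) auto
  moreover have "comp_functor C decode encode = id_functor C"
    by (rule functor_eqI[OF comp(2)[THEN pi_functor_is_functor] pi_functor_id[OF pi_category_axioms, THEN
        pi_functor_is_functor]]) auto
  moreover have "comp_beta (underlying doubled_pi) P (underlying doubled_pi) encode encode_beta decode
      decode_beta =
      id_trans (lcat (underlying doubled_pi)) (lcat (underlying doubled_pi)) (lshift (underlying doubled_pi))"
    unfolding comp_beta_eq[OF pi_functor_decode pi_functor_encode] id_trans_def
    by (rule restrict_ext) (simp add: decode_beta_def encode_beta_def L.Idt_closed L.Idt_left Sh.fmap_Idt)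
  moreover have "comp_beta P (underlying doubled_pi) P decode decode_beta encode encode_beta
      = id_trans C C (lshift P)"
    unfolding comp_beta_eq[OF pi_functor_encode pi_functor_decode] id_trans_def
    by (rule restrict_ext) (simp add: decode_beta_def encode_beta_def L.Idt_closed L.Idt_left)
  ultimately show ?thesis
    using pi_functor_decode pi_functor_encode unfolding iso_mor_def
    by (auto intro!: bexI[of _ "(encode, encode_beta)"])
qed

end

section \<open>Assembling the equivalence\<close>

lemma underlying_surj:
  fixes P :: "('u, 'k, 'v) pi_cat"
  assumes "infinite (UNIV :: 'v set)" and P: "pi_category K P"
  shows "\<exists>Q :: ('u, 'k, 'v) pi_supercat. pi_supercategory K Q \<and> (\<exists>h. iso_mor (PiCat K) (underlying Q) P h)"
proof -
  \<comment> \<open>An infinite set is equipotent with its square, which provides the coding of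
    pairs of morphisms.\<close>
  obtain e :: "'v \<times> 'v \<Rightarrow> 'v" where "inj e"
    using card_of_Times_same_infinite[OF assms(1)] unfolding card_of_ordIso[symmetric] UNIV_Times_UNIV
        bij_betw_def by blast
  then interpret pi_category_doubling K P e
    using P by (simp add: pi_category_doubling_def pi_category_doubling_axioms_def)
  show ?thesis using pi_supercategory_doubled underlying_doubled_iso by blast
qed

lemma cat_equivalence_underlying:
  assumes "infinite (UNIV :: 'v set)"
  shows "cat_equivalence (PiSCat K :: (('u, 'k, 'v) pi_supercat, ('u, 'v, 'u, 'v) fctr) ordinary_cat)
    (PiCat K) (underlying_functor K)"
proof (rule cat_equivalenceI[OF is_functor_underlying])
  fix P Q :: "('u, 'k, 'v) pi_supercat" and h
  assume "P \<in> Ob (PiSCat K)" "Q \<in> Ob (PiSCat K)"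
    "h \<in> carrier (Mor (PiCat K) (fob (underlying_functor K) P) (fob (underlying_functor K) Q))"
  then show "\<exists>F\<in>carrier (Mor (PiSCat K) P Q). fmap (underlying_functor K) P Q F = h"
    using underlying_full[of K P Q "fst h" "snd h"] by (fastforce simp: underlying_functor_def)
next
  fix P Q :: "('u, 'k, 'v) pi_supercat" and F G
  assume "P \<in> Ob (PiSCat K)" "Q \<in> Ob (PiSCat K)" "F \<in> carrier (Mor (PiSCat K) P Q)" "G
      \<in> carrier (Mor (PiSCat K) P Q)"
    "fmap (underlying_functor K) P Q F = fmap (underlying_functor K) P Q G"
  then show "F = G"
    using underlying_faithful[of K P Q F G] by (simp add: underlying_functor_def)
next
  fix P :: "('u, 'k, 'v) pi_cat"
  assume "P \<in> Ob (PiCat K)"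
  then show "\<exists>Q\<in>Ob (PiSCat K). \<exists>h. iso_mor (PiCat K) (fob (underlying_functor K) Q) P h"
    using underlying_surj[OF assms, of K P] by (auto simp: underlying_functor_def)
qed

theorem theorem1p9:
  fixes K :: "'k ring"
  assumes "field K" and "\<one>\<^bsub>K\<^esub> \<oplus>\<^bsub>K\<^esub> \<one>\<^bsub>K\<^esub> \<noteq> \<zero>\<^bsub>K\<^esub>"
    and "infinite (UNIV :: 'v set)"
  shows "(is_functor
            (SCat K :: (('o, 'k, 'm) supercat, ('o, 'm, 'o, 'm) fctr) ordinary_cat)
            (PiSCat K :: (('o \<times> bit, 'k, 'm) pi_supercat,
               ('o \<times> bit, 'm, 'o \<times> bit, 'm) fctr) ordinary_cat)
            (envelope_functor K) \<and>
          is_functor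
            (PiSCat K :: (('p, 'k, 'n) pi_supercat, ('p, 'n, 'p, 'n) fctr) ordinary_cat)
            (SCat K :: (('p, 'k, 'n) supercat, ('p, 'n, 'p, 'n) fctr) ordinary_cat)
            (forget K) \<and>
          (\<forall>A \<in> Ob (SCat K :: (('o, 'k, 'm) supercat, ('o, 'm, 'o, 'm) fctr) ordinary_cat).
           \<forall>B \<in> Ob (PiSCat K :: (('p, 'k, 'n) pi_supercat, ('p, 'n, 'p, 'n) fctr) ordinary_cat).
             \<exists>\<Phi>. superequivalence K
                   (hom_supercat K A (fob (forget K) B))
                   (hom_supercat K (scat (fob (envelope_functor K) A)) (scat B)) \<Phi>))
       \<and> cat_equivalence
            (PiSCat K :: (('u, 'k, 'v) pi_supercat, ('u, 'v, 'u, 'v) fctr) ordinary_cat)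
            (PiCat K :: (('u, 'k, 'v) pi_cat, ('u, 'v, 'u, 'v) fctr \<times> ('u \<Rightarrow> 'v)) ordinary_cat)
            (underlying_functor K)"
proof (intro conjI ballI)
  show "is_functor (SCat K) (PiSCat K) (envelope_functor K)" by (rule is_functor_envelope)
  show "is_functor (PiSCat K) (SCat K) (forget K)" by (rule is_functor_forget)
next
  fix A :: "('o, 'k, 'm) supercat" and B :: "('p, 'k, 'n) pi_supercat"
  assume "A \<in> Ob (SCat K)" "B \<in> Ob (PiSCat K)"
  then show "\<exists>\<Phi>. superequivalence K (hom_supercat K A (fob (forget K) B))
      (hom_supercat K (scat (fob (envelope_functor K) A)) (scat B)) \<Phi>"
    using superequivalence_extension[of K A B] by (auto simp: forget_def envelope_functor_def)
qed (rule cat_equivalence_underlying[OF assms(3)])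

end
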